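(* Let $\mathbb{A}$ be an algebraically coherent semi-abelian category. For any pair of abelian objects $M$ and $N$ of $\mathbb{A}$ acting trivially on one another, so that $M\otimes N$ denotes the non-abelian tensor product of the internal crossed modules $M\to 0$ and $N\to 0$ over the zero object (with trivial actions), one has $M\otimes N\cong M\diamond_2 N$, where $M\diamond_2 N$ is the cosmash product of $M$ and $N$ computed in the 2-nilpotent core $\mathbf{Nil}_2(\mathbb{A})$ of $\mathbb{A}$.
   Context: A semi-abelian category is a pointed, Barr exact, Bourn protomodular category with binary coproducts. $\binom{f}{g}\colon A+B\to C$ is the arrow induced on a coproduct, $\langle f,g\rangle$ the arrow into a product, $k_f\colon K_f\to A$ the kernel of $f\colon A\to B$, and $X\flat Y$ is the kernel of $\binom{1_X}{0}\colon X+Y\to X$. The category $\mathbb{A}$ is algebraically coherent when for all $X,Y,Z$ the comparison morphism $\binom{1_X\flat \iota_Y}{1_X\flat\iota_Z}\colon X\flat Y+X\flat Z\to X\flat(Y+Z)$ is a regular epimorphism (such categories satisfy the Smith is Huq condition: the Smith-Pedicchio commutator of two internal equivalence relations vanishes if and only if the Huq commutator of the associated normal subobjects vanishes). Cosmash products and Higgins commutators. In a category with kernels, finite products and coproducts, the cosmash product $A\diamond B$ is the kernel of $\binom{\langle 1_A,0\rangle}{\langle 0,1_B\rangle}\colon A+B\to A\times B$. The ternary cosmash product $A\diamond B\diamond C$ is the kernel of the canonical morphism $A+B+C\to (A+B)\times(A+C)\times(B+C)$ whose components are induced by killing $C$, $B$, $A$ respectively. For subobjects $K,M,N$ of $X$,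 the Higgins commutator $[M,N]\leq X$ is the image of $M\diamond N\to M+N\to X$, and $[K,M,N]\leq X$ is the image of $K\diamond M\diamond N\to K+M+N\to X$. The Huq commutator $[M,N]^{\mathcal Q}_X$ is the normal closure of $[M,N]$ in $X$. An object $A$ is abelian when $[A,A]=0$. $\mathbf{Nil}_2(\mathbb{A})$ is the full (Birkhoff) subcategory of $\mathbb{A}$ of the objects $A$ with $[A,A,A]=0$; its reflector is $A\mapsto A/[A,A,A]$. $M\diamond_2 N$ is the kernel in $\mathbf{Nil}_2(\mathbb{A})$ of the canonical morphism $M+_2N\to M\times N$, where $+_2$ is the coproduct in $\mathbf{Nil}_2(\mathbb{A})$. Non-abelian tensor product over $L=0$. For an abelian object $X$, the crossed module $X\to 0$ corresponds to the internal groupoid $X\rightrightarrows 0$. In general, the tensor product of two $L$-crossed modules $M\to L$, $N\to L$ with associated internal groupoids $(M\rtimes L,L,d_M,c_M,e_M)$ and $(N\rtimes L,L,d_N,c_N,e_N)$ (domain, codomain, identities) is obtained as follows. Let $Q$ be the pushout of $e_M$ and $e_N$, with coproduct-like injections $e_U\colon M\rtimes L\to Q$ and $e_L\colon N\rtimes L\to Q$; let $d_U,c_U\colon Q\to M\rtimes L$ be determined by $d_Ue_U=1=c_Ue_U$, $d_Ue_L=e_Md_N$, $c_Ue_L=e_Mc_N$, and $d_L,c_L\colon Q\to N\rtimes L$ by $d_Le_L=1=c_Le_L$, $d_Le_U=e_Nd_M$, $c_Le_U=e_Nc_M$. Put $Q_{M\otimes N}=Q/\bigl([K_{d_L},K_{c_L}]^{\mathcal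 Q}_Q\vee[K_{d_U},K_{c_U}]^{\mathcal Q}_Q\bigr)$, with induced morphisms $\overline{d_U}\colon Q_{M\otimes N}\to M\rtimes L$ and $\overline{d_L}\colon Q_{M\otimes N}\to N\rtimes L$. Then $M\otimes N=K_{\overline{d_U}}\wedge K_{\overline{d_L}}$. Here this is applied with $L=0$, $M\rtimes L=M$, $N\rtimes L=N$, $Q=M+N$. *)

theory Defs
  imports Main
begin

section \<open>Categories\<close>

record ('o, 'a) cat =
  Obj :: "'o set"
  Arr :: "'a set"
  Dom :: "'a \<Rightarrow> 'o"
  Cod :: "'a \<Rightarrow> 'o"
  Ide :: "'o \<Rightarrow> 'a"
  Cmp :: "'a \<Rightarrow> 'a \<Rightarrow> 'a"  (infixl "\<cdot>\<index>" 70)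

definition hom :: "('o, 'a) cat \<Rightarrow> 'o \<Rightarrow> 'o \<Rightarrow> 'a set" where
  "hom C A B = {f \<in> Arr C. Dom C f = A \<and> Cod C f = B}"

locale category =
  fixes C :: "('o, 'a) cat" (structure)
  assumes dom_in_Obj: "f \<in> Arr C \<Longrightarrow> Dom C f \<in> Obj C"
    and cod_in_Obj: "f \<in> Arr C \<Longrightarrow> Cod C f \<in> Obj C"
    and ide_in_hom: "A \<in> Obj C \<Longrightarrow> Ide C A \<in> hom C A A"
    and cmp_in_hom: "\<lbrakk>f \<in> hom C A B; g \<in> hom C B D\<rbrakk> \<Longrightarrow> g \<cdot> f \<in> hom C A D"
    and cmp_ide_left: "f \<in> hom C A B \<Longrightarrow> Ide C B \<cdot> f = f"
    and cmp_ide_right: "f \<in> hom C A B \<Longrightarrow> f \<cdot> Ide C A = f"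
    and cmp_assoc: "\<lbrakk>f \<in> hom C A B; g \<in> hom C B D; h \<in> hom C D E\<rbrakk>
                      \<Longrightarrow> (h \<cdot> g) \<cdot> f = h \<cdot> (g \<cdot> f)"

definition full_subcat :: "('o, 'a) cat \<Rightarrow> 'o set \<Rightarrow> ('o, 'a) cat" where
  "full_subcat C S = C\<lparr>Obj := Obj C \<inter> S,
                       Arr := {f \<in> Arr C. Dom C f \<in> S \<and> Cod C f \<in> S}\<rparr>"

definition is_mono :: "('o, 'a) cat \<Rightarrow> 'a \<Rightarrow> bool" where
  "is_mono C m \<longleftrightarrow> m \<in> Arr C \<and>
     (\<forall>X. \<forall>f \<in> hom C X (Dom C m). \<forall>g \<in> hom C X (Dom C m).
        m \<cdot>\<^bsub>C\<^esub> f = m \<cdot>\<^bsub>C\<^esub> g \<longrightarrow> f = g)"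

definition is_iso :: "('o, 'a) cat \<Rightarrow> 'a \<Rightarrow> bool" where
  "is_iso C f \<longleftrightarrow> f \<in> Arr C \<and>
     (\<exists>g \<in> hom C (Cod C f) (Dom C f).
        g \<cdot>\<^bsub>C\<^esub> f = Ide C (Dom C f) \<and> f \<cdot>\<^bsub>C\<^esub> g = Ide C (Cod C f))"

definition isomorphic :: "('o, 'a) cat \<Rightarrow> 'o \<Rightarrow> 'o \<Rightarrow> bool" where
  "isomorphic C A B \<longleftrightarrow> (\<exists>f \<in> hom C A B. is_iso C f)"


section \<open>Limits and colimits\<close>

definition is_terminal :: "('o, 'a) cat \<Rightarrow> 'o \<Rightarrow> bool" where
  "is_terminal C T \<longleftrightarrow> T \<in> Obj C \<and> (\<forall>X \<in> Obj C. \<exists>!f. f \<in> hom C X T)"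

definition is_initial :: "('o, 'a) cat \<Rightarrow> 'o \<Rightarrow> bool" where
  "is_initial C I \<longleftrightarrow> I \<in> Obj C \<and> (\<forall>X \<in> Obj C. \<exists>!f. f \<in> hom C I X)"

definition is_zero :: "('o, 'a) cat \<Rightarrow> 'o \<Rightarrow> bool" where
  "is_zero C Z \<longleftrightarrow> is_initial C Z \<and> is_terminal C Z"

definition zero_arr :: "('o, 'a) cat \<Rightarrow> 'o \<Rightarrow> 'o \<Rightarrow> 'a" where
  "zero_arr C A B =
     (THE z. \<exists>Z. is_zero C Z \<and> (\<exists>f \<in> hom C A Z. \<exists>g \<in> hom C Z B. z = g \<cdot>\<^bsub>C\<^esub> f))"

definition is_product :: "('o, 'a) cat \<Rightarrow> 'o \<Rightarrow> 'o \<Rightarrow> 'a \<Rightarrow> 'a \<Rightarrow> bool" where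
  "is_product C A B p q \<longleftrightarrow>
     p \<in> hom C (Dom C p) A \<and> q \<in> hom C (Dom C p) B \<and>
     (\<forall>X. \<forall>f \<in> hom C X A. \<forall>g \<in> hom C X B.
        \<exists>!h. h \<in> hom C X (Dom C p) \<and> p \<cdot>\<^bsub>C\<^esub> h = f \<and> q \<cdot>\<^bsub>C\<^esub> h = g)"

definition is_coproduct :: "('o, 'a) cat \<Rightarrow> 'o \<Rightarrow> 'o \<Rightarrow> 'a \<Rightarrow> 'a \<Rightarrow> bool" where
  "is_coproduct C A B i j \<longleftrightarrow>
     i \<in> hom C A (Cod C i) \<and> j \<in> hom C B (Cod C i) \<and>
     (\<forall>X. \<forall>f \<in> hom C A X. \<forall>g \<in> hom C B X.
        \<exists>!h. h \<in> hom C (Cod C i) X \<and> h \<cdot>\<^bsub>C\<^esub> i = f \<and> h \<cdot>\<^bsub>C\<^esub> j = g)"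

definition is_pullback :: "('o, 'a) cat \<Rightarrow> 'a \<Rightarrow> 'a \<Rightarrow> 'a \<Rightarrow> 'a \<Rightarrow> bool" where
  "is_pullback C f g p q \<longleftrightarrow>
     f \<in> Arr C \<and> g \<in> Arr C \<and> Cod C f = Cod C g \<and>
     p \<in> hom C (Dom C p) (Dom C f) \<and> q \<in> hom C (Dom C p) (Dom C g) \<and>
     f \<cdot>\<^bsub>C\<^esub> p = g \<cdot>\<^bsub>C\<^esub> q \<and>
     (\<forall>X. \<forall>u \<in> hom C X (Dom C f). \<forall>v \<in> hom C X (Dom C g).
        f \<cdot>\<^bsub>C\<^esub> u = g \<cdot>\<^bsub>C\<^esub> v \<longrightarrow>
        (\<exists>!h. h \<in> hom C X (Dom C p) \<and> p \<cdot>\<^bsub>C\<^esub> h = u \<and> q \<cdot>\<^bsub>C\<^esub> h = v))"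

definition is_pushout :: "('o, 'a) cat \<Rightarrow> 'a \<Rightarrow> 'a \<Rightarrow> 'a \<Rightarrow> 'a \<Rightarrow> bool" where
  "is_pushout C f g i j \<longleftrightarrow>
     f \<in> Arr C \<and> g \<in> Arr C \<and> Dom C f = Dom C g \<and>
     i \<in> hom C (Cod C f) (Cod C i) \<and> j \<in> hom C (Cod C g) (Cod C i) \<and>
     i \<cdot>\<^bsub>C\<^esub> f = j \<cdot>\<^bsub>C\<^esub> g \<and>
     (\<forall>X. \<forall>u \<in> hom C (Cod C f) X. \<forall>v \<in> hom C (Cod C g) X.
        u \<cdot>\<^bsub>C\<^esub> f = v \<cdot>\<^bsub>C\<^esub> g \<longrightarrow>
        (\<exists>!h. h \<in> hom C (Cod C i) X \<and> h \<cdot>\<^bsub>C\<^esub> i = u \<and> h \<cdot>\<^bsub>C\<^esub> j = v))"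

definition is_coequalizer :: "('o, 'a) cat \<Rightarrow> 'a \<Rightarrow> 'a \<Rightarrow> 'a \<Rightarrow> bool" where
  "is_coequalizer C f g q \<longleftrightarrow>
     f \<in> Arr C \<and> g \<in> hom C (Dom C f) (Cod C f) \<and> q \<in> hom C (Cod C f) (Cod C q) \<and>
     q \<cdot>\<^bsub>C\<^esub> f = q \<cdot>\<^bsub>C\<^esub> g \<and>
     (\<forall>X. \<forall>h \<in> hom C (Cod C f) X. h \<cdot>\<^bsub>C\<^esub> f = h \<cdot>\<^bsub>C\<^esub> g \<longrightarrow>
        (\<exists>!u. u \<in> hom C (Cod C q) X \<and> u \<cdot>\<^bsub>C\<^esub> q = h))"

definition is_regular_epi :: "('o, 'a) cat \<Rightarrow> 'a \<Rightarrow> bool" where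
  "is_regular_epi C q \<longleftrightarrow> (\<exists>f g. is_coequalizer C f g q)"

definition is_kernel :: "('o, 'a) cat \<Rightarrow> 'a \<Rightarrow> 'a \<Rightarrow> bool" where
  "is_kernel C f k \<longleftrightarrow>
     f \<in> Arr C \<and> k \<in> hom C (Dom C k) (Dom C f) \<and>
     f \<cdot>\<^bsub>C\<^esub> k = zero_arr C (Dom C k) (Cod C f) \<and>
     (\<forall>X. \<forall>h \<in> hom C X (Dom C f). f \<cdot>\<^bsub>C\<^esub> h = zero_arr C X (Cod C f) \<longrightarrow>
        (\<exists>!u. u \<in> hom C X (Dom C k) \<and> k \<cdot>\<^bsub>C\<^esub> u = h))"

definition is_cokernel :: "('o, 'a) cat \<Rightarrow> 'a \<Rightarrow> 'a \<Rightarrow> bool" where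
  "is_cokernel C f q \<longleftrightarrow>
     f \<in> Arr C \<and> q \<in> hom C (Cod C f) (Cod C q) \<and>
     q \<cdot>\<^bsub>C\<^esub> f = zero_arr C (Dom C f) (Cod C q) \<and>
     (\<forall>X. \<forall>h \<in> hom C (Cod C f) X. h \<cdot>\<^bsub>C\<^esub> f = zero_arr C (Dom C f) X \<longrightarrow>
        (\<exists>!u. u \<in> hom C (Cod C q) X \<and> u \<cdot>\<^bsub>C\<^esub> q = h))"


section \<open>Semi-abelian categories\<close>

definition pointed :: "('o, 'a) cat \<Rightarrow> bool" where
  "pointed C \<longleftrightarrow> (\<exists>Z. is_zero C Z)"

definition finitely_complete :: "('o, 'a) cat \<Rightarrow> bool" where
  "finitely_complete C \<longleftrightarrow>
     (\<exists>T. is_terminal C T) \<and>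
     (\<forall>f \<in> Arr C. \<forall>g \<in> Arr C. Cod C f = Cod C g \<longrightarrow> (\<exists>p q. is_pullback C f g p q))"

definition has_binary_coproducts :: "('o, 'a) cat \<Rightarrow> bool" where
  "has_binary_coproducts C \<longleftrightarrow>
     (\<forall>A \<in> Obj C. \<forall>B \<in> Obj C. \<exists>i j. is_coproduct C A B i j)"

definition regular_category :: "('o, 'a) cat \<Rightarrow> bool" where
  "regular_category C \<longleftrightarrow>
     finitely_complete C \<and>
     (\<forall>f p q. is_pullback C f f p q \<longrightarrow> (\<exists>c. is_coequalizer C p q c)) \<and>
     (\<forall>f g p q. is_pullback C f g p q \<and> is_regular_epi C f \<longrightarrow> is_regular_epi C q)"

definition is_equivalence_relation :: "('o, 'a) cat \<Rightarrow> 'o \<Rightarrow> 'a \<Rightarrow> 'a \<Rightarrow> bool" where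
  "is_equivalence_relation C X r s \<longleftrightarrow>
     (let R = Dom C r in
      r \<in> hom C R X \<and> s \<in> hom C R X \<and>
      (\<forall>T. \<forall>u \<in> hom C T R. \<forall>v \<in> hom C T R.
         r \<cdot>\<^bsub>C\<^esub> u = r \<cdot>\<^bsub>C\<^esub> v \<and> s \<cdot>\<^bsub>C\<^esub> u = s \<cdot>\<^bsub>C\<^esub> v \<longrightarrow> u = v) \<and>
      (\<exists>e \<in> hom C X R. r \<cdot>\<^bsub>C\<^esub> e = Ide C X \<and> s \<cdot>\<^bsub>C\<^esub> e = Ide C X) \<and>
      (\<exists>t \<in> hom C R R. r \<cdot>\<^bsub>C\<^esub> t = s \<and> s \<cdot>\<^bsub>C\<^esub> t = r) \<and>
      (\<forall>p q. is_pullback C s r p q \<longrightarrow>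
         (\<exists>m \<in> hom C (Dom C p) R.
            r \<cdot>\<^bsub>C\<^esub> m = r \<cdot>\<^bsub>C\<^esub> p \<and> s \<cdot>\<^bsub>C\<^esub> m = s \<cdot>\<^bsub>C\<^esub> q)))"

definition barr_exact :: "('o, 'a) cat \<Rightarrow> bool" where
  "barr_exact C \<longleftrightarrow>
     regular_category C \<and>
     (\<forall>X r s. is_equivalence_relation C X r s \<longrightarrow> (\<exists>f. is_pullback C f f r s))"

definition is_point :: "('o, 'a) cat \<Rightarrow> 'a \<Rightarrow> 'a \<Rightarrow> bool" where
  "is_point C p s \<longleftrightarrow> p \<in> Arr C \<and> s \<in> hom C (Cod C p) (Dom C p) \<and> p \<cdot>\<^bsub>C\<^esub> s = Ide C (Cod C p)"

text \<open>
  Every change-of-base functor \<open>v\<^sup>*\<close> of the fibration of points reflects isomorphisms: \<open>f\<close> is a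
  morphism of points from \<open>(p, s)\<close> to \<open>(p', s')\<close>, and \<open>g = v\<^sup>*(f)\<close>.
\<close>
definition protomodular :: "('o, 'a) cat \<Rightarrow> bool" where
  "protomodular C \<longleftrightarrow>
     (\<forall>v p s p' s' f a x a' x' g.
        is_point C p s \<and> is_point C p' s' \<and> Cod C p = Cod C p' \<and>
        f \<in> hom C (Dom C p) (Dom C p') \<and> p' \<cdot>\<^bsub>C\<^esub> f = p \<and> f \<cdot>\<^bsub>C\<^esub> s = s' \<and>
        is_pullback C v p x a \<and> is_pullback C v p' x' a' \<and>
        g \<in> hom C (Dom C x) (Dom C x') \<and> x' \<cdot>\<^bsub>C\<^esub> g = x \<and> a' \<cdot>\<^bsub>C\<^esub> g = f \<cdot>\<^bsub>C\<^esub> a \<and>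
        is_iso C g
        \<longrightarrow> is_iso C f)"

definition semi_abelian :: "('o, 'a) cat \<Rightarrow> bool" where
  "semi_abelian C \<longleftrightarrow>
     category C \<and> pointed C \<and> barr_exact C \<and> protomodular C \<and> has_binary_coproducts C"


section \<open>Chosen limits and colimits\<close>

text \<open>
  The operations below choose one representative of a construction that is determined up to
  isomorphism; they are meaningful only when the construction in question exists.
\<close>

definition zero_ob :: "('o, 'a) cat \<Rightarrow> 'o" where
  "zero_ob C = (SOME Z. is_zero C Z)"

definition prod_cone :: "('o, 'a) cat \<Rightarrow> 'o \<Rightarrow> 'o \<Rightarrow> 'a \<times> 'a" where
  "prod_cone C A B = (SOME (p, q). is_product C A B p q)"

definition proj1 :: "('o, 'a) cat \<Rightarrow> 'o \<Rightarrow> 'o \<Rightarrow> 'a" where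
  "proj1 C A B = fst (prod_cone C A B)"

definition proj2 :: "('o, 'a) cat \<Rightarrow> 'o \<Rightarrow> 'o \<Rightarrow> 'a" where
  "proj2 C A B = snd (prod_cone C A B)"

definition prod_ob :: "('o, 'a) cat \<Rightarrow> 'o \<Rightarrow> 'o \<Rightarrow> 'o" where
  "prod_ob C A B = Dom C (proj1 C A B)"

definition tuple :: "('o, 'a) cat \<Rightarrow> 'a \<Rightarrow> 'a \<Rightarrow> 'a" where
  "tuple C f g =
     (let A = Cod C f; B = Cod C g in
      THE h. h \<in> hom C (Dom C f) (prod_ob C A B) \<and>
             proj1 C A B \<cdot>\<^bsub>C\<^esub> h = f \<and> proj2 C A B \<cdot>\<^bsub>C\<^esub> h = g)"

definition coprod_cocone :: "('o, 'a) cat \<Rightarrow> 'o \<Rightarrow> 'o \<Rightarrow> 'a \<times> 'a" where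
  "coprod_cocone C A B = (SOME (i, j). is_coproduct C A B i j)"

definition inj1 :: "('o, 'a) cat \<Rightarrow> 'o \<Rightarrow> 'o \<Rightarrow> 'a" where
  "inj1 C A B = fst (coprod_cocone C A B)"

definition inj2 :: "('o, 'a) cat \<Rightarrow> 'o \<Rightarrow> 'o \<Rightarrow> 'a" where
  "inj2 C A B = snd (coprod_cocone C A B)"

definition coprod_ob :: "('o, 'a) cat \<Rightarrow> 'o \<Rightarrow> 'o \<Rightarrow> 'o" where
  "coprod_ob C A B = Cod C (inj1 C A B)"

definition cotuple :: "('o, 'a) cat \<Rightarrow> 'a \<Rightarrow> 'a \<Rightarrow> 'a" where
  "cotuple C f g =
     (let A = Dom C f; B = Dom C g in
      THE h. h \<in> hom C (coprod_ob C A B) (Cod C f) \<and>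
             h \<cdot>\<^bsub>C\<^esub> inj1 C A B = f \<and> h \<cdot>\<^bsub>C\<^esub> inj2 C A B = g)"

text \<open>Ternary products and coproducts are \<open>(A \<times> B) \<times> D\<close> and \<open>(A + B) + D\<close>.\<close>

definition tuple3 :: "('o, 'a) cat \<Rightarrow> 'a \<Rightarrow> 'a \<Rightarrow> 'a \<Rightarrow> 'a" where
  "tuple3 C f g h = tuple C (tuple C f g) h"

definition cotuple3 :: "('o, 'a) cat \<Rightarrow> 'a \<Rightarrow> 'a \<Rightarrow> 'a \<Rightarrow> 'a" where
  "cotuple3 C f g h = cotuple C (cotuple C f g) h"

definition kernel :: "('o, 'a) cat \<Rightarrow> 'a \<Rightarrow> 'a" where
  "kernel C f = (SOME k. is_kernel C f k)"

definition cokernel :: "('o, 'a) cat \<Rightarrow> 'a \<Rightarrow> 'a" where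
  "cokernel C f = (SOME q. is_cokernel C f q)"

definition pushout_cocone :: "('o, 'a) cat \<Rightarrow> 'a \<Rightarrow> 'a \<Rightarrow> 'a \<times> 'a" where
  "pushout_cocone C f g = (SOME (i, j). is_pushout C f g i j)"

text \<open>The factorisation of \<open>f\<close> through the monomorphism \<open>m\<close>, respectively the epimorphism \<open>q\<close>.\<close>

definition lift_through :: "('o, 'a) cat \<Rightarrow> 'a \<Rightarrow> 'a \<Rightarrow> 'a" where
  "lift_through C m f = (THE u. u \<in> hom C (Dom C f) (Dom C m) \<and> m \<cdot>\<^bsub>C\<^esub> u = f)"

definition descend_along :: "('o, 'a) cat \<Rightarrow> 'a \<Rightarrow> 'a \<Rightarrow> 'a" where
  "descend_along C q f = (THE u. u \<in> hom C (Cod C q) (Cod C f) \<and> u \<cdot>\<^bsub>C\<^esub> q = f)"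


section \<open>Algebraic coherence\<close>

text \<open>\<open>flat C X Y\<close> is the inclusion of \<open>X \<flat> Y\<close> in \<open>X + Y\<close>; \<open>flat_map C X f\<close> is \<open>1\<^sub>X \<flat> f\<close>.\<close>

definition flat :: "('o, 'a) cat \<Rightarrow> 'o \<Rightarrow> 'o \<Rightarrow> 'a" where
  "flat C X Y = kernel C (cotuple C (Ide C X) (zero_arr C Y X))"

definition flat_map :: "('o, 'a) cat \<Rightarrow> 'o \<Rightarrow> 'a \<Rightarrow> 'a" where
  "flat_map C X f =
     (let Y = Dom C f; Y' = Cod C f in
      lift_through C (flat C X Y')
        (cotuple C (inj1 C X Y') (inj2 C X Y' \<cdot>\<^bsub>C\<^esub> f) \<cdot>\<^bsub>C\<^esub> flat C X Y))"

definition algebraically_coherent :: "('o, 'a) cat \<Rightarrow> bool" where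
  "algebraically_coherent C \<longleftrightarrow>
     (\<forall>X \<in> Obj C. \<forall>Y \<in> Obj C. \<forall>Z \<in> Obj C.
        is_regular_epi C (cotuple C (flat_map C X (inj1 C Y Z)) (flat_map C X (inj2 C Y Z))))"


section \<open>Subobjects\<close>

text \<open>A subobject of \<open>X\<close> is represented by a monomorphism with codomain \<open>X\<close>.\<close>

definition sub_le :: "('o, 'a) cat \<Rightarrow> 'a \<Rightarrow> 'a \<Rightarrow> bool" where
  "sub_le C m n \<longleftrightarrow> (\<exists>u \<in> hom C (Dom C m) (Dom C n). m = n \<cdot>\<^bsub>C\<^esub> u)"

definition is_subobject :: "('o, 'a) cat \<Rightarrow> 'o \<Rightarrow> 'a \<Rightarrow> bool" where
  "is_subobject C X m \<longleftrightarrow> is_mono C m \<and> Cod C m = X"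

definition is_normal_subobject :: "('o, 'a) cat \<Rightarrow> 'o \<Rightarrow> 'a \<Rightarrow> bool" where
  "is_normal_subobject C X m \<longleftrightarrow> (\<exists>f. Dom C f = X \<and> is_kernel C f m)"

definition join :: "('o, 'a) cat \<Rightarrow> 'a \<Rightarrow> 'a \<Rightarrow> 'a" where
  "join C m n =
     (SOME j. is_subobject C (Cod C m) j \<and> sub_le C m j \<and> sub_le C n j \<and>
        (\<forall>l. is_subobject C (Cod C m) l \<and> sub_le C m l \<and> sub_le C n l \<longrightarrow> sub_le C j l))"

definition meet :: "('o, 'a) cat \<Rightarrow> 'a \<Rightarrow> 'a \<Rightarrow> 'a" where
  "meet C m n =
     (SOME j. is_subobject C (Cod C m) j \<and> sub_le C j m \<and> sub_le C j n \<and>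
        (\<forall>l. is_subobject C (Cod C m) l \<and> sub_le C l m \<and> sub_le C l n \<longrightarrow> sub_le C l j))"

definition image :: "('o, 'a) cat \<Rightarrow> 'a \<Rightarrow> 'a" where
  "image C f =
     (SOME m. is_mono C m \<and>
        (\<exists>e \<in> hom C (Dom C f) (Dom C m). is_regular_epi C e \<and> f = m \<cdot>\<^bsub>C\<^esub> e))"

definition normal_closure :: "('o, 'a) cat \<Rightarrow> 'a \<Rightarrow> 'a" where
  "normal_closure C m =
     (SOME n. is_normal_subobject C (Cod C m) n \<and> sub_le C m n \<and>
        (\<forall>l. is_normal_subobject C (Cod C m) l \<and> sub_le C m l \<longrightarrow> sub_le C n l))"


section \<open>Cosmash products and commutators\<close>

text \<open>
  The cosmash products are given by their inclusions in \<open>A + B\<close> and \<open>A + B + D\<close>.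
\<close>

definition cosmash :: "('o, 'a) cat \<Rightarrow> 'o \<Rightarrow> 'o \<Rightarrow> 'a" where
  "cosmash C A B =
     kernel C (cotuple C (tuple C (Ide C A) (zero_arr C A B))
                         (tuple C (zero_arr C B A) (Ide C B)))"

definition cosmash_ob :: "('o, 'a) cat \<Rightarrow> 'o \<Rightarrow> 'o \<Rightarrow> 'o" where
  "cosmash_ob C A B = Dom C (cosmash C A B)"

definition cosmash3 :: "('o, 'a) cat \<Rightarrow> 'o \<Rightarrow> 'o \<Rightarrow> 'o \<Rightarrow> 'a" where
  "cosmash3 C A B D =
     kernel C (tuple3 C
       (cotuple3 C (inj1 C A B) (inj2 C A B) (zero_arr C D (coprod_ob C A B)))
       (cotuple3 C (inj1 C A D) (zero_arr C B (coprod_ob C A D)) (inj2 C A D))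
       (cotuple3 C (zero_arr C A (coprod_ob C B D)) (inj1 C B D) (inj2 C B D)))"

definition higgins :: "('o, 'a) cat \<Rightarrow> 'a \<Rightarrow> 'a \<Rightarrow> 'a" where
  "higgins C m n = image C (cotuple C m n \<cdot>\<^bsub>C\<^esub> cosmash C (Dom C m) (Dom C n))"

definition higgins3 :: "('o, 'a) cat \<Rightarrow> 'a \<Rightarrow> 'a \<Rightarrow> 'a \<Rightarrow> 'a" where
  "higgins3 C k m n =
     image C (cotuple3 C k m n \<cdot>\<^bsub>C\<^esub> cosmash3 C (Dom C k) (Dom C m) (Dom C n))"

definition huq :: "('o, 'a) cat \<Rightarrow> 'a \<Rightarrow> 'a \<Rightarrow> 'a" where
  "huq C m n = normal_closure C (higgins C m n)"

definition abelian_object :: "('o, 'a) cat \<Rightarrow> 'o \<Rightarrow> bool" where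
  "abelian_object C A \<longleftrightarrow> A \<in> Obj C \<and> is_zero C (Dom C (higgins C (Ide C A) (Ide C A)))"

definition nil2 :: "('o, 'a) cat \<Rightarrow> ('o, 'a) cat" where
  "nil2 C =
     full_subcat C {A. is_zero C (Dom C (higgins3 C (Ide C A) (Ide C A) (Ide C A)))}"


section \<open>The non-abelian tensor product\<close>

text \<open>
  The part of an internal groupoid \<open>(G, L, d, c, e)\<close> on which the tensor product depends. The
  groupoid associated with a crossed module \<open>M \<rightarrow> L\<close> has \<open>G = M \<rtimes> L\<close>. In a semi-abelian category
  (which is Mal'tsev) the composition is uniquely determined by these data.
\<close>
record ('o, 'a) igpd =
  Gtot :: 'o
  Gbase :: 'o
  Gdom :: 'a
  Gcod :: 'a
  Gide :: 'a

text \<open>The internal groupoid over \<open>0\<close> corresponding to the crossed module \<open>X \<rightarrow> 0\<close>, for \<open>X\<close> abelian.\<close>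

definition groupoid_over_zero :: "('o, 'a) cat \<Rightarrow> 'o \<Rightarrow> ('o, 'a) igpd" where
  "groupoid_over_zero C X =
     \<lparr>Gtot = X, Gbase = zero_ob C,
      Gdom = zero_arr C X (zero_ob C), Gcod = zero_arr C X (zero_ob C),
      Gide = zero_arr C (zero_ob C) X\<rparr>"

text \<open>
  The tensor product of two crossed modules over the same object, in terms of their associated
  groupoids \<open>G\<close> and \<open>H\<close>.
\<close>
definition tensor :: "('o, 'a) cat \<Rightarrow> ('o, 'a) igpd \<Rightarrow> ('o, 'a) igpd \<Rightarrow> 'o" where
  "tensor C G H =
     (let eU = fst (pushout_cocone C (Gide G) (Gide H));
          eL = snd (pushout_cocone C (Gide G) (Gide H));
          induced = (\<lambda>f g. THE h. h \<in> hom C (Cod C eU) (Cod C f) \<and>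
                                  h \<cdot>\<^bsub>C\<^esub> eU = f \<and> h \<cdot>\<^bsub>C\<^esub> eL = g);
          dU = induced (Ide C (Gtot G)) (Gide G \<cdot>\<^bsub>C\<^esub> Gdom H);
          cU = induced (Ide C (Gtot G)) (Gide G \<cdot>\<^bsub>C\<^esub> Gcod H);
          dL = induced (Gide H \<cdot>\<^bsub>C\<^esub> Gdom G) (Ide C (Gtot H));
          cL = induced (Gide H \<cdot>\<^bsub>C\<^esub> Gcod G) (Ide C (Gtot H));
          q = cokernel C (join C (huq C (kernel C dL) (kernel C cL))
                                 (huq C (kernel C dU) (kernel C cU)))
      in Dom C (meet C (kernel C (descend_along C q dU)) (kernel C (descend_along C q dL))))"

end

theory Submission
  imports Defs
begin

text \<open>
  Write \<open>Q = M + N\<close> and let \<open>R\<close> be the quotient of \<open>Q\<close> in the definition of the tensor product, so that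
  \<open>M \<otimes> N\<close> is the kernel of \<open>R \<rightarrow> M \<times> N\<close>. The theorem says that \<open>R\<close> is the coproduct \<open>M +\<^sub>2 N\<close>.
  The main tool is a consequence of algebraic coherence: if \<open>f\<close> and \<open>f'\<close> cooperate (commute in the sense
  of Huq) with \<open>g\<close>, so does the arrow out of the coproduct that they induce, because cooperation of \<open>g: X \<rightarrow> Z\<close>
  with \<open>f: Y \<rightarrow> Z\<close> is an equation between two arrows out of \<open>X \<flat> Y\<close>.

  If \<open>T\<close> is two-nilpotent, then the commutator of \<open>M\<close> and \<open>N\<close> in \<open>T\<close> is central; since the kernel of
  \<open>Q \<rightarrow> N\<close> is generated by \<open>M\<close> and the commutator of \<open>M\<close> and \<open>N\<close>, every arrow \<open>Q \<rightarrow> T\<close> factors through \<open>R\<close>.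
  Conversely, the kernels of \<open>R \<rightarrow> M\<close> and \<open>R \<rightarrow> N\<close> cooperate with themselves, so that their meet is central
  in \<open>R\<close>, with abelian quotient \<open>M \<times> N\<close>; and a central extension of an abelian object is two-nilpotent.
\<close>

section \<open>Categories with zero object\<close>

text \<open>None of the objects involved is given by a formula: kernels, images, normal closures and
  joins are choices, fixed only up to isomorphism. No commutator is ever computed, therefore. Each
  subobject that enters the quotient is described by the arrows that kill it, and an arrow kills the
  Higgins or Huq commutator of \<open>m\<close> and \<open>n\<close> exactly when its composites
  with them cooperate. A cokernel sees nothing else, so the tensor quotient becomes a universal
  problem about cooperation.

  The delicate direction is the two-nilpotency of \<open>R\<close>: the ternary commutator is not by
  definition an iterated binary one, so centrality does not bear on it directly. The remedy is a
  subtraction that is available along a central extension. Two arrows that agree in the quotient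
  differ by an arrow into the kernel, and coherence shows that this difference is determined by its
  restrictions to the summands that are acted upon, while the ternary cosmash product is killed by
  the projections onto these.\<close>

context category
begin

lemma hom_iff: "f \<in> hom C A B \<longleftrightarrow> f \<in> Arr C \<and> Dom C f = A \<and> Cod C f = B"
  by (auto simp: hom_def)

lemma arr_cmp [simp]: "\<lbrakk>f \<in> Arr C; g \<in> Arr C; Dom C g = Cod C f\<rbrakk> \<Longrightarrow> g \<cdot> f \<in> Arr C"
  and dom_cmp [simp]: "\<lbrakk>f \<in> Arr C; g \<in> Arr C; Dom C g = Cod C f\<rbrakk> \<Longrightarrow> Dom C (g \<cdot> f) = Dom C f"
  and cod_cmp [simp]: "\<lbrakk>f \<in> Arr C; g \<in> Arr C; Dom C g = Cod C f\<rbrakk> \<Longrightarrow> Cod C (g \<cdot> f) = Cod C g"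
  using cmp_in_hom[of f "Dom C f" "Cod C f" g "Cod C g"] by (auto simp: hom_def)

lemma arr_ide [simp]: "A \<in> Obj C \<Longrightarrow> Ide C A \<in> Arr C"
  and dom_ide [simp]: "A \<in> Obj C \<Longrightarrow> Dom C (Ide C A) = A"
  and cod_ide [simp]: "A \<in> Obj C \<Longrightarrow> Cod C (Ide C A) = A"
  using ide_in_hom[of A] by (auto simp: hom_def)

lemma obj_dom [simp]: "f \<in> Arr C \<Longrightarrow> Dom C f \<in> Obj C"
  and obj_cod [simp]: "f \<in> Arr C \<Longrightarrow> Cod C f \<in> Obj C"
  by (auto intro: dom_in_Obj cod_in_Obj)

lemma ide_left [simp]: "\<lbrakk>f \<in> Arr C; Cod C f = B\<rbrakk> \<Longrightarrow> Ide C B \<cdot> f = f"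
  and ide_right [simp]: "\<lbrakk>f \<in> Arr C; Dom C f = A\<rbrakk> \<Longrightarrow> f \<cdot> Ide C A = f"
  using cmp_ide_left[of f "Dom C f" B] cmp_ide_right[of f A "Cod C f"] by (auto simp: hom_def)

lemma assoc [simp]:
  "\<lbrakk>f \<in> Arr C; g \<in> Arr C; h \<in> Arr C; Dom C g = Cod C f; Dom C h = Cod C g\<rbrakk> \<Longrightarrow> (h \<cdot> g) \<cdot> f = h \<cdot> (g \<cdot> f)"
  using cmp_assoc[of f "Dom C f" "Cod C f" g "Cod C g" h "Cod C h"] by (auto simp: hom_def)

lemma reassoc:
  "\<lbrakk>g \<cdot> f = k; f \<in> Arr C; g \<in> Arr C; Dom C g = Cod C f; x \<in> Arr C; Dom C f = Cod C x\<rbrakk> \<Longrightarrow> g \<cdot> (f \<cdot> x) = k \<cdot> x"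
  using assoc[of x f g] by auto

lemma is_mono_cancel:
  "\<lbrakk>is_mono C m; m \<cdot> f = m \<cdot> g; f \<in> Arr C; g \<in> Arr C; Cod C f = Dom C m; Cod C g = Dom C m; Dom C f = Dom C g\<rbrakk> \<Longrightarrow> f = g"
  unfolding is_mono_def by (auto simp: hom_def)

lemma is_monoI:
  assumes "m \<in> Arr C" "\<And>f g. \<lbrakk>f \<in> Arr C; g \<in> Arr C; Cod C f = Dom C m; Cod C g = Dom C m; Dom C f = Dom C g; m \<cdot> f = m \<cdot> g\<rbrakk> \<Longrightarrow> f = g"
  shows "is_mono C m"
  using assms unfolding is_mono_def by (auto simp: hom_def)

lemma is_mono_arr: "is_mono C m \<Longrightarrow> m \<in> Arr C"
  by (auto simp: is_mono_def)

lemma is_isoE: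
  assumes "is_iso C f"
  obtains g where "f \<in> Arr C" "g \<in> Arr C" "Dom C g = Cod C f" "Cod C g = Dom C f"
    "g \<cdot> f = Ide C (Dom C f)" "f \<cdot> g = Ide C (Cod C f)"
  using assms by (auto simp: is_iso_def hom_def)

lemma is_isoI:
  "\<lbrakk>f \<in> Arr C; g \<in> Arr C; Dom C g = Cod C f; Cod C g = Dom C f; g \<cdot> f = Ide C (Dom C f); f \<cdot> g = Ide C (Cod C f)\<rbrakk> \<Longrightarrow> is_iso C f"
  by (auto simp: is_iso_def hom_def)

lemma is_iso_ide: "A \<in> Obj C \<Longrightarrow> is_iso C (Ide C A)"
  by (rule is_isoI[of _ "Ide C A"]) auto

lemma is_iso_mono: "is_iso C f \<Longrightarrow> is_mono C f"
proof (rule is_monoI)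
  assume "is_iso C f"
  then obtain g where g: "f \<in> Arr C" "g \<in> Arr C" "Dom C g = Cod C f" "Cod C g = Dom C f" "g \<cdot> f = Ide C (Dom C f)"
    by (rule is_isoE)
  show "f \<in> Arr C" by fact
  fix x y assume a: "x \<in> Arr C" "y \<in> Arr C" "Cod C x = Dom C f" "Cod C y = Dom C f" "Dom C x = Dom C y" "f \<cdot> x = f \<cdot> y"
  have "(g \<cdot> f) \<cdot> x = (g \<cdot> f) \<cdot> y" using g(1-4) a by simp
  then show "x = y" using g a by simp
qed

end

text \<open>Equality of the codomains of \<open>f\<close> and \<open>g\<close> is not demanded,
  since equal composites with \<open>e\<close> force it; \<open>epicI\<close> gives it back as an
  assumption.\<close>

definition epic :: "('o, 'a) cat \<Rightarrow> 'a \<Rightarrow> bool" where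
  "epic C e \<longleftrightarrow> e \<in> Arr C \<and>
     (\<forall>f \<in> Arr C. \<forall>g \<in> Arr C. Dom C f = Cod C e \<and> Dom C g = Cod C e \<and> f \<cdot>\<^bsub>C\<^esub> e = g \<cdot>\<^bsub>C\<^esub> e \<longrightarrow> f = g)"

context category
begin

lemma epic_cancel:
  "\<lbrakk>epic C e; f \<cdot> e = g \<cdot> e; f \<in> Arr C; g \<in> Arr C; Dom C f = Cod C e; Dom C g = Cod C e\<rbrakk> \<Longrightarrow> f = g"
  unfolding epic_def by auto

lemma epicI:
  assumes e: "e \<in> Arr C" and ext: "\<And>x y. \<lbrakk>x \<in> Arr C; y \<in> Arr C; Dom C x = Cod C e; Dom C y = Cod C e; Cod C x = Cod C y; x \<cdot> e = y \<cdot> e\<rbrakk> \<Longrightarrow> x = y"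
  shows "epic C e"
  unfolding epic_def
proof (intro conjI ballI impI)
  show "e \<in> Arr C" by fact
  fix x y assume h: "x \<in> Arr C" "y \<in> Arr C" "Dom C x = Cod C e \<and> Dom C y = Cod C e \<and> x \<cdot> e = y \<cdot> e"
  have "Cod C (x \<cdot> e) = Cod C x" "Cod C (y \<cdot> e) = Cod C y" by (rule cod_cmp; use h e in simp)+
  then have "Cod C x = Cod C y" using h by metis
  then show "x = y" using ext h by metis
qed

section \<open>Coequalizers and regular epimorphisms\<close>

lemma coequalizerD:
  assumes "is_coequalizer C f g q"
  shows "f \<in> Arr C" "g \<in> Arr C" "q \<in> Arr C" "Dom C g = Dom C f" "Cod C g = Cod C f" "Dom C q = Cod C f" "q \<cdot> f = q \<cdot> g"
  using assms by (auto simp: is_coequalizer_def hom_def)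

lemma coequalizer_factor:
  assumes "is_coequalizer C f g q" "h \<in> Arr C" "Dom C h = Cod C f" "h \<cdot> f = h \<cdot> g"
  obtains u where "u \<in> Arr C" "Dom C u = Cod C q" "Cod C u = Cod C h" "u \<cdot> q = h"
proof -
  have "h \<in> hom C (Cod C f) (Cod C h)" using assms by (simp add: hom_iff)
  moreover have "\<forall>X. \<forall>h \<in> hom C (Cod C f) X. h \<cdot> f = h \<cdot> g \<longrightarrow> (\<exists>!u. u \<in> hom C (Cod C q) X \<and> u \<cdot> q = h)"
    using assms(1) unfolding is_coequalizer_def by (elim conjE)
  ultimately have "\<exists>!u. u \<in> hom C (Cod C q) (Cod C h) \<and> u \<cdot> q = h"
    using assms(4) by simp
  then show thesis using that by (auto simp: hom_iff)
qed

lemma regular_epi_epic: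
  assumes "is_regular_epi C q" shows "epic C q"
proof -
  obtain f g where co: "is_coequalizer C f g q" using assms by (auto simp: is_regular_epi_def)
  note d = coequalizerD[OF co]
  show ?thesis
  proof (rule epicI)
    show "q \<in> Arr C" by fact
    fix x y assume a: "x \<in> Arr C" "y \<in> Arr C" "Dom C x = Cod C q" "Dom C y = Cod C q" "Cod C x = Cod C y" "x \<cdot> q = y \<cdot> q"
    have "x \<cdot> q \<in> hom C (Cod C f) (Cod C x)" "(x \<cdot> q) \<cdot> f = (x \<cdot> q) \<cdot> g"
      using a d by (simp_all add: hom_iff)
    then have "\<exists>!u. u \<in> hom C (Cod C q) (Cod C x) \<and> u \<cdot> q = x \<cdot> q"
      using co unfolding is_coequalizer_def by blast
    moreover have "x \<in> hom C (Cod C q) (Cod C x)" "y \<in> hom C (Cod C q) (Cod C x)"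
      using a by (simp_all add: hom_iff)
    ultimately show "x = y" using a by metis
  qed
qed

lemma regular_epi_arr: "is_regular_epi C q \<Longrightarrow> q \<in> Arr C"
  using regular_epi_epic by (auto simp: epic_def)

text \<open>As \<open>m\<close> is mono, \<open>u\<close> coequalises the pair of which
  \<open>e\<close> is the coequalizer, which yields the diagonal; the second triangle follows by
  cancelling \<open>e\<close>. This orthogonality makes the image of a cotuple the least subobject,
  hence the join.\<close>

lemma regular_epi_diagonal:
  assumes e: "is_regular_epi C e" and m: "is_mono C m" and u: "u \<in> Arr C" "Dom C u = Dom C e" "Cod C u = Dom C m"
    and v: "v \<in> Arr C" "Dom C v = Cod C e" and eq: "m \<cdot> u = v \<cdot> e"
  obtains d where "d \<in> Arr C" "Dom C d = Cod C e" "Cod C d = Dom C m" "d \<cdot> e = u" "m \<cdot> d = v"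
proof -
  obtain f g where co: "is_coequalizer C f g e" using e by (auto simp: is_regular_epi_def)
  note d = coequalizerD[OF co] is_mono_arr[OF m]
  have "m \<cdot> (u \<cdot> f) = m \<cdot> (u \<cdot> g)"
    using d u v eq by (metis assoc)
  then have "u \<cdot> f = u \<cdot> g" by (rule is_mono_cancel[OF m]) (use d u in auto)
  then obtain t where t: "t \<in> Arr C" "Dom C t = Cod C e" "Cod C t = Cod C u" "t \<cdot> e = u"
    using coequalizer_factor[OF co u(1)] d u by auto
  have "(m \<cdot> t) \<cdot> e = v \<cdot> e" using t d u v eq by simp
  then have "m \<cdot> t = v" by (rule epic_cancel[OF regular_epi_epic[OF e]]) (use t d u v in auto)
  then show thesis using that t u by auto
qed

lemma iso_regular_epi:
  assumes e: "is_regular_epi C e" and i: "is_iso C i" and eq: "Dom C i = Cod C e"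
  shows "is_regular_epi C (i \<cdot> e)"
proof -
  obtain f g where co: "is_coequalizer C f g e" using e by (auto simp: is_regular_epi_def)
  note d = coequalizerD[OF co]
  obtain j where j: "i \<in> Arr C" "j \<in> Arr C" "Dom C j = Cod C i" "Cod C j = Dom C i"
    "j \<cdot> i = Ide C (Dom C i)" "i \<cdot> j = Ide C (Cod C i)" using i by (rule is_isoE)
  note r = j(5)[THEN reassoc] j(6)[THEN reassoc]
  have "is_coequalizer C f g (i \<cdot> e)" unfolding is_coequalizer_def
  proof (intro conjI allI ballI impI)
    show "i \<cdot> e \<cdot> f = i \<cdot> e \<cdot> g" using d j eq by simp
    fix X h assume h: "h \<in> hom C (Cod C f) X" "h \<cdot> f = h \<cdot> g"
    then obtain u where u: "u \<in> Arr C" "Dom C u = Cod C e" "Cod C u = Cod C h" "u \<cdot> e = h"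
      using coequalizer_factor[OF co, of h] by (auto simp: hom_iff)
    show "\<exists>!u. u \<in> hom C (Cod C (i \<cdot> e)) X \<and> u \<cdot> (i \<cdot> e) = h"
    proof (rule ex1I)
      show "u \<cdot> j \<in> hom C (Cod C (i \<cdot> e)) X \<and> u \<cdot> j \<cdot> (i \<cdot> e) = h"
        using u j eq d h r by (simp add: hom_iff)
      fix w assume w: "w \<in> hom C (Cod C (i \<cdot> e)) X \<and> w \<cdot> (i \<cdot> e) = h"
      then have "(w \<cdot> i) \<cdot> e = u \<cdot> e" using u j eq d by (simp add: hom_iff)
      then have "w \<cdot> i = u" by (rule epic_cancel[OF regular_epi_epic[OF e]]) (use w u j eq d in \<open>auto simp: hom_iff\<close>)
      then have "(w \<cdot> i) \<cdot> j = u \<cdot> j" by simp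
      then show "w = u \<cdot> j" using w j eq d by (simp add: hom_iff)
    qed
  qed (use d j eq in \<open>simp_all add: hom_iff\<close>)
  then show ?thesis by (auto simp: is_regular_epi_def)
qed

section \<open>Pullbacks, zero objects and zero arrows\<close>

lemma pullbackD:
  assumes "is_pullback C f g p q"
  shows "f \<in> Arr C" "g \<in> Arr C" "p \<in> Arr C" "q \<in> Arr C" "Cod C f = Cod C g" "Cod C p = Dom C f"
    "Cod C q = Dom C g" "Dom C q = Dom C p" "f \<cdot> p = g \<cdot> q"
  using assms by (auto simp: is_pullback_def hom_def)

lemma pullback_factor:
  assumes "is_pullback C f g p q" "u \<in> Arr C" "v \<in> Arr C" "Dom C u = Dom C v" "Cod C u = Dom C f" "Cod C v = Dom C g"
    "f \<cdot> u = g \<cdot> v"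
  obtains h where "h \<in> Arr C" "Dom C h = Dom C u" "Cod C h = Dom C p" "p \<cdot> h = u" "q \<cdot> h = v"
proof -
  have "u \<in> hom C (Dom C u) (Dom C f)" "v \<in> hom C (Dom C u) (Dom C g)" using assms by (auto simp: hom_iff)
  then have "\<exists>!h. h \<in> hom C (Dom C u) (Dom C p) \<and> p \<cdot> h = u \<and> q \<cdot> h = v"
    using assms unfolding is_pullback_def by blast
  then show thesis using that by (auto simp: hom_iff)
qed

lemma pullback_ext:
  assumes pb: "is_pullback C f g p q" and u: "u \<in> Arr C" "v \<in> Arr C" "Dom C u = Dom C v" "Cod C u = Dom C p" "Cod C v = Dom C p"
    "p \<cdot> u = p \<cdot> v" "q \<cdot> u = q \<cdot> v"
  shows "u = v"
proof -
  note d = pullbackD[OF pb]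
  have "p \<cdot> u \<in> hom C (Dom C u) (Dom C f)" "q \<cdot> u \<in> hom C (Dom C u) (Dom C g)" "f \<cdot> (p \<cdot> u) = g \<cdot> (q \<cdot> u)"
    using d u d(9)[THEN reassoc, of u] by (auto simp: hom_iff)
  then have "\<exists>!h. h \<in> hom C (Dom C u) (Dom C p) \<and> p \<cdot> h = p \<cdot> u \<and> q \<cdot> h = q \<cdot> u"
    using pb unfolding is_pullback_def by blast
  then show ?thesis using u by (auto simp: hom_iff)
qed

lemma is_pullbackI:
  assumes "f \<in> Arr C" "g \<in> Arr C" "p \<in> Arr C" "q \<in> Arr C" "Cod C f = Cod C g" "Cod C p = Dom C f"
    "Cod C q = Dom C g" "Dom C q = Dom C p" "f \<cdot> p = g \<cdot> q"
    and fac: "\<And>u v. \<lbrakk>u \<in> Arr C; v \<in> Arr C; Dom C u = Dom C v; Cod C u = Dom C f; Cod C v = Dom C g; f \<cdot> u = g \<cdot> v\<rbrakk>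
      \<Longrightarrow> \<exists>h. h \<in> Arr C \<and> Dom C h = Dom C u \<and> Cod C h = Dom C p \<and> p \<cdot> h = u \<and> q \<cdot> h = v"
    and ext: "\<And>u v. \<lbrakk>u \<in> Arr C; v \<in> Arr C; Dom C u = Dom C v; Cod C u = Dom C p; Cod C v = Dom C p; p \<cdot> u = p \<cdot> v; q \<cdot> u = q \<cdot> v\<rbrakk> \<Longrightarrow> u = v"
  shows "is_pullback C f g p q"
  unfolding is_pullback_def
proof (intro conjI allI ballI impI)
  fix X u v assume a: "u \<in> hom C X (Dom C f)" "v \<in> hom C X (Dom C g)" "f \<cdot> u = g \<cdot> v"
  then obtain h where h: "h \<in> Arr C" "Dom C h = Dom C u" "Cod C h = Dom C p" "p \<cdot> h = u" "q \<cdot> h = v"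
    using fac[of u v] by (auto simp: hom_iff)
  show "\<exists>!h. h \<in> hom C X (Dom C p) \<and> p \<cdot> h = u \<and> q \<cdot> h = v"
  proof (rule ex1I)
    show "h \<in> hom C X (Dom C p) \<and> p \<cdot> h = u \<and> q \<cdot> h = v" using h a by (auto simp: hom_iff)
    show "k = h" if "k \<in> hom C X (Dom C p) \<and> p \<cdot> k = u \<and> q \<cdot> k = v" for k
      by (rule ext) (use that h a in \<open>auto simp: hom_iff\<close>)
  qed
qed (use assms in \<open>auto simp: hom_iff\<close>)

lemma is_terminalD:
  "\<lbrakk>is_terminal C T; f \<in> Arr C; g \<in> Arr C; Cod C f = T; Cod C g = T; Dom C f = Dom C g\<rbrakk> \<Longrightarrow> f = g"
  unfolding is_terminal_def using dom_in_Obj by (metis hom_iff)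

lemma is_initialD:
  "\<lbrakk>is_initial C T; f \<in> Arr C; g \<in> Arr C; Dom C f = T; Dom C g = T; Cod C f = Cod C g\<rbrakk> \<Longrightarrow> f = g"
  unfolding is_initial_def using cod_in_Obj by (metis hom_iff)

text \<open>Two zero objects are linked by an arrow \<open>t\<close>, and both factorisations are
  compared with the path through it. Hence the description \<open>zero_arr\<close>, which ranges
  over all zero objects, is well defined.\<close>

lemma zero_arr_unique:
  assumes "is_zero C Z" "is_zero C Z'" "f \<in> hom C A Z" "g \<in> hom C Z B" "f' \<in> hom C A Z'" "g' \<in> hom C Z' B"
  shows "g \<cdot> f = g' \<cdot> f'"
proof -
  obtain t where t: "t \<in> hom C Z Z'" using assms by (auto simp: is_zero_def is_initial_def)
  have "t \<cdot> f = f'" by (rule is_terminalD[of Z']) (use assms t in \<open>auto simp: is_zero_def hom_iff\<close>)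
  moreover have "g' \<cdot> t = g" by (rule is_initialD[of Z]) (use assms t in \<open>auto simp: is_zero_def hom_iff\<close>)
  ultimately show ?thesis using cmp_assoc[OF assms(3) t assms(6)] by metis
qed

lemma zero_arr_eq:
  assumes "is_zero C Z" "f \<in> hom C A Z" "g \<in> hom C Z B"
  shows "zero_arr C A B = g \<cdot> f"
  unfolding zero_arr_def by (rule the_equality) (use assms zero_arr_unique in blast)+

end

locale pointed_category = category +
  assumes pointed: "pointed C"
begin

abbreviation zro where "zro \<equiv> zero_arr C"

lemma zero_ob: "is_zero C (zero_ob C)"
  using pointed unfolding pointed_def zero_ob_def by (rule someI_ex)

lemma zero_ob_obj [simp]: "zero_ob C \<in> Obj C"
  using zero_ob by (auto simp: is_zero_def is_initial_def)

lemma zro_decomp: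
  assumes "A \<in> Obj C" "B \<in> Obj C"
  obtains f g where "f \<in> hom C A (zero_ob C)" "g \<in> hom C (zero_ob C) B" "zro A B = g \<cdot> f"
proof -
  obtain f g where "f \<in> hom C A (zero_ob C)" "g \<in> hom C (zero_ob C) B"
    using assms zero_ob unfolding is_zero_def is_initial_def is_terminal_def by metis
  then show thesis using that zero_arr_eq[OF zero_ob] by auto
qed

lemma zro_hom:
  assumes "A \<in> Obj C" "B \<in> Obj C" shows "zro A B \<in> hom C A B"
  using zro_decomp[OF assms] cmp_in_hom by metis

lemma zro_arr [simp]: "\<lbrakk>A \<in> Obj C; B \<in> Obj C\<rbrakk> \<Longrightarrow> zro A B \<in> Arr C"
  and zro_dom [simp]: "\<lbrakk>A \<in> Obj C; B \<in> Obj C\<rbrakk> \<Longrightarrow> Dom C (zro A B) = A"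
  and zro_cod [simp]: "\<lbrakk>A \<in> Obj C; B \<in> Obj C\<rbrakk> \<Longrightarrow> Cod C (zro A B) = B"
  using zro_hom[of A B] by (auto simp: hom_iff)

lemma cmp_zro [simp]:
  assumes "g \<in> Arr C" "A \<in> Obj C" "Dom C g = B" shows "g \<cdot> zro A B = zro A (Cod C g)"
proof -
  have B: "B \<in> Obj C" using assms by auto
  obtain a b where ab: "a \<in> hom C A (zero_ob C)" "b \<in> hom C (zero_ob C) B" "zro A B = b \<cdot> a"
    using zro_decomp[OF assms(2) B] .
  have "zro A (Cod C g) = (g \<cdot> b) \<cdot> a" by (rule zero_arr_eq[OF zero_ob]) (use ab assms in \<open>auto simp: hom_iff\<close>)
  then show ?thesis using ab assms by (auto simp: hom_iff)
qed

lemma zro_cmp [simp]: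
  assumes "f \<in> Arr C" "B \<in> Obj C" "Cod C f = A" shows "zro A B \<cdot> f = zro (Dom C f) B"
proof -
  have A: "A \<in> Obj C" using assms by auto
  obtain a b where ab: "a \<in> hom C A (zero_ob C)" "b \<in> hom C (zero_ob C) B" "zro A B = b \<cdot> a"
    using zro_decomp[OF A assms(2)] .
  have "zro (Dom C f) B = b \<cdot> (a \<cdot> f)" by (rule zero_arr_eq[OF zero_ob]) (use ab assms in \<open>auto simp: hom_iff\<close>)
  then show ?thesis using ab assms by (auto simp: hom_iff)
qed

lemma zero_from:
  assumes "is_zero C A" "f \<in> Arr C" "Dom C f = A" shows "f = zro A (Cod C f)"
proof -
  have A: "A \<in> Obj C" using assms by auto
  have i: "is_initial C A" using assms(1) by (simp add: is_zero_def)
  show ?thesis by (rule is_initialD[OF i assms(2) _ assms(3)]) (simp_all add: A assms)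
qed

lemma zero_to:
  assumes "is_zero C A" "f \<in> Arr C" "Cod C f = A" shows "f = zro (Dom C f) A"
proof -
  have A: "A \<in> Obj C" using obj_cod[OF assms(2)] assms(3) by simp
  have t: "is_terminal C A" using assms(1) by (simp add: is_zero_def)
  show ?thesis by (rule is_terminalD[OF t assms(2) _ assms(3)]) (simp_all add: A assms)
qed

lemma is_zeroI:
  assumes A: "A \<in> Obj C" and eq: "Ide C A = zro A A" shows "is_zero C A"
proof -
  have "f = zro X A" if "f \<in> hom C X A" for f X
  proof -
    have "f = Ide C A \<cdot> f" using that by (simp add: hom_iff)
    then show ?thesis using that A unfolding eq by (simp add: hom_iff)
  qed
  moreover have "f = zro A X" if "f \<in> hom C A X" for f X
  proof -
    have "f = f \<cdot> Ide C A" using that by (simp add: hom_iff)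
    then show ?thesis using that A unfolding eq by (simp add: hom_iff)
  qed
  ultimately show ?thesis using A zro_hom unfolding is_zero_def is_terminal_def is_initial_def by blast
qed

section \<open>Kernels and cokernels\<close>

lemma kernelD:
  assumes "is_kernel C f k"
  shows "f \<in> Arr C" "k \<in> Arr C" "Cod C k = Dom C f" "f \<cdot> k = zro (Dom C k) (Cod C f)"
  using assms by (auto simp: is_kernel_def hom_iff)

lemma kernel_factor:
  assumes "is_kernel C f k" "h \<in> Arr C" "Cod C h = Dom C f" "f \<cdot> h = zro (Dom C h) (Cod C f)"
  obtains u where "u \<in> Arr C" "Dom C u = Dom C h" "Cod C u = Dom C k" "k \<cdot> u = h"
proof -
  have "h \<in> hom C (Dom C h) (Dom C f)" using assms by (auto simp: hom_iff)
  then have "\<exists>!u. u \<in> hom C (Dom C h) (Dom C k) \<and> k \<cdot> u = h" using assms unfolding is_kernel_def by blast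
  then show thesis using that by (auto simp: hom_iff)
qed

lemma kernel_mono:
  assumes k: "is_kernel C f k" shows "is_mono C k"
proof (rule is_monoI)
  note d = kernelD[OF k]
  show "k \<in> Arr C" by fact
  fix u v assume a: "u \<in> Arr C" "v \<in> Arr C" "Cod C u = Dom C k" "Cod C v = Dom C k" "Dom C u = Dom C v" "k \<cdot> u = k \<cdot> v"
  have "k \<cdot> u \<in> hom C (Dom C u) (Dom C f)" "f \<cdot> (k \<cdot> u) = zro (Dom C u) (Cod C f)"
    using d a d(4)[THEN reassoc, of u] by (auto simp: hom_iff)
  then have "\<exists>!w. w \<in> hom C (Dom C u) (Dom C k) \<and> k \<cdot> w = k \<cdot> u" using k unfolding is_kernel_def by blast
  then show "u = v" using a by (auto simp: hom_iff)
qed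

lemma is_kernelI:
  assumes "f \<in> Arr C" "is_mono C k" "Cod C k = Dom C f" "f \<cdot> k = zro (Dom C k) (Cod C f)"
    and fac: "\<And>h. \<lbrakk>h \<in> Arr C; Cod C h = Dom C f; f \<cdot> h = zro (Dom C h) (Cod C f)\<rbrakk>
      \<Longrightarrow> \<exists>u. u \<in> Arr C \<and> Dom C u = Dom C h \<and> Cod C u = Dom C k \<and> k \<cdot> u = h"
  shows "is_kernel C f k"
  unfolding is_kernel_def
proof (intro conjI allI ballI impI)
  fix X h assume a: "h \<in> hom C X (Dom C f)" "f \<cdot> h = zro X (Cod C f)"
  then obtain u where u: "u \<in> Arr C" "Dom C u = Dom C h" "Cod C u = Dom C k" "k \<cdot> u = h"
    using fac[of h] by (auto simp: hom_iff)
  show "\<exists>!u. u \<in> hom C X (Dom C k) \<and> k \<cdot> u = h"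
  proof (rule ex1I)
    show "u \<in> hom C X (Dom C k) \<and> k \<cdot> u = h" using u a by (auto simp: hom_iff)
    show "w = u" if "w \<in> hom C X (Dom C k) \<and> k \<cdot> w = h" for w
      by (rule is_mono_cancel[OF assms(2)]) (use that u a in \<open>auto simp: hom_iff\<close>)
  qed
qed (use assms is_mono_arr in \<open>auto simp: hom_iff\<close>)

text \<open>The protomodularity axiom speaks of pullbacks. This presents the kernel as the change of
  base along \<open>0 \<rightarrow> B\<close>, the one base change to which the axiom is applied
  below.\<close>

lemma kernel_is_pullback:
  assumes k: "is_kernel C f k"
  shows "is_pullback C (zro (zero_ob C) (Cod C f)) f (zro (Dom C k) (zero_ob C)) k"
proof -
  note d = kernelD[OF k]
  show ?thesis
  proof (rule is_pullbackI)
    fix u v assume a: "u \<in> Arr C" "v \<in> Arr C" "Dom C u = Dom C v" "Cod C u = Dom C (zro (zero_ob C) (Cod C f))"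
      "Cod C v = Dom C f" "zro (zero_ob C) (Cod C f) \<cdot> u = f \<cdot> v"
    then have "f \<cdot> v = zro (Dom C v) (Cod C f)" using d by simp
    then obtain h where h: "h \<in> Arr C" "Dom C h = Dom C v" "Cod C h = Dom C k" "k \<cdot> h = v"
      using kernel_factor[OF k a(2) a(5)] by auto
    then show "\<exists>h. h \<in> Arr C \<and> Dom C h = Dom C u \<and> Cod C h = Dom C (zro (Dom C k) (zero_ob C)) \<and>
             zro (Dom C k) (zero_ob C) \<cdot> h = u \<and> k \<cdot> h = v"
      using a d zero_to[OF zero_ob, of u] by (intro exI[of _ h]) auto
  next
    show "u = v" if "u \<in> Arr C" "v \<in> Arr C" "Dom C u = Dom C v" "Cod C u = Dom C (zro (Dom C k) (zero_ob C))"
       "Cod C v = Dom C (zro (Dom C k) (zero_ob C))" "k \<cdot> u = k \<cdot> v" for u v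
      by (rule is_mono_cancel[OF kernel_mono[OF k]]) (use that d in auto)
  qed (use d in auto)
qed

lemma cokernelD:
  assumes "is_cokernel C f q"
  shows "f \<in> Arr C" "q \<in> Arr C" "Dom C q = Cod C f" "q \<cdot> f = zro (Dom C f) (Cod C q)"
  using assms by (auto simp: is_cokernel_def hom_iff)

lemma cokernel_factor:
  assumes "is_cokernel C f q" "h \<in> Arr C" "Dom C h = Cod C f" "h \<cdot> f = zro (Dom C f) (Cod C h)"
  obtains u where "u \<in> Arr C" "Dom C u = Cod C q" "Cod C u = Cod C h" "u \<cdot> q = h"
proof -
  have "h \<in> hom C (Cod C f) (Cod C h)" using assms by (auto simp: hom_iff)
  then have "\<exists>!u. u \<in> hom C (Cod C q) (Cod C h) \<and> u \<cdot> q = h" using assms unfolding is_cokernel_def by blast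
  then show thesis using that by (auto simp: hom_iff)
qed

lemma cokernel_regular_epi:
  assumes "is_cokernel C f q" shows "is_regular_epi C q"
proof -
  note d = cokernelD[OF assms]
  have "is_coequalizer C f (zro (Dom C f) (Cod C f)) q"
    using assms d unfolding is_coequalizer_def is_cokernel_def by (auto simp: hom_iff)
  then show ?thesis by (auto simp: is_regular_epi_def)
qed

end

section \<open>Chosen products, coproducts and kernels\<close>

context category
begin

lemma productD:
  assumes "is_product C A B p q"
  shows "p \<in> hom C (Dom C p) A" "q \<in> hom C (Dom C p) B"
  using assms by (simp_all add: is_product_def)

lemma product_ex1:
  "\<lbrakk>is_product C A B p q; f \<in> hom C X A; g \<in> hom C X B\<rbrakk>
    \<Longrightarrow> \<exists>!h. h \<in> hom C X (Dom C p) \<and> p \<cdot> h = f \<and> q \<cdot> h = g"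
  unfolding is_product_def by (elim conjE) simp

lemma product_ext:
  assumes P: "is_product C A B p q" and h: "h \<in> hom C X (Dom C p)" "k \<in> hom C X (Dom C p)"
    "p \<cdot> h = p \<cdot> k" "q \<cdot> h = q \<cdot> k"
  shows "h = k"
proof -
  have "p \<cdot> k \<in> hom C X A" "q \<cdot> k \<in> hom C X B" using productD[OF P] h by (auto simp: hom_iff)
  from product_ex1[OF P this] show ?thesis using h by metis
qed

text \<open>Stated in a bare category, from the existence of some product, so that it serves the
  choices made in \<open>nil2 C\<close> as well as those made in \<open>C\<close>. The same holds
  for the neighbouring lemmas on tuples, coproducts and kernels.\<close>

lemma proj_is_product:
  assumes "is_product C A B p q"
  shows "is_product C A B (proj1 C A B) (proj2 C A B)"
proof -
  have "case prod_cone C A B of (p, q) \<Rightarrow> is_product C A B p q"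
    unfolding prod_cone_def by (rule someI[of _ "(p, q)"]) (simp add: assms)
  then show ?thesis by (simp add: proj1_def proj2_def case_prod_beta)
qed

lemma tuple_props:
  assumes "is_product C A B (proj1 C A B) (proj2 C A B)" "f \<in> hom C X A" "g \<in> hom C X B"
  shows "tuple C f g \<in> hom C X (prod_ob C A B) \<and> proj1 C A B \<cdot> tuple C f g = f \<and> proj2 C A B \<cdot> tuple C f g = g"
proof -
  have "\<exists>!h. h \<in> hom C X (prod_ob C A B) \<and> proj1 C A B \<cdot> h = f \<and> proj2 C A B \<cdot> h = g"
    unfolding prod_ob_def by (rule product_ex1[OF assms])
  from theI'[OF this] show ?thesis using assms(2,3) by (simp add: tuple_def hom_iff)
qed

lemma coproductD:
  assumes "is_coproduct C A B i j"
  shows "i \<in> hom C A (Cod C i)" "j \<in> hom C B (Cod C i)"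
  using assms by (simp_all add: is_coproduct_def)

lemma coproduct_ex1:
  "\<lbrakk>is_coproduct C A B i j; f \<in> hom C A X; g \<in> hom C B X\<rbrakk>
    \<Longrightarrow> \<exists>!h. h \<in> hom C (Cod C i) X \<and> h \<cdot> i = f \<and> h \<cdot> j = g"
  unfolding is_coproduct_def by (elim conjE) simp

lemma coproduct_ext:
  assumes P: "is_coproduct C A B i j" and h: "h \<in> hom C (Cod C i) X" "k \<in> hom C (Cod C i) X"
    "h \<cdot> i = k \<cdot> i" "h \<cdot> j = k \<cdot> j"
  shows "h = k"
proof -
  have "k \<cdot> i \<in> hom C A X" "k \<cdot> j \<in> hom C B X" using coproductD[OF P] h by (auto simp: hom_iff)
  from coproduct_ex1[OF P this] show ?thesis using h by metis
qed

lemma inj_is_coproduct: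
  assumes "is_coproduct C A B i j"
  shows "is_coproduct C A B (inj1 C A B) (inj2 C A B)"
proof -
  have "case coprod_cocone C A B of (i, j) \<Rightarrow> is_coproduct C A B i j"
    unfolding coprod_cocone_def by (rule someI[of _ "(i, j)"]) (simp add: assms)
  then show ?thesis by (simp add: inj1_def inj2_def case_prod_beta)
qed

lemma cotuple_props:
  assumes "is_coproduct C A B (inj1 C A B) (inj2 C A B)" "f \<in> hom C A X" "g \<in> hom C B X"
  shows "cotuple C f g \<in> hom C (coprod_ob C A B) X \<and> cotuple C f g \<cdot> inj1 C A B = f \<and> cotuple C f g \<cdot> inj2 C A B = g"
proof -
  have "\<exists>!h. h \<in> hom C (coprod_ob C A B) X \<and> h \<cdot> inj1 C A B = f \<and> h \<cdot> inj2 C A B = g"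
    unfolding coprod_ob_def by (rule coproduct_ex1[OF assms])
  from theI'[OF this] show ?thesis using assms(2,3) by (simp add: cotuple_def hom_iff)
qed

lemma kernel_is_kernel:
  assumes "is_kernel C f k" shows "is_kernel C f (kernel C f)"
  unfolding kernel_def using assms by (rule someI)

lemma cokernel_is_cokernel:
  assumes "is_cokernel C f q" shows "is_cokernel C f (cokernel C f)"
  unfolding cokernel_def using assms by (rule someI)

end

text \<open>The fragment that supports calculation with tuples, cotuples and cosmash products;
  exactness and protomodularity come on top of it.\<close>

locale bicartesian_category = pointed_category +
  assumes products: "\<lbrakk>A \<in> Obj C; B \<in> Obj C\<rbrakk> \<Longrightarrow> \<exists>p q. is_product C A B p q"
    and coproducts: "\<lbrakk>A \<in> Obj C; B \<in> Obj C\<rbrakk> \<Longrightarrow> \<exists>i j. is_coproduct C A B i j"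
    and kernels: "f \<in> Arr C \<Longrightarrow> \<exists>k. is_kernel C f k"
begin

abbreviation pr1 where "pr1 \<equiv> proj1 C"
abbreviation pr2 where "pr2 \<equiv> proj2 C"
abbreviation prd where "prd \<equiv> prod_ob C"
abbreviation in1 where "in1 \<equiv> inj1 C"
abbreviation in2 where "in2 \<equiv> inj2 C"
abbreviation cop where "cop \<equiv> coprod_ob C"
abbreviation tup where "tup \<equiv> tuple C"
abbreviation cot where "cot \<equiv> cotuple C"
abbreviation ide where "ide \<equiv> Ide C"
abbreviation ker where "ker \<equiv> kernel C"

lemma proj_product: "\<lbrakk>A \<in> Obj C; B \<in> Obj C\<rbrakk> \<Longrightarrow> is_product C A B (pr1 A B) (pr2 A B)"
  using products proj_is_product by metis

lemma inj_coproduct: "\<lbrakk>A \<in> Obj C; B \<in> Obj C\<rbrakk> \<Longrightarrow> is_coproduct C A B (in1 A B) (in2 A B)"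
  using coproducts inj_is_coproduct by metis

lemma pr_simps [simp]:
  assumes "A \<in> Obj C" "B \<in> Obj C"
  shows "pr1 A B \<in> Arr C" "pr2 A B \<in> Arr C" "Dom C (pr1 A B) = prd A B" "Dom C (pr2 A B) = prd A B"
    "Cod C (pr1 A B) = A" "Cod C (pr2 A B) = B" "prd A B \<in> Obj C"
  using productD[OF proj_product[OF assms]] dom_in_Obj[of "pr1 A B"] by (auto simp: hom_iff prod_ob_def)

lemma in_simps [simp]:
  assumes "A \<in> Obj C" "B \<in> Obj C"
  shows "in1 A B \<in> Arr C" "in2 A B \<in> Arr C" "Cod C (in1 A B) = cop A B" "Cod C (in2 A B) = cop A B"
    "Dom C (in1 A B) = A" "Dom C (in2 A B) = B" "cop A B \<in> Obj C"
  using coproductD[OF inj_coproduct[OF assms]] cod_in_Obj[of "in1 A B"] by (auto simp: hom_iff coprod_ob_def)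

lemma tup_simps [simp]:
  assumes "f \<in> Arr C" "g \<in> Arr C" "Dom C f = Dom C g"
  shows "tup f g \<in> Arr C" "Dom C (tup f g) = Dom C g" "Cod C (tup f g) = prd (Cod C f) (Cod C g)"
  using tuple_props[OF proj_product, of "Cod C f" "Cod C g" f "Dom C g" g] assms by (auto simp: hom_iff)

lemma pr_tup [simp]:
  assumes "f \<in> Arr C" "g \<in> Arr C" "Dom C f = Dom C g" "Cod C f = A" "Cod C g = B"
  shows "pr1 A B \<cdot> tup f g = f" "pr2 A B \<cdot> tup f g = g"
  using tuple_props[OF proj_product, of "Cod C f" "Cod C g" f "Dom C g" g] assms by (auto simp: hom_iff)

lemma pr_tup' [simp]:
  assumes "f \<in> Arr C" "g \<in> Arr C" "Dom C f = Dom C g" "Cod C f = A" "Cod C g = B" "x \<in> Arr C" "Dom C g = Cod C x"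
  shows "pr1 A B \<cdot> (tup f g \<cdot> x) = f \<cdot> x" "pr2 A B \<cdot> (tup f g \<cdot> x) = g \<cdot> x"
proof -
  have [simp]: "A \<in> Obj C" "B \<in> Obj C" using assms by auto
  show "pr1 A B \<cdot> (tup f g \<cdot> x) = f \<cdot> x" by (rule reassoc) (use assms in simp_all)
  show "pr2 A B \<cdot> (tup f g \<cdot> x) = g \<cdot> x" by (rule reassoc) (use assms in simp_all)
qed

lemma prd_ext:
  assumes "h \<in> Arr C" "k \<in> Arr C" "Dom C h = Dom C k" "Cod C h = prd A B" "Cod C k = prd A B" "A \<in> Obj C" "B \<in> Obj C"
    "pr1 A B \<cdot> h = pr1 A B \<cdot> k" "pr2 A B \<cdot> h = pr2 A B \<cdot> k"
  shows "h = k"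
  by (rule product_ext[OF proj_product[of A B]]) (use assms in \<open>simp_all add: hom_iff\<close>)

lemma tup_cmp:
  assumes "f \<in> Arr C" "g \<in> Arr C" "Dom C f = Dom C g" "x \<in> Arr C" "Dom C g = Cod C x"
  shows "tup f g \<cdot> x = tup (f \<cdot> x) (g \<cdot> x)"
  by (rule prd_ext[of _ _ "Cod C f" "Cod C g"]) (use assms in simp_all)

lemma cot_simps [simp]:
  assumes "f \<in> Arr C" "g \<in> Arr C" "Cod C f = Cod C g"
  shows "cot f g \<in> Arr C" "Cod C (cot f g) = Cod C g" "Dom C (cot f g) = cop (Dom C f) (Dom C g)"
  using cotuple_props[OF inj_coproduct, of "Dom C f" "Dom C g" f "Cod C g" g] assms by (auto simp: hom_iff)

lemma cot_in [simp]:
  assumes "f \<in> Arr C" "g \<in> Arr C" "Cod C f = Cod C g" "Dom C f = A" "Dom C g = B"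
  shows "cot f g \<cdot> in1 A B = f" "cot f g \<cdot> in2 A B = g"
  using cotuple_props[OF inj_coproduct, of "Dom C f" "Dom C g" f "Cod C g" g] assms by (auto simp: hom_iff)

lemma cot_in' [simp]:
  assumes "f \<in> Arr C" "g \<in> Arr C" "Cod C f = Cod C g" "Dom C f = A" "Dom C g = B" "x \<in> Arr C"
  shows "Cod C x = A \<Longrightarrow> cot f g \<cdot> (in1 A B \<cdot> x) = f \<cdot> x" "Cod C x = B \<Longrightarrow> cot f g \<cdot> (in2 A B \<cdot> x) = g \<cdot> x"
proof -
  have [simp]: "A \<in> Obj C" "B \<in> Obj C" using assms by auto
  show "Cod C x = A \<Longrightarrow> cot f g \<cdot> (in1 A B \<cdot> x) = f \<cdot> x" by (rule reassoc) (use assms in simp_all)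
  show "Cod C x = B \<Longrightarrow> cot f g \<cdot> (in2 A B \<cdot> x) = g \<cdot> x" by (rule reassoc) (use assms in simp_all)
qed

lemma cop_ext:
  assumes "h \<in> Arr C" "k \<in> Arr C" "Cod C h = Cod C k" "Dom C h = cop A B" "Dom C k = cop A B" "A \<in> Obj C" "B \<in> Obj C"
    "h \<cdot> in1 A B = k \<cdot> in1 A B" "h \<cdot> in2 A B = k \<cdot> in2 A B"
  shows "h = k"
  by (rule coproduct_ext[OF inj_coproduct[of A B]]) (use assms in \<open>simp_all add: hom_iff\<close>)

lemma cmp_cot:
  assumes "f \<in> Arr C" "g \<in> Arr C" "Cod C f = Cod C g" "x \<in> Arr C" "Cod C g = Dom C x"
  shows "x \<cdot> cot f g = cot (x \<cdot> f) (x \<cdot> g)"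
  by (rule cop_ext[of _ _ "Dom C f" "Dom C g"]) (use assms in simp_all)

lemma ker_is_kernel: "f \<in> Arr C \<Longrightarrow> is_kernel C f (ker f)"
  using kernels kernel_is_kernel by metis

lemma ker_simps [simp]:
  assumes "f \<in> Arr C"
  shows "ker f \<in> Arr C" "Cod C (ker f) = Dom C f" "f \<cdot> ker f = zro (Dom C (ker f)) (Cod C f)"
  using kernelD[OF ker_is_kernel[OF assms]] by auto

lemma ker_simps' [simp]:
  assumes "f \<in> Arr C" "x \<in> Arr C" "Cod C x = Dom C (ker f)"
  shows "f \<cdot> (ker f \<cdot> x) = zro (Dom C x) (Cod C f)"
  using reassoc[OF ker_simps(3)[OF assms(1)], of x] assms by simp

end

section \<open>Regularity and protomodularity\<close>

lemma (in category) is_pointD: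
  assumes "is_point C p s"
  shows "p \<in> Arr C" "s \<in> Arr C" "Dom C s = Cod C p" "Cod C s = Dom C p" "p \<cdot> s = Ide C (Cod C p)"
  using assms by (auto simp: is_point_def hom_iff)

lemma (in category) is_pointI:
  "\<lbrakk>p \<in> Arr C; s \<in> Arr C; Dom C s = Cod C p; Cod C s = Dom C p; p \<cdot> s = Ide C (Cod C p)\<rbrakk> \<Longrightarrow> is_point C p s"
  by (auto simp: is_point_def hom_iff)

context pointed_category
begin

text \<open>A product is a pullback over the terminal object, where the compatibility condition is
  automatic.\<close>

lemma finitely_complete_products:
  assumes "finitely_complete C" "A \<in> Obj C" "B \<in> Obj C"
  shows "\<exists>p q. is_product C A B p q"
proof -
  obtain T where T: "is_terminal C T" using assms by (auto simp: finitely_complete_def)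
  obtain a b where ab: "a \<in> hom C A T" "b \<in> hom C B T"
    using T assms(2,3) unfolding is_terminal_def by metis
  then obtain p q where pb: "is_pullback C a b p q"
    using assms(1) unfolding finitely_complete_def by (metis hom_iff)
  have "\<exists>!h. h \<in> hom C X (Dom C p) \<and> p \<cdot> h = f \<and> q \<cdot> h = g" if fg: "f \<in> hom C X A" "g \<in> hom C X B" for X f g
  proof -
    have "a \<cdot> f = b \<cdot> g" by (rule is_terminalD[OF T]) (use ab fg in \<open>auto simp: hom_iff\<close>)
    then obtain h where h: "h \<in> hom C X (Dom C p)" "p \<cdot> h = f" "q \<cdot> h = g"
      using pullback_factor[OF pb, of f g] ab fg by (auto simp: hom_iff)
    moreover have "k = h" if "k \<in> hom C X (Dom C p)" "p \<cdot> k = f" "q \<cdot> k = g" for k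
      by (rule pullback_ext[OF pb]) (use that h in \<open>simp_all add: hom_iff\<close>)
    ultimately show ?thesis by metis
  qed
  moreover have "p \<in> hom C (Dom C p) A" "q \<in> hom C (Dom C p) B"
    using pullbackD[OF pb] ab by (auto simp: hom_iff)
  ultimately show ?thesis unfolding is_product_def by blast
qed

lemma finitely_complete_kernels:
  assumes "finitely_complete C" "f \<in> Arr C"
  shows "\<exists>k. is_kernel C f k"
proof -
  obtain p k where pb: "is_pullback C (zro (zero_ob C) (Cod C f)) f p k"
    using assms unfolding finitely_complete_def by (metis zro_arr zro_cod zero_ob_obj obj_cod)
  note d = pullbackD[OF pb]
  have z: "zro (zero_ob C) (Cod C f) \<cdot> x = zro (Dom C x) (Cod C f)" if "x \<in> Arr C" "Cod C x = zero_ob C" for x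
    using that assms by simp
  have "is_kernel C f k"
  proof (rule is_kernelI)
    show "is_mono C k"
    proof (rule is_monoI)
      fix u v assume a: "u \<in> Arr C" "v \<in> Arr C" "Cod C u = Dom C k" "Cod C v = Dom C k" "Dom C u = Dom C v" "k \<cdot> u = k \<cdot> v"
      have "p \<cdot> u = p \<cdot> v" by (rule is_terminalD[of "zero_ob C"]) (use zero_ob a d assms in \<open>auto simp: is_zero_def\<close>)
      then show "u = v" by (intro pullback_ext[OF pb a(1,2,5)]) (use a d in auto)
    qed (use d in auto)
    show "f \<cdot> k = zro (Dom C k) (Cod C f)" using d z[of p] assms by simp
    fix h assume h: "h \<in> Arr C" "Cod C h = Dom C f" "f \<cdot> h = zro (Dom C h) (Cod C f)"
    then show "\<exists>u. u \<in> Arr C \<and> Dom C u = Dom C h \<and> Cod C u = Dom C k \<and> k \<cdot> u = h"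
      using pullback_factor[OF pb, of "zro (Dom C h) (zero_ob C)" h] d assms by (auto simp: hom_iff)
  qed (use assms d in auto)
  then show ?thesis by blast
qed

end

locale semi_abelian_category =
  fixes C :: "('o, 'a) cat" (structure)
  assumes semi_abelian: "semi_abelian C"

sublocale semi_abelian_category \<subseteq> bicartesian_category C
proof -
  interpret pointed_category C
    using semi_abelian by (intro pointed_category.intro) (auto simp: semi_abelian_def pointed_category_axioms_def)
  have "finitely_complete C" using semi_abelian by (auto simp: semi_abelian_def barr_exact_def regular_category_def)
  then show "bicartesian_category C"
    using semi_abelian finitely_complete_products finitely_complete_kernels
    by unfold_locales (auto simp: semi_abelian_def has_binary_coproducts_def)
qed

context semi_abelian_category
begin

section \<open>Equalizers and image factorisations\<close>

lemma pullback_exists: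
  assumes "f \<in> Arr C" "g \<in> Arr C" "Cod C f = Cod C g"
  obtains p q where "is_pullback C f g p q"
  using semi_abelian assms unfolding semi_abelian_def barr_exact_def regular_category_def finitely_complete_def by blast

lemma regular_epi_pullback: "is_pullback C f g p q \<Longrightarrow> is_regular_epi C f \<Longrightarrow> is_regular_epi C q"
  using semi_abelian unfolding semi_abelian_def barr_exact_def regular_category_def by blast

lemma kernel_pair_coequalizer:
  assumes "is_pullback C f f p q" obtains c where "is_coequalizer C p q c"
  using semi_abelian assms unfolding semi_abelian_def barr_exact_def regular_category_def by blast

lemma equivalence_relation_effective:
  assumes "is_equivalence_relation C X r s" obtains f where "is_pullback C f f r s"
  using semi_abelian assms unfolding semi_abelian_def barr_exact_def by blast

lemma mono_pullback:
  assumes pb: "is_pullback C f g p q" and m: "is_mono C f"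
  shows "is_mono C q"
proof (rule is_monoI)
  note d = pullbackD[OF pb]
  show "q \<in> Arr C" by (rule d)
  fix u v assume a: "u \<in> Arr C" "v \<in> Arr C" "Cod C u = Dom C q" "Cod C v = Dom C q" "Dom C u = Dom C v" "q \<cdot> u = q \<cdot> v"
  have "f \<cdot> (p \<cdot> u) = f \<cdot> (p \<cdot> v)" using a d(9)[THEN reassoc, of u] d(9)[THEN reassoc, of v] d by simp
  then have "p \<cdot> u = p \<cdot> v" by (rule is_mono_cancel[OF m]) (use a d in auto)
  then show "u = v" by (intro pullback_ext[OF pb a(1,2,5)]) (use a d in auto)
qed

text \<open>The pullback of the graphs of \<open>u\<close> and \<open>w\<close>: comparing first
  components shows that its two projections coincide, and comparing second components that they
  equalise \<open>u\<close> and \<open>w\<close>.\<close>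

lemma equalizer_exists:
  assumes "u \<in> Arr C" "w \<in> Arr C" "Dom C u = Dom C w" "Cod C u = Cod C w"
  obtains m where "is_mono C m" "Cod C m = Dom C w" "u \<cdot> m = w \<cdot> m"
    "\<And>h. \<lbrakk>h \<in> Arr C; Cod C h = Dom C w; u \<cdot> h = w \<cdot> h\<rbrakk> \<Longrightarrow> \<exists>x. x \<in> Arr C \<and> Dom C x = Dom C h \<and> Cod C x = Dom C m \<and> m \<cdot> x = h"
proof -
  let ?A = "Dom C w" and ?B = "Cod C w"
  have [simp]: "?A \<in> Obj C" "?B \<in> Obj C" using assms by auto
  obtain a b where pb: "is_pullback C (tup (ide ?A) u) (tup (ide ?A) w) a b"
    by (rule pullback_exists[of "tup (ide ?A) u" "tup (ide ?A) w"]) (use assms in auto)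
  have d: "a \<in> Arr C" "b \<in> Arr C" "Cod C a = ?A" "Cod C b = ?A" "Dom C b = Dom C a"
    "tup (ide ?A) u \<cdot> a = tup (ide ?A) w \<cdot> b"
    using pullbackD[OF pb] assms by simp_all
  have "pr1 ?A ?B \<cdot> (tup (ide ?A) u \<cdot> a) = pr1 ?A ?B \<cdot> (tup (ide ?A) w \<cdot> b)"
    "pr2 ?A ?B \<cdot> (tup (ide ?A) u \<cdot> a) = pr2 ?A ?B \<cdot> (tup (ide ?A) w \<cdot> b)" using d(6) by simp_all
  then have ab: "a = b" and eq: "u \<cdot> a = w \<cdot> b" using d(1-5) assms by simp_all
  have mono: "is_mono C a"
  proof (rule is_monoI)
    fix f g assume a: "f \<in> Arr C" "g \<in> Arr C" "Cod C f = Dom C a" "Cod C g = Dom C a" "Dom C f = Dom C g" "a \<cdot> f = a \<cdot> g"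
    then show "f = g" by (intro pullback_ext[OF pb a(1,2,5)]) (simp_all add: ab)
  qed (rule d)
  have fac: "\<exists>x. x \<in> Arr C \<and> Dom C x = Dom C h \<and> Cod C x = Dom C a \<and> a \<cdot> x = h"
    if h: "h \<in> Arr C" "Cod C h = Dom C w" "u \<cdot> h = w \<cdot> h" for h
  proof -
    have eq: "tup (ide ?A) u \<cdot> h = tup (ide ?A) w \<cdot> h"
      by (rule prd_ext[of _ _ ?A ?B]) (use h assms in simp_all)
    show ?thesis
      by (rule pullback_factor[OF pb h(1) h(1) refl _ _ eq]) (use h(1,2) assms in auto)
  qed
  show thesis using that mono d(3) eq fac unfolding ab[symmetric] by blast
qed

lemma image_factorization:
  assumes f: "f \<in> Arr C"
  obtains m e where "is_mono C m" "is_regular_epi C e" "m \<cdot> e = f" "Dom C m = Cod C e" "Dom C e = Dom C f" "Cod C m = Cod C f"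
proof -
  obtain p q where pb: "is_pullback C f f p q" using pullback_exists[OF f f] by auto
  note d = pullbackD[OF pb]
  obtain c where co: "is_coequalizer C p q c" using kernel_pair_coequalizer[OF pb] .
  note c = coequalizerD[OF co]
  have ce: "is_regular_epi C c" using co by (auto simp: is_regular_epi_def)
  obtain m where m: "m \<in> Arr C" "Dom C m = Cod C c" "Cod C m = Cod C f" "m \<cdot> c = f"
    using coequalizer_factor[OF co f] d by auto
  have "is_mono C m"
  proof (rule is_monoI)
    fix a b assume a: "a \<in> Arr C" "b \<in> Arr C" "Cod C a = Dom C m" "Cod C b = Dom C m" "Dom C a = Dom C b" "m \<cdot> a = m \<cdot> b"
    \<comment> \<open>Pulling \<open>c\<close> back along \<open>a\<close>, and then along
      \<open>b \<cdot> c1\<close>, covers the common domain by epimorphisms after which both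
      \<open>a\<close> and \<open>b\<close> lift through \<open>c\<close>. The lifts have equal
      composites with \<open>f\<close>, so they factor through the kernel pair, which
      \<open>c\<close> coequalises.\<close>
    obtain a1 c1 where pb1: "is_pullback C c a a1 c1" by (rule pullback_exists[of c a]) (use c(3) a(1,3) m(2) in simp_all)
    note d1 = pullbackD[OF pb1]
    obtain b1 c2 where pb2: "is_pullback C c (b \<cdot> c1) b1 c2" by (rule pullback_exists[of c "b \<cdot> c1"]) (use c(3) a(1-5) m(2) d1(1-4,6-8) in simp_all)
    note d2 = pullbackD[OF pb2]
    have e: "epic C c1" "epic C c2"
      using regular_epi_pullback[OF pb1 ce] regular_epi_pullback[OF pb2 ce] by (auto intro: regular_epi_epic)
    have ty: "a1 \<in> Arr C" "c1 \<in> Arr C" "b1 \<in> Arr C" "c2 \<in> Arr C" "Cod C a1 = Dom C f" "Cod C c1 = Dom C b" "Dom C a1 = Dom C c1"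
      "Cod C b1 = Dom C f" "Cod C c2 = Dom C c1" "Dom C b1 = Dom C c2" "Dom C c = Dom C f" "c \<in> Arr C"
      using d1(1-4,6-8) d2(1-4,6-8) a(1-5) c(1-6) d(1-4,6-8) m(1-3) by simp_all
    have s1: "c \<cdot> a1 = a \<cdot> c1" and s2: "c \<cdot> b1 = b \<cdot> (c1 \<cdot> c2)" using d1(9) d2(9) ty a(1-5) m(1-3) by simp_all
    have "f \<cdot> (a1 \<cdot> c2) = m \<cdot> (a \<cdot> (c1 \<cdot> c2))"
      using ty m(1-3) a(1-5) s1[THEN reassoc, of c2] m(4)[THEN reassoc, of "a1 \<cdot> c2"] by simp
    also have "\<dots> = m \<cdot> (b \<cdot> (c1 \<cdot> c2))" using a(6)[THEN reassoc, of "c1 \<cdot> c2"] ty a(1-5) m(1-3) by simp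
    also have "\<dots> = f \<cdot> b1" using ty m(1-3) a(1-5) s2 m(4)[THEN reassoc, of b1] by simp
    finally have eq: "f \<cdot> (a1 \<cdot> c2) = f \<cdot> b1" .
    obtain w where w: "w \<in> Arr C" "Dom C w = Dom C (a1 \<cdot> c2)" "Cod C w = Dom C p" "p \<cdot> w = a1 \<cdot> c2" "q \<cdot> w = b1"
      by (rule pullback_factor[OF pb _ _ _ _ _ eq]) (use ty in simp_all)
    have "c \<cdot> (p \<cdot> w) = c \<cdot> (q \<cdot> w)"
      using c(1-6) d(8) w(1,3) c(7)[THEN reassoc, of w] by simp
    then have "(a \<cdot> c1) \<cdot> c2 = (b \<cdot> c1) \<cdot> c2"
      using s1[THEN reassoc, of c2] s2 ty a(1-5) m(1-3) unfolding w(4,5) by simp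
    then have "a \<cdot> c1 = b \<cdot> c1" by (rule epic_cancel[OF e(2)]) (use ty a(1-5) in simp_all)
    then show "a = b" by (rule epic_cancel[OF e(1)]) (use ty a(1-5) in simp_all)
  qed (rule m)
  then show thesis using that ce m c d by auto
qed

text \<open>The hypothesis says that \<open>f\<close> is an extremal epimorphism. It is applied to
  the mono part of the image factorisation, which leaves a regular epimorphism followed by an
  isomorphism.\<close>

lemma regular_epiI:
  assumes f: "f \<in> Arr C"
    and ext: "\<And>m g. \<lbrakk>is_mono C m; Cod C m = Cod C f; g \<in> Arr C; Dom C m = Cod C g; Dom C g = Dom C f; m \<cdot> g = f\<rbrakk> \<Longrightarrow> is_iso C m"
  shows "is_regular_epi C f"
proof -
  obtain m e where me: "is_mono C m" "is_regular_epi C e" "m \<cdot> e = f" "Dom C m = Cod C e" "Dom C e = Dom C f" "Cod C m = Cod C f"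
    using image_factorization[OF f] .
  have "is_iso C m" using ext[of m e] me regular_epi_arr[OF me(2)] by auto
  then show ?thesis using iso_regular_epi[OF me(2), of m] me by auto
qed

text \<open>The split short five lemma is protomodularity along \<open>0 \<rightarrow> B\<close>,
  where \<open>B\<close> is the common codomain of the two points, pulling a point back along this
  arrow being the same as taking its kernel.\<close>

lemma split_short_five:
  assumes p: "is_point C p s" and p': "is_point C p' s'" and f: "f \<in> Arr C" "Dom C f = Dom C p" "Cod C f = Dom C p'"
    "p' \<cdot> f = p" "f \<cdot> s = s'" and k: "is_kernel C p k" and k': "is_kernel C p' k'"
    and g: "is_iso C g" "Dom C g = Dom C k" "Cod C g = Dom C k'" "f \<cdot> k = k' \<cdot> g"
  shows "is_iso C f"
proof -
  note d = is_pointD[OF p] is_pointD[OF p'] kernelD[OF k] kernelD[OF k']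
  have [simp]: "g \<in> Arr C" using g(1) by (auto simp: is_iso_def)
  have c: "Cod C p = Cod C p'" using cod_cmp[of f p'] f d by auto
  have x: "zro (Dom C k') (zero_ob C) \<cdot> g = zro (Dom C k) (zero_ob C)" using g d by simp
  have pm: "protomodular C" using semi_abelian by (simp add: semi_abelian_def)
  show ?thesis
    by (rule pm[unfolded protomodular_def, rule_format,
        of p s p' s' f "zro (zero_ob C) (Cod C p)" "zro (Dom C k) (zero_ob C)" k "zro (Dom C k') (zero_ob C)" k' g])
      (use p p' f c g d kernel_is_pullback[OF k] kernel_is_pullback[OF k'] x in \<open>simp add: hom_iff\<close>)
qed

text \<open>The point restricts along \<open>m\<close> to \<open>p \<cdot> m\<close> with section
  \<open>s'\<close> and kernel \<open>k'\<close>, so the short five lemma applies to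
  \<open>m\<close> with an identity on kernels. In words: kernel and section together generate the
  total object. Most uses of protomodularity take this form.\<close>

lemma mono_kernel_section_iso:
  assumes p: "is_point C p s" and k: "is_kernel C p k" and m: "is_mono C m" "Cod C m = Dom C p"
    and k': "k' \<in> Arr C" "Cod C k' = Dom C m" "m \<cdot> k' = k" and s': "s' \<in> Arr C" "Cod C s' = Dom C m" "m \<cdot> s' = s"
  shows "is_iso C m"
proof -
  note d = is_pointD[OF p] kernelD[OF k] is_mono_arr[OF m(1)]
  have dk: "Dom C k' = Dom C k" using dom_cmp[of k' m] k' d by auto
  have ds: "Dom C s' = Dom C s" using dom_cmp[of s' m] s' d by auto
  have p2: "is_point C (p \<cdot> m) s'" by (rule is_pointI) (use d m s' ds in auto)
  have ker2: "is_kernel C (p \<cdot> m) k'"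
  proof (rule is_kernelI)
    show "is_mono C k'"
    proof (rule is_monoI)
      fix u v assume a: "u \<in> Arr C" "v \<in> Arr C" "Cod C u = Dom C k'" "Cod C v = Dom C k'" "Dom C u = Dom C v" "k' \<cdot> u = k' \<cdot> v"
      then have "(m \<cdot> k') \<cdot> u = (m \<cdot> k') \<cdot> v" using k'(1,2) d by simp
      then have "k \<cdot> u = k \<cdot> v" unfolding k'(3) .
      then show "u = v" by (rule is_mono_cancel[OF kernel_mono[OF k]]) (use a dk in auto)
    qed (rule k')
    show "p \<cdot> m \<cdot> k' = zro (Dom C k') (Cod C (p \<cdot> m))" using d m k' dk by simp
    fix h assume h: "h \<in> Arr C" "Cod C h = Dom C (p \<cdot> m)" "p \<cdot> m \<cdot> h = zro (Dom C h) (Cod C (p \<cdot> m))"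
    have "p \<cdot> (m \<cdot> h) = zro (Dom C (m \<cdot> h)) (Cod C p)" using h d m by simp
    then obtain u where u: "u \<in> Arr C" "Dom C u = Dom C h" "Cod C u = Dom C k" "k \<cdot> u = m \<cdot> h"
      using kernel_factor[OF k, of "m \<cdot> h"] h d m by auto
    then have "m \<cdot> (k' \<cdot> u) = m \<cdot> h" using k'(3)[THEN reassoc, of u] k' d dk by simp
    then have "k' \<cdot> u = h" by (rule is_mono_cancel[OF m(1)]) (use u k' d dk h m in auto)
    then show "\<exists>u. u \<in> Arr C \<and> Dom C u = Dom C h \<and> Cod C u = Dom C k' \<and> k' \<cdot> u = h" using u dk by auto
  qed (use d m k' in auto)
  show ?thesis
    by (rule split_short_five[OF p2 p _ _ _ _ _ ker2 k is_iso_ide[of "Dom C k"]]) (use d m s' k' dk in auto)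
qed

text \<open>The equalizer of \<open>u\<close> and \<open>w\<close> is a subobject that contains the
  kernel and the section, hence it is everything.\<close>

lemma point_ext:
  assumes p: "is_point C p s" and k: "is_kernel C p k" and u: "u \<in> Arr C" "w \<in> Arr C" "Dom C u = Dom C p" "Dom C w = Dom C p"
    "Cod C u = Cod C w" "u \<cdot> k = w \<cdot> k" "u \<cdot> s = w \<cdot> s"
  shows "u = w"
proof -
  note d = is_pointD[OF p] kernelD[OF k]
  have du: "Dom C u = Dom C w" using u by simp
  obtain m where m: "is_mono C m" "Cod C m = Dom C w" "u \<cdot> m = w \<cdot> m" and
    fac: "\<And>h. \<lbrakk>h \<in> Arr C; Cod C h = Dom C w; u \<cdot> h = w \<cdot> h\<rbrakk> \<Longrightarrow> \<exists>x. x \<in> Arr C \<and> Dom C x = Dom C h \<and> Cod C x = Dom C m \<and> m \<cdot> x = h"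
    by (rule equalizer_exists[OF u(1,2) du u(5)]) blast
  obtain k' where k': "k' \<in> Arr C" "Cod C k' = Dom C m" "m \<cdot> k' = k" using fac[of k] d u by auto
  obtain s' where s': "s' \<in> Arr C" "Cod C s' = Dom C m" "m \<cdot> s' = s" using fac[of s] d u by auto
  have "is_iso C m" by (rule mono_kernel_section_iso[OF p k m(1) _ k' s']) (use m u in simp)
  then obtain j where j: "m \<in> Arr C" "j \<in> Arr C" "Dom C j = Cod C m" "Cod C j = Dom C m" "m \<cdot> j = ide (Cod C m)"
    by (rule is_isoE)
  have "(u \<cdot> m) \<cdot> j = (w \<cdot> m) \<cdot> j" using m(3) by simp
  then show ?thesis using j m(2) u by simp
qed

end

section \<open>Difunctionality and cokernels\<close>

context semi_abelian_category
begin

lemma pullbackE: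
  assumes "f \<in> Arr C" "g \<in> Arr C" "Cod C f = Cod C g"
  obtains p q P where "is_pullback C f g p q" "p \<in> Arr C" "q \<in> Arr C" "Dom C p = P" "Dom C q = P"
    "Cod C p = Dom C f" "Cod C q = Dom C g" "P \<in> Obj C" "f \<cdot> p = g \<cdot> q"
proof -
  obtain p q where pb: "is_pullback C f g p q" using pullback_exists[OF assms] .
  show thesis by (rule that[OF pb, of "Dom C p"]) (use pullbackD[OF pb] in simp_all)
qed

lemma kerE:
  assumes "f \<in> Arr C"
  obtains k K where "is_kernel C f k" "k \<in> Arr C" "Dom C k = K" "Cod C k = Dom C f" "K \<in> Obj C" "f \<cdot> k = zro K (Cod C f)"
  using ker_is_kernel[OF assms] kernelD[OF ker_is_kernel[OF assms]] by (metis obj_dom)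

text \<open>The object \<open>P\<close> of suitable triples \<open>(u, v, w)\<close> is a pullback of split epimorphisms, and the subobject \<open>S\<close>
  of those triples for which \<open>x\<close> exists contains both sections, hence is everything.\<close>

lemma difunctional:
  assumes X: "X \<in> Obj C" "R \<in> Obj C"
    and r: "r0 \<in> Arr C" "r1 \<in> Arr C" "Dom C r0 = R" "Dom C r1 = R" "Cod C r0 = X" "Cod C r1 = X"
    and jm: "is_mono C (tup r0 r1)"
    and u: "u \<in> Arr C" "v \<in> Arr C" "w \<in> Arr C" "Dom C u = T" "Dom C v = T" "Dom C w = T"
      "Cod C u = R" "Cod C v = R" "Cod C w = R" "r1 \<cdot> u = r1 \<cdot> v" "r0 \<cdot> v = r0 \<cdot> w"
  obtains x where "x \<in> Arr C" "Dom C x = T" "Cod C x = R" "r0 \<cdot> x = r0 \<cdot> u" "r1 \<cdot> x = r1 \<cdot> w"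
proof -
  obtain a1 a2 A where pbA: "is_pullback C r1 r1 a1 a2" and a: "a1 \<in> Arr C" "a2 \<in> Arr C" "Dom C a1 = A" "Dom C a2 = A"
    "Cod C a1 = R" "Cod C a2 = R" "A \<in> Obj C" "r1 \<cdot> a1 = r1 \<cdot> a2"
    by (rule pullbackE[of r1 r1]) (use r in simp_all)
  obtain b1 b2 B where pbB: "is_pullback C r0 r0 b1 b2" and b: "b1 \<in> Arr C" "b2 \<in> Arr C" "Dom C b1 = B" "Dom C b2 = B"
    "Cod C b1 = R" "Cod C b2 = R" "B \<in> Obj C" "r0 \<cdot> b1 = r0 \<cdot> b2"
    by (rule pullbackE[of r0 r0]) (use r in simp_all)
  obtain p1 p2 P where pbP: "is_pullback C a2 b1 p1 p2" and p: "p1 \<in> Arr C" "p2 \<in> Arr C" "Dom C p1 = P" "Dom C p2 = P"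
    "Cod C p1 = A" "Cod C p2 = B" "P \<in> Obj C" "a2 \<cdot> p1 = b1 \<cdot> p2"
    by (rule pullbackE[of a2 b1]) (use a b in simp_all)
  obtain d where d: "d \<in> Arr C" "Dom C d = R" "Cod C d = A" "a1 \<cdot> d = ide R" "a2 \<cdot> d = ide R"
    by (rule pullback_factor[OF pbA, of "ide R" "ide R"]) (use r a X in simp_all)
  obtain t where t: "t \<in> Arr C" "Dom C t = B" "Cod C t = P" "p1 \<cdot> t = d \<cdot> b1" "p2 \<cdot> t = ide B"
    by (rule pullback_factor[OF pbP, of "d \<cdot> b1" "ide B"]) (use a b p d X d(5)[THEN reassoc, of b1] in simp_all)
  have pt: "is_point C p2 t" by (rule is_pointI) (use p t in simp_all)
  obtain k K where k: "is_kernel C p2 k" "k \<in> Arr C" "Dom C k = K" "Cod C k = P" "K \<in> Obj C" "p2 \<cdot> k = zro K B"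
    by (rule kerE[OF p(2)]) (use p in simp_all)
  define g where "g = tup (r0 \<cdot> (a1 \<cdot> p1)) (r1 \<cdot> (b2 \<cdot> p2))"
  have g: "g \<in> Arr C" "Dom C g = P" "Cod C g = prd X X" and g1: "pr1 X X \<cdot> g = r0 \<cdot> (a1 \<cdot> p1)" and g2: "pr2 X X \<cdot> g = r1 \<cdot> (b2 \<cdot> p2)"
    unfolding g_def using r a b p by simp_all
  obtain h m S where pbS: "is_pullback C (tup r0 r1) g h m" and h: "h \<in> Arr C" "m \<in> Arr C" "Dom C h = S" "Dom C m = S"
    "Cod C h = R" "Cod C m = P" "S \<in> Obj C" "tup r0 r1 \<cdot> h = g \<cdot> m"
    by (rule pullbackE[of "tup r0 r1" g]) (use r g in simp_all)
  have m: "is_mono C m" by (rule mono_pullback[OF pbS jm])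
  \<comment> \<open>The kernel of \<open>p2\<close> consists of the triples
    \<open>(u, 0, 0)\<close>, where \<open>x = u\<close> works; the section \<open>t\<close> gives
    the triples \<open>(v, v, w)\<close>, where \<open>x = w\<close> works. The two equations
    \<open>e1\<close> and \<open>e2\<close> say this.\<close>
  have e1: "tup r0 r1 \<cdot> (a1 \<cdot> (p1 \<cdot> k)) = g \<cdot> k"
  proof (rule prd_ext[of _ _ X X])
    have "r1 \<cdot> (a1 \<cdot> (p1 \<cdot> k)) = r1 \<cdot> (b1 \<cdot> (p2 \<cdot> k))"
      using a(8)[THEN reassoc, of "p1 \<cdot> k"] p(8)[THEN reassoc, of k] r a p k(2-5) b by simp
    then show "pr2 X X \<cdot> (tup r0 r1 \<cdot> (a1 \<cdot> (p1 \<cdot> k))) = pr2 X X \<cdot> (g \<cdot> k)"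
      using g2[THEN reassoc, of k] r a p k(2-6) b X g by simp
    show "pr1 X X \<cdot> (tup r0 r1 \<cdot> (a1 \<cdot> (p1 \<cdot> k))) = pr1 X X \<cdot> (g \<cdot> k)"
      using g1[THEN reassoc, of k] r a p k(2-6) b X g by simp
  qed (use r a p k(2-5) g X in simp_all)
  obtain k' where k': "k' \<in> Arr C" "Dom C k' = K" "Cod C k' = S" "m \<cdot> k' = k"
    by (rule pullback_factor[OF pbS _ _ _ _ _ e1]) (use r a p k(2-5) g h X in simp_all)
  have e2: "tup r0 r1 \<cdot> b2 = g \<cdot> t"
  proof (rule prd_ext[of _ _ X X])
    show "pr2 X X \<cdot> (tup r0 r1 \<cdot> b2) = pr2 X X \<cdot> (g \<cdot> t)"
      using g2[THEN reassoc, of t] r b p t X g by simp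
    show "pr1 X X \<cdot> (tup r0 r1 \<cdot> b2) = pr1 X X \<cdot> (g \<cdot> t)"
      using g1[THEN reassoc, of t] d(4)[THEN reassoc, of b1] r a p t b X g d by simp
  qed (use r b t g X in simp_all)
  obtain t' where t': "t' \<in> Arr C" "Dom C t' = B" "Cod C t' = S" "m \<cdot> t' = t"
    by (rule pullback_factor[OF pbS _ _ _ _ _ e2]) (use r b t(1-3) g h in simp_all)
  have "is_iso C m" by (rule mono_kernel_section_iso[OF pt k(1) m _ k'(1) _ k'(4) t'(1) _ t'(4)]) (use h p k' t' in simp_all)
  then obtain j where j: "j \<in> Arr C" "Dom C j = P" "Cod C j = S" "m \<cdot> j = ide P"
    by (rule is_isoE) (use h in simp)
  obtain x where x: "x \<in> Arr C" "Dom C x = T" "Cod C x = A" "a1 \<cdot> x = u" "a2 \<cdot> x = v"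
    by (rule pullback_factor[OF pbA _ _ _ _ _ u(10)]) (use u a r in simp_all)
  obtain y where y: "y \<in> Arr C" "Dom C y = T" "Cod C y = B" "b1 \<cdot> y = v" "b2 \<cdot> y = w"
    by (rule pullback_factor[OF pbB _ _ _ _ _ u(11)]) (use u b r in simp_all)
  obtain z where z: "z \<in> Arr C" "Dom C z = T" "Cod C z = P" "p1 \<cdot> z = x" "p2 \<cdot> z = y"
    by (rule pullback_factor[OF pbP, of x y]) (use x y u a b p in simp_all)
  have eq: "tup r0 r1 \<cdot> (h \<cdot> (j \<cdot> z)) = g \<cdot> z"
    using h(8)[THEN reassoc, of "j \<cdot> z"] j(4)[THEN reassoc, of z] h(1-7) j z g r by simp
  have "pr1 X X \<cdot> (tup r0 r1 \<cdot> (h \<cdot> (j \<cdot> z))) = r0 \<cdot> u" "pr2 X X \<cdot> (tup r0 r1 \<cdot> (h \<cdot> (j \<cdot> z))) = r1 \<cdot> w"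
    unfolding eq using g1[THEN reassoc, of z] g2[THEN reassoc, of z] r a b p x y z X g by simp_all
  then have "r0 \<cdot> (h \<cdot> (j \<cdot> z)) = r0 \<cdot> u" "r1 \<cdot> (h \<cdot> (j \<cdot> z)) = r1 \<cdot> w"
    using r h(1-7) j z by simp_all
  then show thesis using that[of "h \<cdot> (j \<cdot> z)"] h(1-7) j z by simp
qed

text \<open>The Mal'tsev property follows from difunctionality. Symmetry comes from the triple
  formed by \<open>e \<cdot> r1\<close>, the identity and \<open>e \<cdot> r0\<close>; for
  transitivity, the diagonal at the common endpoint is inserted between \<open>p\<close> and
  \<open>q\<close>.\<close>

lemma reflexive_relation_equivalence:
  assumes X: "X \<in> Obj C" "R \<in> Obj C"
    and r: "r0 \<in> Arr C" "r1 \<in> Arr C" "Dom C r0 = R" "Dom C r1 = R" "Cod C r0 = X" "Cod C r1 = X"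
    and jm: "is_mono C (tup r0 r1)"
    and e: "e \<in> Arr C" "Dom C e = X" "Cod C e = R" "r0 \<cdot> e = ide X" "r1 \<cdot> e = ide X"
  shows "is_equivalence_relation C X r0 r1"
proof -
  note re = e(4)[THEN reassoc] e(5)[THEN reassoc]
  have jm': "f = g" if "f \<in> hom C T R" "g \<in> hom C T R" "r0 \<cdot> f = r0 \<cdot> g" "r1 \<cdot> f = r1 \<cdot> g" for T f g
  proof -
    have "tup r0 r1 \<cdot> f = tup r0 r1 \<cdot> g"
      by (rule prd_ext[of _ _ X X]) (use r that X in \<open>simp_all add: hom_iff\<close>)
    then show ?thesis by (rule is_mono_cancel[OF jm]) (use r that in \<open>simp_all add: hom_iff\<close>)
  qed
  have sym: "\<exists>t \<in> hom C R R. r0 \<cdot> t = r1 \<and> r1 \<cdot> t = r0"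
    by (rule difunctional[OF X r jm, of "e \<cdot> r1" "ide R" "e \<cdot> r0" R]) (use X r e re in \<open>auto simp: hom_iff\<close>)
  have trans: "\<exists>m \<in> hom C (Dom C p) R. r0 \<cdot> m = r0 \<cdot> p \<and> r1 \<cdot> m = r1 \<cdot> q" if pb: "is_pullback C r1 r0 p q" for p q
  proof -
    have d: "p \<in> Arr C" "q \<in> Arr C" "Cod C p = R" "Cod C q = R" "Dom C q = Dom C p" "r1 \<cdot> p = r0 \<cdot> q"
      using pullbackD[OF pb] r by simp_all
    show ?thesis
      by (rule difunctional[OF X r jm, of p "e \<cdot> (r1 \<cdot> p)" q "Dom C p"]) (use X r e d re in \<open>auto simp: hom_iff\<close>)
  qed
  show ?thesis unfolding is_equivalence_relation_def Let_def r(3)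
  proof (intro conjI allI ballI impI)
    show "\<exists>e \<in> hom C X R. r0 \<cdot> e = ide X \<and> r1 \<cdot> e = ide X" using e by (auto simp: hom_iff)
  qed (use r jm' sym trans in \<open>simp_all add: hom_iff\<close>)
qed

text \<open>In \<open>Y \<times> Y\<close>, the image of the arrow induced by the diagonal and by
  \<open>(0, f)\<close> is a reflexive relation, hence an equivalence relation, hence effective. An
  arrow coequalises its two legs exactly when it kills \<open>f\<close>, so the coequalizer of the
  legs is the cokernel.\<close>

lemma cokernel_exists:
  assumes f: "f \<in> Arr C" obtains q where "is_cokernel C f q"
proof -
  obtain X Y where o [simp]: "Dom C f = X" "Cod C f = Y" "X \<in> Obj C" "Y \<in> Obj C" using f by auto
  note [simp] = f
  let ?a = "cot (ide Y) (zro X Y)" and ?b = "cot (ide Y) f"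
  obtain m e where me: "is_mono C m" "is_regular_epi C e" "m \<cdot> e = tup ?a ?b" "Dom C m = Cod C e" "Dom C e = Dom C (tup ?a ?b)"
    "Cod C m = Cod C (tup ?a ?b)"
    by (rule image_factorization[of "tup ?a ?b"]) simp_all
  define R where "R = Cod C e"
  have m: "m \<in> Arr C" "Dom C m = R" "Cod C m = prd Y Y" and e: "e \<in> Arr C" "Dom C e = cop Y X" "Cod C e = R" "R \<in> Obj C"
    and ee: "epic C e"
    using is_mono_arr[OF me(1)] regular_epi_arr[OF me(2)] regular_epi_epic[OF me(2)] me(4-6) by (simp_all add: R_def)
  define r0 where "r0 = pr1 Y Y \<cdot> m"
  define r1 where "r1 = pr2 Y Y \<cdot> m"
  have r: "r0 \<in> Arr C" "r1 \<in> Arr C" "Dom C r0 = R" "Dom C r1 = R" "Cod C r0 = Y" "Cod C r1 = Y"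
    using m by (simp_all add: r0_def r1_def)
  have tm: "tup r0 r1 = m" by (rule prd_ext[of _ _ Y Y]) (use m r in \<open>simp_all add: r0_def[symmetric] r1_def[symmetric]\<close>)
  have re: "r0 \<cdot> e = ?a" "r1 \<cdot> e = ?b" unfolding r0_def r1_def using m e me(3) by simp_all
  have ei: "r0 \<cdot> (e \<cdot> in1 Y X) = ide Y" "r1 \<cdot> (e \<cdot> in1 Y X) = ide Y" "r0 \<cdot> (e \<cdot> in2 Y X) = zro X Y" "r1 \<cdot> (e \<cdot> in2 Y X) = f"
    using re(1)[THEN reassoc, of "in1 Y X"] re(2)[THEN reassoc, of "in1 Y X"]
      re(1)[THEN reassoc, of "in2 Y X"] re(2)[THEN reassoc, of "in2 Y X"] r e by simp_all
  have "is_equivalence_relation C Y r0 r1"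
    by (rule reflexive_relation_equivalence[of Y R r0 r1 "e \<cdot> in1 Y X"]) (use r e ei me(1) tm in simp_all)
  then obtain g where "is_pullback C g g r0 r1" by (rule equivalence_relation_effective)
  then obtain c where co: "is_coequalizer C r0 r1 c" by (rule kernel_pair_coequalizer)
  have c: "c \<in> Arr C" "Dom C c = Y" "c \<cdot> r0 = c \<cdot> r1" using coequalizerD[OF co] r by simp_all
  have "c \<cdot> f = c \<cdot> (r1 \<cdot> (e \<cdot> in2 Y X))" using ei by simp
  also have "\<dots> = c \<cdot> (r0 \<cdot> (e \<cdot> in2 Y X))"
    using c(3)[THEN reassoc, of "e \<cdot> in2 Y X"] c(1,2) r e by simp
  finally have cf: "c \<cdot> f = zro X (Cod C c)" using c ei by simp
  have fac: "\<exists>!u. u \<in> hom C (Cod C c) Z \<and> u \<cdot> c = h" if h: "h \<in> hom C Y Z" "h \<cdot> f = zro X Z" for h Z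
  proof -
    have h': "h \<in> Arr C" "Dom C h = Y" "Cod C h = Z" "Z \<in> Obj C" using h by (auto simp: hom_iff)
    have "h \<cdot> ?a = h \<cdot> ?b" using h' h(2) by (simp add: cmp_cot)
    then have "(h \<cdot> r0) \<cdot> e = (h \<cdot> r1) \<cdot> e" using h' r e re by simp
    then have eq: "h \<cdot> r0 = h \<cdot> r1" by (rule epic_cancel[OF ee]) (use h' r e in simp_all)
    obtain u where u: "u \<in> Arr C" "Dom C u = Cod C c" "Cod C u = Z" "u \<cdot> c = h"
      by (rule coequalizer_factor[OF co h'(1) _ eq]) (use h' r in simp_all)
    have "epic C c" using co by (intro regular_epi_epic) (auto simp: is_regular_epi_def)
    then have uniq: "v = u" if "v \<in> hom C (Cod C c) Z \<and> v \<cdot> c = h" for v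
      by (rule epic_cancel) (use that u in \<open>simp_all add: hom_iff\<close>)
    show ?thesis by (rule ex1I[of _ u, OF _ uniq]) (use u in \<open>simp_all add: hom_iff\<close>)
  qed
  have "is_cokernel C f c" unfolding is_cokernel_def o
  proof (intro conjI allI ballI impI)
    show "\<exists>!u. u \<in> hom C (Cod C c) Z \<and> u \<cdot> c = h" if "h \<in> hom C Y Z" "h \<cdot> f = zro X Z" for Z h
      using that by (rule fac)
  qed (use c(1,2) cf in \<open>simp_all add: hom_iff\<close>)
  then show thesis by (rule that)
qed

lemma cokernel_cokernel: "f \<in> Arr C \<Longrightarrow> is_cokernel C f (cokernel C f)"
  using cokernel_exists cokernel_is_cokernel by metis

text \<open>A regular epimorphism is the cokernel of its kernel. The first leg \<open>p\<close> of
  the kernel pair of \<open>e\<close> is split by the diagonal, and \<open>h \<cdot> p\<close> and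
  \<open>h \<cdot> q\<close> agree on that section and on the kernel of \<open>p\<close>, which
  \<open>q\<close> carries into the kernel of \<open>e\<close>. So \<open>h\<close> respects the
  kernel pair.\<close>

lemma regular_epi_factor:
  assumes e: "is_regular_epi C e" and k: "is_kernel C e k" and h: "h \<in> Arr C" "Dom C h = Dom C e" "h \<cdot> k = zro (Dom C k) (Cod C h)"
  obtains u where "u \<in> Arr C" "Dom C u = Cod C e" "Cod C u = Cod C h" "u \<cdot> e = h"
proof -
  obtain A where A: "e \<in> Arr C" "Dom C e = A" "Dom C h = A" "A \<in> Obj C" using regular_epi_arr[OF e] h by auto
  obtain K where K: "k \<in> Arr C" "Dom C k = K" "Cod C k = A" "K \<in> Obj C" "h \<cdot> k = zro K (Cod C h)" using kernelD[OF k] h A by auto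
  obtain p q P where pb: "is_pullback C e e p q" and p: "p \<in> Arr C" "q \<in> Arr C" "Dom C p = P" "Dom C q = P"
    "Cod C p = A" "Cod C q = A" "P \<in> Obj C" "e \<cdot> p = e \<cdot> q"
    by (rule pullbackE[of e e]) (use A in simp_all)
  obtain s where s: "s \<in> Arr C" "Dom C s = A" "Cod C s = P" "p \<cdot> s = ide A" "q \<cdot> s = ide A"
    by (rule pullback_factor[OF pb, of "ide A" "ide A"]) (use A p in simp_all)
  have pt: "is_point C p s" by (rule is_pointI) (use p s A in simp_all)
  obtain l L where l: "is_kernel C p l" "l \<in> Arr C" "Dom C l = L" "Cod C l = P" "L \<in> Obj C" "p \<cdot> l = zro L A"
    by (rule kerE[OF p(1)]) (use p in simp_all)
  have "e \<cdot> (q \<cdot> l) = zro L (Cod C e)" using p(8)[THEN reassoc, of l] p(1-7) l(2-6) A by simp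
  then obtain x where x: "x \<in> Arr C" "Dom C x = L" "Cod C x = K" "k \<cdot> x = q \<cdot> l"
    using kernel_factor[OF k, of "q \<cdot> l"] p l(2-5) A K(2) by auto
  have hql: "h \<cdot> (q \<cdot> l) = zro L (Cod C h)" using K(5)[THEN reassoc, of x] K(1-4) x(1-3) h(1) A(3) by (simp flip: x(4))
  have hpq: "h \<cdot> p = h \<cdot> q"
    by (rule point_ext[OF pt l(1)]) (use hql p s l(2-6) A(2-4) h(1) in simp_all)
  obtain f g where co: "is_coequalizer C f g e" using e by (auto simp: is_regular_epi_def)
  define F where "F = Dom C f"
  have fg: "f \<in> Arr C" "g \<in> Arr C" "Dom C f = F" "Dom C g = F" "Cod C f = A" "Cod C g = A" "e \<cdot> f = e \<cdot> g"
    using coequalizerD[OF co] A(2) by (simp_all add: F_def)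
  obtain y where y: "y \<in> Arr C" "Dom C y = F" "Cod C y = P" "p \<cdot> y = f" "q \<cdot> y = g"
    by (rule pullback_factor[OF pb _ _ _ _ _ fg(7)]) (use fg A p in simp_all)
  have "h \<cdot> (p \<cdot> y) = h \<cdot> (q \<cdot> y)" using hpq[THEN reassoc, of y] y(1-3) p(1-7) A(3) h(1) by simp
  then have "h \<cdot> f = h \<cdot> g" by (simp add: y)
  then show thesis using coequalizer_factor[OF co h(1)] fg A that by auto
qed

end

section \<open>Cooperating morphisms\<close>

context bicartesian_category
begin

declare tup_cmp [simp]

lemma cmp_cot':
  assumes "f \<in> Arr C" "g \<in> Arr C" "Cod C f = Cod C g" "x \<in> Arr C" "Cod C g = Dom C x" "y \<in> Arr C"
    "Cod C y = cop (Dom C f) (Dom C g)"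
  shows "x \<cdot> (cot f g \<cdot> y) = cot (x \<cdot> f) (x \<cdot> g) \<cdot> y"
  by (rule reassoc) (use assms in \<open>simp_all add: cmp_cot\<close>)

lemma tup_zro: "\<lbrakk>A \<in> Obj C; B \<in> Obj C; Z \<in> Obj C\<rbrakk> \<Longrightarrow> tup (zro Z A) (zro Z B) = zro Z (prd A B)"
  by (rule prd_ext[of _ _ A B]) simp_all

lemma pr1_point:
  assumes "A \<in> Obj C" "B \<in> Obj C" shows "is_point C (pr1 A B) (tup (ide A) (zro A B))"
  by (rule is_pointI) (use assms in simp_all)

lemma pr1_kernel:
  assumes "A \<in> Obj C" "B \<in> Obj C" shows "is_kernel C (pr1 A B) (tup (zro B A) (ide B))"
proof (rule is_kernelI)
  show "is_mono C (tup (zro B A) (ide B))"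
  proof (rule is_monoI)
    fix f g assume a: "f \<in> Arr C" "g \<in> Arr C" "Cod C f = Dom C (tup (zro B A) (ide B))" "Cod C g = Dom C (tup (zro B A) (ide B))"
      "Dom C f = Dom C g" "tup (zro B A) (ide B) \<cdot> f = tup (zro B A) (ide B) \<cdot> g"
    have "pr2 A B \<cdot> (tup (zro B A) (ide B) \<cdot> f) = pr2 A B \<cdot> (tup (zro B A) (ide B) \<cdot> g)" by (simp only: a(6))
    then show "f = g" using a(1-5) assms by simp
  qed (use assms in simp)
  fix h assume h: "h \<in> Arr C" "Cod C h = Dom C (pr1 A B)" "pr1 A B \<cdot> h = zro (Dom C h) (Cod C (pr1 A B))"
  have "tup (zro B A) (ide B) \<cdot> (pr2 A B \<cdot> h) = h"
    by (rule prd_ext[of _ _ A B]) (use h assms in simp_all)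
  then show "\<exists>u. u \<in> Arr C \<and> Dom C u = Dom C h \<and> Cod C u = Dom C (tup (zro B A) (ide B)) \<and> tup (zro B A) (ide B) \<cdot> u = h"
    using h(1,2) assms by (intro exI[of _ "pr2 A B \<cdot> h"]) simp
qed (use assms in simp_all)

text \<open>Commutation in the sense of Huq, with cooperator \<open>\<phi>\<close>. Asking for mere
  existence is harmless: in the semi-abelian setting \<open>prd_epi\<close> makes the cooperator
  unique.\<close>

definition coop where
  "coop f g \<longleftrightarrow> (\<exists>\<phi> \<in> hom C (prd (Dom C f) (Dom C g)) (Cod C f).
     \<phi> \<cdot> tup (ide (Dom C f)) (zro (Dom C f) (Dom C g)) = f \<and> \<phi> \<cdot> tup (zro (Dom C g) (Dom C f)) (ide (Dom C g)) = g)"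

lemma coopI:
  assumes "f \<in> Arr C" "g \<in> Arr C" "Dom C f = X" "Dom C g = Y" "Cod C f = Z" "Cod C g = Z"
    "\<phi> \<in> Arr C" "Dom C \<phi> = prd X Y" "Cod C \<phi> = Z"
    "\<phi> \<cdot> tup (ide X) (zro X Y) = f" "\<phi> \<cdot> tup (zro Y X) (ide Y) = g"
  shows "coop f g"
  using assms unfolding coop_def by (auto simp: hom_iff intro!: bexI[of _ \<phi>])

text \<open>The cooperator is evaluated on generalised elements \<open>(x, 0)\<close> and
  \<open>(0, y)\<close>, because after simplification of a composite with tuples these are the
  shapes that remain.\<close>

lemma coopE:
  assumes "coop f g" "f \<in> Arr C" "g \<in> Arr C" "Dom C f = X" "Dom C g = Y" "Cod C f = Z"
  obtains \<phi> where "\<phi> \<in> Arr C" "Dom C \<phi> = prd X Y" "Cod C \<phi> = Z"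
    "\<And>x. \<lbrakk>x \<in> Arr C; Cod C x = X\<rbrakk> \<Longrightarrow> \<phi> \<cdot> tup x (zro (Dom C x) Y) = f \<cdot> x"
    "\<And>y. \<lbrakk>y \<in> Arr C; Cod C y = Y\<rbrakk> \<Longrightarrow> \<phi> \<cdot> tup (zro (Dom C y) X) y = g \<cdot> y"
proof -
  have o: "X \<in> Obj C" "Y \<in> Obj C" using assms by auto
  obtain \<phi> where p: "\<phi> \<in> Arr C" "Dom C \<phi> = prd X Y" "Cod C \<phi> = Z" "\<phi> \<cdot> tup (ide X) (zro X Y) = f" "\<phi> \<cdot> tup (zro Y X) (ide Y) = g"
    using assms unfolding coop_def by (auto simp: hom_iff)
  show thesis
  proof (rule that[OF p(1-3)])
    show "\<phi> \<cdot> tup x (zro (Dom C x) Y) = f \<cdot> x" if "x \<in> Arr C" "Cod C x = X" for x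
      using p(4)[THEN reassoc, of x] that o p(1-3) by simp
    show "\<phi> \<cdot> tup (zro (Dom C y) X) y = g \<cdot> y" if "y \<in> Arr C" "Cod C y = Y" for y
      using p(5)[THEN reassoc, of y] that o p(1-3) by simp
  qed
qed

lemma coop_sym:
  assumes c: "coop f g" and t: "f \<in> Arr C" "g \<in> Arr C" "Dom C f = X" "Dom C g = Y" "Cod C f = Z" "Cod C g = Z"
  shows "coop g f"
proof -
  have [simp]: "X \<in> Obj C" "Y \<in> Obj C" using t by auto
  obtain \<phi> where p: "\<phi> \<in> Arr C" "Dom C \<phi> = prd X Y" "Cod C \<phi> = Z"
    "\<And>x. \<lbrakk>x \<in> Arr C; Cod C x = X\<rbrakk> \<Longrightarrow> \<phi> \<cdot> tup x (zro (Dom C x) Y) = f \<cdot> x"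
    "\<And>y. \<lbrakk>y \<in> Arr C; Cod C y = Y\<rbrakk> \<Longrightarrow> \<phi> \<cdot> tup (zro (Dom C y) X) y = g \<cdot> y"
    using coopE[OF c t(1-5)] by blast
  show ?thesis
    by (rule coopI[OF t(2,1,4,3,6,5), of "\<phi> \<cdot> tup (pr2 Y X) (pr1 Y X)"])
      (use p(1-3) p(4)[of "ide X"] p(5)[of "ide Y"] t in simp_all)
qed

lemma coop_precmp:
  assumes c: "coop f g" and t: "f \<in> Arr C" "g \<in> Arr C" "Dom C f = X" "Dom C g = Y" "Cod C f = Z" "Cod C g = Z"
    and x: "x \<in> Arr C" "Cod C x = X" and y: "y \<in> Arr C" "Cod C y = Y"
  shows "coop (f \<cdot> x) (g \<cdot> y)"
proof -
  obtain X' Y' where [simp]: "Dom C x = X'" "Dom C y = Y'" "X' \<in> Obj C" "Y' \<in> Obj C" using x y by auto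
  have [simp]: "X \<in> Obj C" "Y \<in> Obj C" using t by auto
  obtain \<phi> where p: "\<phi> \<in> Arr C" "Dom C \<phi> = prd X Y" "Cod C \<phi> = Z"
    "\<And>x. \<lbrakk>x \<in> Arr C; Cod C x = X\<rbrakk> \<Longrightarrow> \<phi> \<cdot> tup x (zro (Dom C x) Y) = f \<cdot> x"
    "\<And>y. \<lbrakk>y \<in> Arr C; Cod C y = Y\<rbrakk> \<Longrightarrow> \<phi> \<cdot> tup (zro (Dom C y) X) y = g \<cdot> y"
    using coopE[OF c t(1-5)] by blast
  show ?thesis
    by (rule coopI[of _ _ X' Y' Z "\<phi> \<cdot> tup (x \<cdot> pr1 X' Y') (y \<cdot> pr2 X' Y')"])
      (use p(1-3) p(4)[of x] p(5)[of y] t x y in simp_all)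
qed

lemma coop_postcmp:
  assumes c: "coop f g" and t: "f \<in> Arr C" "g \<in> Arr C" "Dom C f = X" "Dom C g = Y" "Cod C f = Z" "Cod C g = Z"
    and h: "h \<in> Arr C" "Dom C h = Z"
  shows "coop (h \<cdot> f) (h \<cdot> g)"
proof -
  have [simp]: "X \<in> Obj C" "Y \<in> Obj C" using t by auto
  obtain \<phi> where p: "\<phi> \<in> Arr C" "Dom C \<phi> = prd X Y" "Cod C \<phi> = Z"
    "\<And>x. \<lbrakk>x \<in> Arr C; Cod C x = X\<rbrakk> \<Longrightarrow> \<phi> \<cdot> tup x (zro (Dom C x) Y) = f \<cdot> x"
    "\<And>y. \<lbrakk>y \<in> Arr C; Cod C y = Y\<rbrakk> \<Longrightarrow> \<phi> \<cdot> tup (zro (Dom C y) X) y = g \<cdot> y"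
    using coopE[OF c t(1-5)] by blast
  show ?thesis
    by (rule coopI[of _ _ X Y "Cod C h" "h \<cdot> \<phi>"])
      (use p(1-3) p(4)[of "ide X"] p(5)[of "ide Y"] t h in simp_all)
qed

lemma cosmash_simps [simp]:
  assumes "A \<in> Obj C" "B \<in> Obj C"
  shows "cosmash C A B \<in> Arr C" "Cod C (cosmash C A B) = cop A B" "Dom C (cosmash C A B) \<in> Obj C"
    "cot (ide A) (zro B A) \<cdot> cosmash C A B = zro (Dom C (cosmash C A B)) A"
    "cot (zro A B) (ide B) \<cdot> cosmash C A B = zro (Dom C (cosmash C A B)) B"
proof -
  let ?s = "cot (tup (ide A) (zro A B)) (tup (zro B A) (ide B))"
  show c: "cosmash C A B \<in> Arr C" "Cod C (cosmash C A B) = cop A B" "Dom C (cosmash C A B) \<in> Obj C"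
    unfolding cosmash_def using assms ker_simps(1,2)[of ?s] by simp_all
  have z: "?s \<cdot> cosmash C A B = zro (Dom C (cosmash C A B)) (prd A B)"
    using assms ker_simps(3)[of ?s] unfolding cosmash_def by simp
  have "pr1 A B \<cdot> (?s \<cdot> cosmash C A B) = cot (ide A) (zro B A) \<cdot> cosmash C A B"
    "pr2 A B \<cdot> (?s \<cdot> cosmash C A B) = cot (zro A B) (ide B) \<cdot> cosmash C A B"
    using assms c by (simp_all add: cmp_cot')
  then show "cot (ide A) (zro B A) \<cdot> cosmash C A B = zro (Dom C (cosmash C A B)) A"
    "cot (zro A B) (ide B) \<cdot> cosmash C A B = zro (Dom C (cosmash C A B)) B"
    using z assms c by simp_all
qed

lemma cosmash_lift:
  assumes "A \<in> Obj C" "B \<in> Obj C" "h \<in> Arr C" "Cod C h = cop A B" "Dom C h = X"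
    "cot (ide A) (zro B A) \<cdot> h = zro X A" "cot (zro A B) (ide B) \<cdot> h = zro X B"
  obtains u where "u \<in> Arr C" "Dom C u = X" "Cod C u = Dom C (cosmash C A B)" "cosmash C A B \<cdot> u = h"
proof -
  let ?s = "cot (tup (ide A) (zro A B)) (tup (zro B A) (ide B))"
  have X: "X \<in> Obj C" using assms by auto
  have k: "is_kernel C ?s (cosmash C A B)" unfolding cosmash_def by (rule ker_is_kernel) (use assms in simp)
  have "?s \<cdot> h = zro X (prd A B)"
    by (rule prd_ext[of _ _ A B]) (use assms X in \<open>simp_all add: cmp_cot'\<close>)
  then show thesis using kernel_factor[OF k, of h] assms that by auto
qed

end

context semi_abelian_category
begin

text \<open>The two axes of \<open>A \<times> B\<close> are the section and the kernel of the point
  given by the first projection.\<close>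

lemma prd_epi:
  assumes "u \<in> Arr C" "w \<in> Arr C" "Dom C u = prd A B" "Dom C w = prd A B" "Cod C u = Cod C w" "A \<in> Obj C" "B \<in> Obj C"
    "u \<cdot> tup (ide A) (zro A B) = w \<cdot> tup (ide A) (zro A B)" "u \<cdot> tup (zro B A) (ide B) = w \<cdot> tup (zro B A) (ide B)"
  shows "u = w"
  by (rule point_ext[OF pr1_point[of A B] pr1_kernel[of A B]]) (use assms in simp_all)

text \<open>A subobject of \<open>A \<times> B\<close> through which this arrow factors contains
  both axes, that is, the section and the kernel of the first projection.\<close>

lemma sum_to_product_regular_epi:
  assumes "A \<in> Obj C" "B \<in> Obj C"
  shows "is_regular_epi C (cot (tup (ide A) (zro A B)) (tup (zro B A) (ide B)))"
proof (rule regular_epiI)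
  let ?s = "cot (tup (ide A) (zro A B)) (tup (zro B A) (ide B))"
  fix m g assume m: "is_mono C m" "Cod C m = Cod C ?s" and g: "g \<in> Arr C" "Dom C m = Cod C g" "Dom C g = Dom C ?s" "m \<cdot> g = ?s"
  have a: "m \<in> Arr C" by (rule is_mono_arr[OF m(1)])
  have "m \<cdot> (g \<cdot> in1 A B) = tup (ide A) (zro A B)" "m \<cdot> (g \<cdot> in2 A B) = tup (zro B A) (ide B)"
    using g(4)[THEN reassoc, of "in1 A B"] g(4)[THEN reassoc, of "in2 A B"] a m(2) g(1-3) assms by simp_all
  then show "is_iso C m"
    by (intro mono_kernel_section_iso[OF pr1_point[OF assms] pr1_kernel[OF assms] m(1), of "g \<cdot> in2 A B" "g \<cdot> in1 A B"])
      (use a m(2) g(1-3) assms in simp_all)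
qed (use assms in simp)

text \<open>The canonical arrow from sum to product is a regular epimorphism with kernel the cosmash
  product, hence the cokernel of that kernel: \<open>cot f g\<close> descends to the product exactly
  when it kills \<open>cosmash C X Y\<close>. This turns the existence of a cooperator into an
  equation and links it with Higgins commutators.\<close>

lemma coop_iff_cosmash:
  assumes t: "f \<in> Arr C" "g \<in> Arr C" "Dom C f = X" "Dom C g = Y" "Cod C f = Z" "Cod C g = Z"
  shows "coop f g \<longleftrightarrow> cot f g \<cdot> cosmash C X Y = zro (Dom C (cosmash C X Y)) Z"
proof
  have o [simp]: "X \<in> Obj C" "Y \<in> Obj C" "Z \<in> Obj C" using t by auto
  let ?s = "cot (tup (ide X) (zro X Y)) (tup (zro Y X) (ide Y))"
  have k: "is_kernel C ?s (cosmash C X Y)" unfolding cosmash_def by (rule ker_is_kernel) simp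
  {
    assume "coop f g"
    then obtain \<phi> where p: "\<phi> \<in> Arr C" "Dom C \<phi> = prd X Y" "Cod C \<phi> = Z"
      "\<And>x. \<lbrakk>x \<in> Arr C; Cod C x = X\<rbrakk> \<Longrightarrow> \<phi> \<cdot> tup x (zro (Dom C x) Y) = f \<cdot> x"
      "\<And>y. \<lbrakk>y \<in> Arr C; Cod C y = Y\<rbrakk> \<Longrightarrow> \<phi> \<cdot> tup (zro (Dom C y) X) y = g \<cdot> y"
      using coopE[OF _ t(1-5)] by blast
    have "\<phi> \<cdot> ?s = cot f g" using p(1-3) p(4)[of "ide X"] p(5)[of "ide Y"] t by (simp add: cmp_cot)
    then have "cot f g \<cdot> cosmash C X Y = \<phi> \<cdot> (?s \<cdot> cosmash C X Y)"
      using p(1-3) by (simp add: reassoc)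
    then show "cot f g \<cdot> cosmash C X Y = zro (Dom C (cosmash C X Y)) Z"
      using p(1-3) kernelD(4)[OF k] by simp
  next
    assume "cot f g \<cdot> cosmash C X Y = zro (Dom C (cosmash C X Y)) Z"
    then obtain \<phi> where p: "\<phi> \<in> Arr C" "Dom C \<phi> = prd X Y" "Cod C \<phi> = Z" "\<phi> \<cdot> ?s = cot f g"
      using regular_epi_factor[OF sum_to_product_regular_epi[OF o(1,2)] k, of "cot f g"] t by auto
    have "\<phi> \<cdot> tup (ide X) (zro X Y) = f" "\<phi> \<cdot> tup (zro Y X) (ide Y) = g"
      using p(4)[THEN reassoc, of "in1 X Y"] p(4)[THEN reassoc, of "in2 X Y"] t p(1-3) by simp_all
    then show "coop f g" by (intro coopI[OF t p(1-3)])
  }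
qed

text \<open>The arrow \<open>e \<times> 1\<close> is a regular epimorphism, being the pullback of
  \<open>e\<close> along a projection. Its kernel has second component zero and a first component
  killed by \<open>e\<close>, so the cooperator of \<open>f \<cdot> e\<close> and \<open>g\<close>
  vanishes there and descends.\<close>

lemma coop_regular_epi:
  assumes t: "f \<in> Arr C" "g \<in> Arr C" "Dom C f = X" "Dom C g = Y" "Cod C f = Z" "Cod C g = Z"
    and e: "is_regular_epi C e" "Dom C e = X'" "Cod C e = X" and c: "coop (f \<cdot> e) g"
  shows "coop f g"
proof -
  have ea [simp]: "e \<in> Arr C" using regular_epi_arr[OF e(1)] .
  have o [simp]: "X \<in> Obj C" "Y \<in> Obj C" "Z \<in> Obj C" "X' \<in> Obj C" using t e obj_dom[OF ea] by auto
  let ?E = "tup (e \<cdot> pr1 X' Y) (pr2 X' Y)"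
  obtain \<phi> where p: "\<phi> \<in> Arr C" "Dom C \<phi> = prd X' Y" "Cod C \<phi> = Z"
    "\<And>x. \<lbrakk>x \<in> Arr C; Cod C x = X'\<rbrakk> \<Longrightarrow> \<phi> \<cdot> tup x (zro (Dom C x) Y) = (f \<cdot> e) \<cdot> x"
    "\<And>y. \<lbrakk>y \<in> Arr C; Cod C y = Y\<rbrakk> \<Longrightarrow> \<phi> \<cdot> tup (zro (Dom C y) X') y = g \<cdot> y"
    by (rule coopE[OF c, of X' Y Z]) (use t e(2,3) in simp_all)
  have "is_pullback C e (pr1 X Y) (pr1 X' Y) ?E"
  proof (rule is_pullbackI)
    fix u v assume a: "u \<in> Arr C" "v \<in> Arr C" "Dom C u = Dom C v" "Cod C u = Dom C e" "Cod C v = Dom C (pr1 X Y)" "e \<cdot> u = pr1 X Y \<cdot> v"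
    have "?E \<cdot> tup u (pr2 X Y \<cdot> v) = v"
      by (rule prd_ext[of _ _ X Y]) (use a e(2,3) in simp_all)
    then show "\<exists>h. h \<in> Arr C \<and> Dom C h = Dom C u \<and> Cod C h = Dom C (pr1 X' Y) \<and> pr1 X' Y \<cdot> h = u \<and> ?E \<cdot> h = v"
      using a(1-5) e(2,3) by (intro exI[of _ "tup u (pr2 X Y \<cdot> v)"]) simp
  next
    fix u v assume a: "u \<in> Arr C" "v \<in> Arr C" "Dom C u = Dom C v" "Cod C u = Dom C (pr1 X' Y)" "Cod C v = Dom C (pr1 X' Y)"
      "pr1 X' Y \<cdot> u = pr1 X' Y \<cdot> v" "?E \<cdot> u = ?E \<cdot> v"
    have "pr2 X Y \<cdot> (?E \<cdot> u) = pr2 X Y \<cdot> (?E \<cdot> v)" by (simp only: a(7))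
    then have "pr2 X' Y \<cdot> u = pr2 X' Y \<cdot> v" using a(1-5) e(2,3) by simp
    with a(6) show "u = v" by (intro prd_ext[OF a(1,2,3), of X' Y]) (use a(4,5) in simp_all)
  qed (use e(2,3) in simp_all)
  then have E: "is_regular_epi C ?E" using e(1) by (rule regular_epi_pullback)
  obtain k K where k: "is_kernel C ?E k" "k \<in> Arr C" "Dom C k = K" "Cod C k = prd X' Y" "K \<in> Obj C" "?E \<cdot> k = zro K (prd X Y)"
    by (rule kerE[of ?E]) (use e(2,3) in simp_all)
  have "pr1 X Y \<cdot> (?E \<cdot> k) = zro K X" "pr2 X Y \<cdot> (?E \<cdot> k) = zro K Y" unfolding k(6) using k(2-5) by simp_all
  then have z: "e \<cdot> (pr1 X' Y \<cdot> k) = zro K X" "pr2 X' Y \<cdot> k = zro K Y" using k(2-5) e(2,3) by simp_all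
  have "k = tup (pr1 X' Y \<cdot> k) (zro K Y)" by (rule prd_ext[of _ _ X' Y]) (use k(2-5) z in simp_all)
  then have "\<phi> \<cdot> k = (f \<cdot> e) \<cdot> (pr1 X' Y \<cdot> k)" using p(4)[of "pr1 X' Y \<cdot> k"] k(2-5) by simp
  then have "\<phi> \<cdot> k = zro K Z" using z(1) k(2-5) t e(2,3) by simp
  then obtain \<psi> where q: "\<psi> \<in> Arr C" "Dom C \<psi> = prd X Y" "Cod C \<psi> = Z" "\<psi> \<cdot> ?E = \<phi>"
    using regular_epi_factor[OF E k(1) p(1)] p(2,3) k(3) e(2,3) by auto
  note r = q(4)[THEN reassoc, of "tup (ide X') (zro X' Y)"] q(4)[THEN reassoc, of "tup (zro Y X') (ide Y)"]
  have "(\<psi> \<cdot> tup (ide X) (zro X Y)) \<cdot> e = f \<cdot> e"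
    using r(1) p(4)[of "ide X'"] q(1-3) e(2,3) t by simp
  then have "\<psi> \<cdot> tup (ide X) (zro X Y) = f"
    by (rule epic_cancel[OF regular_epi_epic[OF e(1)]]) (use q(1-3) t e(2,3) in simp_all)
  moreover have "\<psi> \<cdot> tup (zro Y X) (ide Y) = g"
    using r(2) p(5)[of "ide Y"] q(1-3) e(2,3) t by simp
  ultimately show ?thesis by (intro coopI[OF t q(1-3)])
qed

end

section \<open>Ternary cosmash products and two-nilpotent objects\<close>

context bicartesian_category
begin

text \<open>The kernel of the arrow into the triple product is tested on the three components
  separately. The component that kills \<open>D\<close> involves the cotuple of the injections,
  which is rewritten as an identity first.\<close>

lemma
  assumes o [simp]: "A \<in> Obj C" "B \<in> Obj C" "D \<in> Obj C"
  shows cosmash3_simps: "cosmash3 C A B D \<in> Arr C" "Cod C (cosmash3 C A B D) = cop (cop A B) D" "Dom C (cosmash3 C A B D) \<in> Obj C"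
    and cosmash3_kills: "cot (ide (cop A B)) (zro D (cop A B)) \<cdot> cosmash3 C A B D = zro (Dom C (cosmash3 C A B D)) (cop A B)"
      "cot (cot (in1 A D) (zro B (cop A D))) (in2 A D) \<cdot> cosmash3 C A B D = zro (Dom C (cosmash3 C A B D)) (cop A D)"
      "cot (cot (zro A (cop B D)) (in1 B D)) (in2 B D) \<cdot> cosmash3 C A B D = zro (Dom C (cosmash3 C A B D)) (cop B D)"
    and cosmash3_lift: "\<And>h X. \<lbrakk>h \<in> Arr C; Cod C h = cop (cop A B) D; Dom C h = X;
      cot (ide (cop A B)) (zro D (cop A B)) \<cdot> h = zro X (cop A B);
      cot (cot (in1 A D) (zro B (cop A D))) (in2 A D) \<cdot> h = zro X (cop A D);
      cot (cot (zro A (cop B D)) (in1 B D)) (in2 B D) \<cdot> h = zro X (cop B D)\<rbrakk>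
      \<Longrightarrow> \<exists>u. u \<in> Arr C \<and> Dom C u = X \<and> Cod C u = Dom C (cosmash3 C A B D) \<and> cosmash3 C A B D \<cdot> u = h"
proof -
  have ii: "cot (in1 A B) (in2 A B) = ide (cop A B)" by (rule cop_ext[of _ _ A B]) simp_all
  let ?a = "cot (ide (cop A B)) (zro D (cop A B))"
  let ?b = "cot (cot (in1 A D) (zro B (cop A D))) (in2 A D)"
  let ?c = "cot (cot (zro A (cop B D)) (in1 B D)) (in2 B D)"
  let ?t = "tup (tup ?a ?b) ?c"
  have k: "is_kernel C ?t (cosmash3 C A B D)"
    unfolding cosmash3_def tuple3_def cotuple3_def ii by (rule ker_is_kernel) simp
  have s [simp]: "cosmash3 C A B D \<in> Arr C" "Cod C (cosmash3 C A B D) = cop (cop A B) D" "Dom C (cosmash3 C A B D) \<in> Obj C"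
    using kernelD[OF k] by simp_all
  then show "cosmash3 C A B D \<in> Arr C" "Cod C (cosmash3 C A B D) = cop (cop A B) D" "Dom C (cosmash3 C A B D) \<in> Obj C" by simp_all
  let ?P = "prd (cop A B) (cop A D)"
  have z: "?t \<cdot> cosmash3 C A B D = zro (Dom C (cosmash3 C A B D)) (prd ?P (cop B D))"
    using kernelD(4)[OF k] by simp
  have "pr1 (cop A B) (cop A D) \<cdot> (pr1 ?P (cop B D) \<cdot> (?t \<cdot> cosmash3 C A B D)) = zro (Dom C (cosmash3 C A B D)) (cop A B)"
    "pr2 (cop A B) (cop A D) \<cdot> (pr1 ?P (cop B D) \<cdot> (?t \<cdot> cosmash3 C A B D)) = zro (Dom C (cosmash3 C A B D)) (cop A D)"
    "pr2 ?P (cop B D) \<cdot> (?t \<cdot> cosmash3 C A B D) = zro (Dom C (cosmash3 C A B D)) (cop B D)"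
    unfolding z by simp_all
  then show "?a \<cdot> cosmash3 C A B D = zro (Dom C (cosmash3 C A B D)) (cop A B)"
      "?b \<cdot> cosmash3 C A B D = zro (Dom C (cosmash3 C A B D)) (cop A D)"
      "?c \<cdot> cosmash3 C A B D = zro (Dom C (cosmash3 C A B D)) (cop B D)"
    by simp_all
  fix h X assume h: "h \<in> Arr C" "Cod C h = cop (cop A B) D" "Dom C h = X"
      "?a \<cdot> h = zro X (cop A B)" "?b \<cdot> h = zro X (cop A D)" "?c \<cdot> h = zro X (cop B D)"
  have [simp]: "X \<in> Obj C" using h by auto
  have "?t \<cdot> h = zro X (prd ?P (cop B D))" using h by (simp add: tup_zro)
  then obtain u where "u \<in> Arr C" "Dom C u = X" "Cod C u = Dom C (cosmash3 C A B D)" "cosmash3 C A B D \<cdot> u = h"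
    using kernel_factor[OF k h(1)] h(2,3) by auto
  then show "\<exists>u. u \<in> Arr C \<and> Dom C u = X \<and> Cod C u = Dom C (cosmash3 C A B D) \<and> cosmash3 C A B D \<cdot> u = h" by blast
qed

declare cosmash3_simps [simp]

text \<open>An arrow that factors through the removal of one summand vanishes on the ternary cosmash
  product. The bracketing lets \<open>cmp_cot\<close> absorb \<open>f\<close> into the cotuple, so
  that the instance matches the concrete arrows met later.\<close>

lemma cosmash3_kill:
  assumes "A \<in> Obj C" "B \<in> Obj C" "D \<in> Obj C" and f: "f \<in> Arr C"
  shows "Dom C f = cop A B \<Longrightarrow> (f \<cdot> cot (ide (cop A B)) (zro D (cop A B))) \<cdot> cosmash3 C A B D = zro (Dom C (cosmash3 C A B D)) (Cod C f)"
    "Dom C f = cop A D \<Longrightarrow> (f \<cdot> cot (cot (in1 A D) (zro B (cop A D))) (in2 A D)) \<cdot> cosmash3 C A B D = zro (Dom C (cosmash3 C A B D)) (Cod C f)"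
    "Dom C f = cop B D \<Longrightarrow> (f \<cdot> cot (cot (zro A (cop B D)) (in1 B D)) (in2 B D)) \<cdot> cosmash3 C A B D = zro (Dom C (cosmash3 C A B D)) (Cod C f)"
  using cosmash3_kills[OF assms(1-3)] assms by simp_all

text \<open>The condition \<open>[T,T,T] = 0\<close> as an equation between arrows, which avoids the
  chosen image; \<open>nilp2_iff\<close> connects it with the membership condition of
  \<open>nil2 C\<close>.\<close>

definition nilp2 where
  "nilp2 T \<longleftrightarrow> T \<in> Obj C \<and> cot (cot (ide T) (ide T)) (ide T) \<cdot> cosmash3 C T T T = zro (Dom C (cosmash3 C T T T)) T"

lemma nilp2_obj [simp]: "nilp2 T \<Longrightarrow> T \<in> Obj C"
  by (simp add: nilp2_def)

lemma nilp2_ternary: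
  assumes T: "nilp2 T" and x: "x \<in> Arr C" "Dom C x = A" "Cod C x = T" and y: "y \<in> Arr C" "Dom C y = B" "Cod C y = T"
    and z: "z \<in> Arr C" "Dom C z = D" "Cod C z = T"
  shows "cot (cot x y) z \<cdot> cosmash3 C A B D = zro (Dom C (cosmash3 C A B D)) T"
proof -
  have o [simp]: "A \<in> Obj C" "B \<in> Obj C" "D \<in> Obj C" "T \<in> Obj C" using x y z by auto
  note [simp] = x y z
  \<comment> \<open>This is \<open>x + y + z\<close>. It carries one ternary cosmash product into
    the other, so the ternary commutator of any three arrows into \<open>T\<close> is dominated by
    \<open>[T,T,T]\<close>.\<close>
  let ?s = "cot (cot (in1 (cop T T) T \<cdot> (in1 T T \<cdot> x)) (in1 (cop T T) T \<cdot> (in2 T T \<cdot> y))) (in2 (cop T T) T \<cdot> z)"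
  have "\<exists>u. u \<in> Arr C \<and> Dom C u = Dom C (cosmash3 C A B D) \<and> Cod C u = Dom C (cosmash3 C T T T) \<and>
    cosmash3 C T T T \<cdot> u = ?s \<cdot> cosmash3 C A B D"
  proof (rule cosmash3_lift)
    show "cot (ide (cop T T)) (zro T (cop T T)) \<cdot> (?s \<cdot> cosmash3 C A B D) = zro (Dom C (cosmash3 C A B D)) (cop T T)"
      using cosmash3_kill(1)[OF o(1-3), of "cot (in1 T T \<cdot> x) (in2 T T \<cdot> y)"] by (simp add: cmp_cot cmp_cot')
    show "cot (cot (in1 T T) (zro T (cop T T))) (in2 T T) \<cdot> (?s \<cdot> cosmash3 C A B D) = zro (Dom C (cosmash3 C A B D)) (cop T T)"
      using cosmash3_kill(2)[OF o(1-3), of "cot (in1 T T \<cdot> x) (in2 T T \<cdot> z)"] by (simp add: cmp_cot cmp_cot')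
    show "cot (cot (zro T (cop T T)) (in1 T T)) (in2 T T) \<cdot> (?s \<cdot> cosmash3 C A B D) = zro (Dom C (cosmash3 C A B D)) (cop T T)"
      using cosmash3_kill(3)[OF o(1-3), of "cot (in1 T T \<cdot> y) (in2 T T \<cdot> z)"] by (simp add: cmp_cot cmp_cot')
  qed simp_all
  then obtain u where u: "u \<in> Arr C" "Dom C u = Dom C (cosmash3 C A B D)" "Cod C u = Dom C (cosmash3 C T T T)"
    "cosmash3 C T T T \<cdot> u = ?s \<cdot> cosmash3 C A B D" by blast
  let ?n = "cot (cot (ide T) (ide T)) (ide T)"
  have n: "?n \<cdot> cosmash3 C T T T = zro (Dom C (cosmash3 C T T T)) T" using T by (simp add: nilp2_def)
  have "cot (cot x y) z \<cdot> cosmash3 C A B D = ?n \<cdot> (?s \<cdot> cosmash3 C A B D)" by (simp add: cmp_cot cmp_cot')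
  also have "\<dots> = ?n \<cdot> (cosmash3 C T T T \<cdot> u)" by (simp only: u(4))
  also have "\<dots> = zro (Dom C (cosmash3 C A B D)) T" using n[THEN reassoc, of u] u(1-3) by simp
  finally show ?thesis .
qed

text \<open>The fold of \<open>A\<close>, followed by \<open>m\<close>, is the ternary composite of
  three copies of \<open>m\<close>, and \<open>m\<close> can be cancelled. Stability under
  subobjects and products makes the limits of the core those of \<open>C\<close>.\<close>

lemma nilp2_mono:
  assumes "nilp2 T" and m: "is_mono C m" "Cod C m = T" "Dom C m = A"
  shows "nilp2 A"
proof -
  have a [simp]: "m \<in> Arr C" "A \<in> Obj C" "T \<in> Obj C" using is_mono_arr[OF m(1)] m by auto
  note [simp] = m(2,3)
  have eq: "m \<cdot> (cot (cot (ide A) (ide A)) (ide A) \<cdot> cosmash3 C A A A) = m \<cdot> zro (Dom C (cosmash3 C A A A)) A"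
    using nilp2_ternary[OF assms(1), of m A m A m A] by (simp add: cmp_cot cmp_cot')
  have "cot (cot (ide A) (ide A)) (ide A) \<cdot> cosmash3 C A A A = zro (Dom C (cosmash3 C A A A)) A"
    by (rule is_mono_cancel[OF m(1) eq]) simp_all
  then show ?thesis by (simp add: nilp2_def)
qed

lemma nilp2_product:
  assumes "nilp2 A" "nilp2 B" shows "nilp2 (prd A B)"
proof -
  have [simp]: "A \<in> Obj C" "B \<in> Obj C" using assms by simp_all
  let ?P = "prd A B"
  have "cot (cot (ide ?P) (ide ?P)) (ide ?P) \<cdot> cosmash3 C ?P ?P ?P = zro (Dom C (cosmash3 C ?P ?P ?P)) ?P"
    by (rule prd_ext[of _ _ A B])
      (use nilp2_ternary[OF assms(1), of "pr1 A B" ?P "pr1 A B" ?P "pr1 A B" ?P]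
        nilp2_ternary[OF assms(2), of "pr2 A B" ?P "pr2 A B" ?P "pr2 A B" ?P] in \<open>simp_all add: cmp_cot cmp_cot'\<close>)
  then show ?thesis by (simp add: nilp2_def)
qed

lemma nilp2_zero:
  assumes "is_zero C Z" shows "nilp2 Z"
proof -
  have Z [simp]: "Z \<in> Obj C" using assms by (simp add: is_zero_def is_initial_def)
  show ?thesis unfolding nilp2_def
    using zero_to[OF assms, of "cot (cot (ide Z) (ide Z)) (ide Z) \<cdot> cosmash3 C Z Z Z"] by simp
qed

end

context semi_abelian_category
begin

text \<open>This is \<open>[[A,B],D] \<le> [A,B,D]\<close>: the inclusion of the cosmash product
  \<open>K\<close> of \<open>A\<close> and \<open>B\<close>, added to the identity of
  \<open>D\<close>, sends the cosmash product of \<open>K\<close> and \<open>D\<close> into the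
  ternary one. Killing \<open>D\<close> leaves only the component in \<open>K\<close>, which is zero
  there; killing \<open>A\<close> or \<open>B\<close> already makes \<open>K\<close> vanish, and
  then only the component in \<open>D\<close> remains, again zero.\<close>

lemma nilp2_commutator_central:
  assumes T: "nilp2 T" and x: "x \<in> Arr C" "Dom C x = A" "Cod C x = T" and y: "y \<in> Arr C" "Dom C y = B" "Cod C y = T"
    and z: "z \<in> Arr C" "Dom C z = D" "Cod C z = T"
  shows "coop (cot x y \<cdot> cosmash C A B) z"
proof -
  have o [simp]: "A \<in> Obj C" "B \<in> Obj C" "D \<in> Obj C" "T \<in> Obj C" using x y z by auto
  note [simp] = x y z
  define c K where "c = cosmash C A B" and "K = Dom C c"
  have c [simp]: "c \<in> Arr C" "Cod C c = cop A B" "Dom C c = K" "K \<in> Obj C"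
    and c0: "cot (ide A) (zro B A) \<cdot> c = zro K A" "cot (zro A B) (ide B) \<cdot> c = zro K B"
    unfolding K_def c_def by simp_all
  define e E where "e = cosmash C K D" and "E = Dom C e"
  have e [simp]: "e \<in> Arr C" "Cod C e = cop K D" "Dom C e = E" "E \<in> Obj C"
    and e0: "cot (ide K) (zro D K) \<cdot> e = zro E K" "cot (zro K D) (ide D) \<cdot> e = zro E D"
    unfolding E_def e_def by simp_all
  let ?h = "cot (in1 (cop A B) D \<cdot> c) (in2 (cop A B) D)"
  have "\<exists>u. u \<in> Arr C \<and> Dom C u = E \<and> Cod C u = Dom C (cosmash3 C A B D) \<and> cosmash3 C A B D \<cdot> u = ?h \<cdot> e"
  proof (rule cosmash3_lift)
    have "cot (ide (cop A B)) (zro D (cop A B)) \<cdot> (?h \<cdot> e) = c \<cdot> (cot (ide K) (zro D K) \<cdot> e)"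
      by (simp add: cmp_cot cmp_cot')
    then show "cot (ide (cop A B)) (zro D (cop A B)) \<cdot> (?h \<cdot> e) = zro E (cop A B)" by (simp add: e0)
    have "cot (in1 A D) (zro B (cop A D)) \<cdot> c = in1 A D \<cdot> (cot (ide A) (zro B A) \<cdot> c)"
      by (simp add: cmp_cot cmp_cot')
    then have 1: "cot (in1 A D) (zro B (cop A D)) \<cdot> c = zro K (cop A D)" by (simp add: c0)
    have "cot (cot (in1 A D) (zro B (cop A D))) (in2 A D) \<cdot> (?h \<cdot> e) = in2 A D \<cdot> (cot (zro K D) (ide D) \<cdot> e)"
      by (simp add: cmp_cot cmp_cot' 1)
    then show "cot (cot (in1 A D) (zro B (cop A D))) (in2 A D) \<cdot> (?h \<cdot> e) = zro E (cop A D)" by (simp add: e0)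
    have "cot (zro A (cop B D)) (in1 B D) \<cdot> c = in1 B D \<cdot> (cot (zro A B) (ide B) \<cdot> c)"
      by (simp add: cmp_cot cmp_cot')
    then have 2: "cot (zro A (cop B D)) (in1 B D) \<cdot> c = zro K (cop B D)" by (simp add: c0)
    have "cot (cot (zro A (cop B D)) (in1 B D)) (in2 B D) \<cdot> (?h \<cdot> e) = in2 B D \<cdot> (cot (zro K D) (ide D) \<cdot> e)"
      by (simp add: cmp_cot cmp_cot' 2)
    then show "cot (cot (zro A (cop B D)) (in1 B D)) (in2 B D) \<cdot> (?h \<cdot> e) = zro E (cop B D)" by (simp add: e0)
  qed simp_all
  then obtain u where u: "u \<in> Arr C" "Dom C u = E" "Cod C u = Dom C (cosmash3 C A B D)" "cosmash3 C A B D \<cdot> u = ?h \<cdot> e" by blast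
  have "cot (cot x y \<cdot> c) z \<cdot> e = cot (cot x y) z \<cdot> (?h \<cdot> e)" by (simp add: cmp_cot cmp_cot')
  also have "\<dots> = cot (cot x y) z \<cdot> (cosmash3 C A B D \<cdot> u)" by (simp only: u(4))
  also have "\<dots> = zro E T" using nilp2_ternary[OF T x y z, THEN reassoc, of u] u(1-3) by simp
  finally show ?thesis by (subst coop_iff_cosmash[of _ _ K D T]) (simp_all add: c_def[symmetric] e_def[symmetric])
qed

text \<open>Folding the first two of three summands sends the ternary cosmash product into the
  binary one, so \<open>[M,M,M] \<le> [M,M]\<close>.\<close>

lemma self_coop_nilp2:
  assumes M: "M \<in> Obj C" and ab: "coop (ide M) (ide M)"
  shows "nilp2 M"
proof -
  note [simp] = M
  let ?W = "Dom C (cosmash3 C M M M)"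
  let ?h = "cot (cot (in1 M M) (in1 M M)) (in2 M M)"
  have k: "cot (ide M) (ide M) \<cdot> cosmash C M M = zro (Dom C (cosmash C M M)) M"
    using ab by (subst (asm) coop_iff_cosmash[of _ _ M M M]) simp_all
  obtain u where u: "u \<in> Arr C" "Dom C u = ?W" "Cod C u = Dom C (cosmash C M M)" "cosmash C M M \<cdot> u = ?h \<cdot> cosmash3 C M M M"
  proof (rule cosmash_lift[of M M "?h \<cdot> cosmash3 C M M M" ?W])
    show "cot (ide M) (zro M M) \<cdot> (?h \<cdot> cosmash3 C M M M) = zro ?W M"
      using cosmash3_kill(1)[OF M M M, of "cot (ide M) (ide M)"] by (simp add: cmp_cot cmp_cot')
    show "cot (zro M M) (ide M) \<cdot> (?h \<cdot> cosmash3 C M M M) = zro ?W M"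
      using cosmash3_kill(3)[OF M M M, of "cot (zro M M) (ide M)"] by (simp add: cmp_cot cmp_cot')
  qed simp_all
  have "cot (cot (ide M) (ide M)) (ide M) \<cdot> cosmash3 C M M M = cot (ide M) (ide M) \<cdot> (?h \<cdot> cosmash3 C M M M)"
    by (simp add: cmp_cot cmp_cot')
  also have "\<dots> = cot (ide M) (ide M) \<cdot> (cosmash C M M \<cdot> u)" by (simp only: u(4))
  also have "\<dots> = zro ?W M" using k[THEN reassoc, of u] u(1-3) by simp
  finally show ?thesis by (simp add: nilp2_def)
qed

text \<open>In the form of an equation on the cosmash product, cooperation can be checked after the
  two projections.\<close>

lemma self_coop_product:
  assumes M: "M \<in> Obj C" "coop (ide M) (ide M)" and N: "N \<in> Obj C" "coop (ide N) (ide N)"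
  shows "coop (ide (prd M N)) (ide (prd M N))"
proof -
  note [simp] = M(1) N(1)
  let ?P = "prd M N"
  have "coop (ide M \<cdot> pr1 M N) (ide M \<cdot> pr1 M N)" "coop (ide N \<cdot> pr2 M N) (ide N \<cdot> pr2 M N)"
    by (rule coop_precmp[OF M(2), of M M M] coop_precmp[OF N(2), of N N N]; simp)+
  then have "coop (pr1 M N) (pr1 M N)" "coop (pr2 M N) (pr2 M N)" by simp_all
  then have eq: "cot (pr1 M N) (pr1 M N) \<cdot> cosmash C ?P ?P = zro (Dom C (cosmash C ?P ?P)) M"
    "cot (pr2 M N) (pr2 M N) \<cdot> cosmash C ?P ?P = zro (Dom C (cosmash C ?P ?P)) N"
    using coop_iff_cosmash[of "pr1 M N" "pr1 M N" ?P ?P M] coop_iff_cosmash[of "pr2 M N" "pr2 M N" ?P ?P N] by simp_all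
  have "cot (ide ?P) (ide ?P) \<cdot> cosmash C ?P ?P = zro (Dom C (cosmash C ?P ?P)) ?P"
    by (rule prd_ext[of _ _ M N]) (simp_all add: cmp_cot cmp_cot' eq)
  then show ?thesis by (subst coop_iff_cosmash[of _ _ ?P ?P ?P]) simp_all
qed

end

section \<open>Algebraic coherence\<close>

context bicartesian_category
begin

abbreviation fl where "fl \<equiv> flat C"
abbreviation flo where "flo X Y \<equiv> Dom C (flat C X Y)"

lemma flat_is_kernel:
  "\<lbrakk>X \<in> Obj C; Y \<in> Obj C\<rbrakk> \<Longrightarrow> is_kernel C (cot (ide X) (zro Y X)) (fl X Y)"
  unfolding flat_def by (rule ker_is_kernel) simp

lemma flat_simps [simp]:
  assumes "X \<in> Obj C" "Y \<in> Obj C"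
  shows "fl X Y \<in> Arr C" "Cod C (fl X Y) = cop X Y" "flo X Y \<in> Obj C"
    "cot (ide X) (zro Y X) \<cdot> fl X Y = zro (flo X Y) X"
  using kernelD[OF flat_is_kernel[OF assms]] assms by simp_all

lemma flat_zero:
  assumes "X \<in> Obj C" "f \<in> Arr C" "Dom C f = X" "Cod C f = Z" "Y \<in> Obj C"
  shows "cot f (zro Y Z) \<cdot> fl X Y = zro (flo X Y) Z"
proof -
  have "Z \<in> Obj C" using assms by auto
  then have "f \<cdot> (cot (ide X) (zro Y X) \<cdot> fl X Y) = cot f (zro Y Z) \<cdot> fl X Y"
    by (intro reassoc) (use assms in \<open>simp_all add: cmp_cot\<close>)
  then show ?thesis using assms by simp
qed

lemma flat_lift:
  assumes "X \<in> Obj C" "Y \<in> Obj C" "h \<in> Arr C" "Cod C h = cop X Y" "Dom C h = W" "cot (ide X) (zro Y X) \<cdot> h = zro W X"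
  obtains u where "u \<in> Arr C" "Dom C u = W" "Cod C u = flo X Y" "fl X Y \<cdot> u = h"
  using kernel_factor[OF flat_is_kernel[OF assms(1,2)], of h] assms by auto

lemma flat_map_props:
  assumes X: "X \<in> Obj C" and f: "f \<in> Arr C" "Dom C f = Y" "Cod C f = Y'"
  shows "flat_map C X f \<in> Arr C" "Dom C (flat_map C X f) = flo X Y" "Cod C (flat_map C X f) = flo X Y'"
    "fl X Y' \<cdot> flat_map C X f = cot (in1 X Y') (in2 X Y' \<cdot> f) \<cdot> fl X Y"
proof -
  have o [simp]: "X \<in> Obj C" "Y \<in> Obj C" "Y' \<in> Obj C" using X f by auto
  note [simp] = f
  let ?h = "cot (in1 X Y') (in2 X Y' \<cdot> f) \<cdot> fl X Y"
  obtain u where u: "u \<in> Arr C" "Dom C u = flo X Y" "Cod C u = flo X Y'" "fl X Y' \<cdot> u = ?h"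
    by (rule flat_lift[of X Y' ?h "flo X Y"]) (simp_all add: cmp_cot cmp_cot')
  have "flat_map C X f = u" unfolding flat_map_def Let_def lift_through_def f
  proof (rule the_equality)
    show "u \<in> hom C (Dom C ?h) (flo X Y') \<and> fl X Y' \<cdot> u = ?h" using u by (simp add: hom_iff)
    fix v assume v: "v \<in> hom C (Dom C ?h) (flo X Y') \<and> fl X Y' \<cdot> v = ?h"
    have "fl X Y' \<cdot> v = fl X Y' \<cdot> u" using v u(4) by (simp only:)
    then show "v = u"
      by (rule is_mono_cancel[OF kernel_mono[OF flat_is_kernel[OF o(1,3)]]]) (use u v in \<open>simp_all add: hom_iff\<close>)
  qed
  then show "flat_map C X f \<in> Arr C" "Dom C (flat_map C X f) = flo X Y" "Cod C (flat_map C X f) = flo X Y'"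
    "fl X Y' \<cdot> flat_map C X f = ?h" using u by simp_all
qed

text \<open>Restriction along \<open>flat_map C X f\<close> only precomposes the second component
  with \<open>f\<close>; this is what makes a test on the summands of \<open>Y + Y'\<close>
  effective.\<close>

lemma flat_map_comp:
  assumes X: "X \<in> Obj C" and f: "f \<in> Arr C" "Dom C f = Y" "Cod C f = Y'"
    and a: "a \<in> Arr C" "Dom C a = X" "Cod C a = Z" and b: "b \<in> Arr C" "Dom C b = Y'" "Cod C b = Z"
  shows "cot a b \<cdot> (fl X Y' \<cdot> flat_map C X f) = cot a (b \<cdot> f) \<cdot> fl X Y"
proof -
  have o: "Y \<in> Obj C" "Y' \<in> Obj C" using f by auto
  show ?thesis using flat_map_props[OF X f] X f o a b by (simp add: cmp_cot cmp_cot')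
qed

end

context semi_abelian_category
begin

text \<open>One should think of \<open>X \<flat> Y\<close> as the conjugates of \<open>Y\<close> by
  \<open>X\<close>: the two sides are the conjugation action seen through \<open>f\<close> and the
  trivial action. If a cooperator exists, only the image of \<open>X \<flat> Y\<close> in the
  product matters, and that lies in the axis \<open>Y\<close>. Conversely the cosmash product sits
  inside \<open>X \<flat> Y\<close>, and the trivial side vanishes on it.\<close>

lemma coop_iff_flat:
  assumes t: "g \<in> Arr C" "f \<in> Arr C" "Dom C g = X" "Dom C f = Y" "Cod C g = Z" "Cod C f = Z"
  shows "coop g f \<longleftrightarrow> cot g f \<cdot> fl X Y = cot (zro X Z) f \<cdot> fl X Y"
proof
  have o [simp]: "X \<in> Obj C" "Y \<in> Obj C" "Z \<in> Obj C" using t by auto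
  note [simp] = t
  {
    assume "coop g f"
    then obtain \<phi> where p: "\<phi> \<in> Arr C" "Dom C \<phi> = prd X Y" "Cod C \<phi> = Z"
      "\<And>x. \<lbrakk>x \<in> Arr C; Cod C x = X\<rbrakk> \<Longrightarrow> \<phi> \<cdot> tup x (zro (Dom C x) Y) = g \<cdot> x"
      "\<And>y. \<lbrakk>y \<in> Arr C; Cod C y = Y\<rbrakk> \<Longrightarrow> \<phi> \<cdot> tup (zro (Dom C y) X) y = f \<cdot> y"
      using coopE[OF _ t(1-5)] by blast
    let ?s = "cot (tup (ide X) (zro X Y)) (tup (zro Y X) (ide Y))"
    let ?t = "cot (zro X Y) (ide Y) \<cdot> fl X Y"
    have "?s \<cdot> fl X Y = tup (zro (flo X Y) X) ?t"
      by (rule prd_ext[of _ _ X Y]) (simp_all add: cmp_cot cmp_cot')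
    then have "\<phi> \<cdot> (?s \<cdot> fl X Y) = f \<cdot> ?t" using p(5)[of ?t] by simp
    then show "cot g f \<cdot> fl X Y = cot (zro X Z) f \<cdot> fl X Y"
      using p(1-3) p(4)[of "ide X"] p(5)[of "ide Y"] by (simp add: cmp_cot cmp_cot')
  next
    assume eq: "cot g f \<cdot> fl X Y = cot (zro X Z) f \<cdot> fl X Y"
    obtain l where l: "l \<in> Arr C" "Dom C l = Dom C (cosmash C X Y)" "Cod C l = flo X Y" "fl X Y \<cdot> l = cosmash C X Y"
      by (rule flat_lift[of X Y "cosmash C X Y"]) simp_all
    have "cot g f \<cdot> (fl X Y \<cdot> l) = cot (zro X Z) f \<cdot> (fl X Y \<cdot> l)"
      using eq[THEN reassoc, of l] l(1-3) by simp
    then have "cot g f \<cdot> cosmash C X Y = f \<cdot> (cot (zro X Y) (ide Y) \<cdot> cosmash C X Y)"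
      unfolding l(4) by (simp add: cmp_cot cmp_cot' del: cosmash_simps(4,5))
    then show "coop g f" by (subst coop_iff_cosmash[OF t]) simp
  }
qed

end

locale coherent_category = semi_abelian_category +
  assumes coherent: "algebraically_coherent C"
begin

text \<open>The comparison arrow of algebraic coherence is a regular epimorphism, hence epic. All
  uses of coherence below pass through this cancellation property.\<close>

lemma flat_ext:
  assumes o: "X \<in> Obj C" "Y \<in> Obj C" "Y' \<in> Obj C"
    and a: "a \<in> Arr C" "Dom C a = flo X (cop Y Y')" "Cod C a = Z" and b: "b \<in> Arr C" "Dom C b = flo X (cop Y Y')" "Cod C b = Z"
    and eq: "a \<cdot> flat_map C X (in1 Y Y') = b \<cdot> flat_map C X (in1 Y Y')" "a \<cdot> flat_map C X (in2 Y Y') = b \<cdot> flat_map C X (in2 Y Y')"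
  shows "a = b"
proof -
  note [simp] = o
  have f1: "flat_map C X (in1 Y Y') \<in> Arr C" "Dom C (flat_map C X (in1 Y Y')) = flo X Y" "Cod C (flat_map C X (in1 Y Y')) = flo X (cop Y Y')"
    by (rule flat_map_props; simp)+
  have f2: "flat_map C X (in2 Y Y') \<in> Arr C" "Dom C (flat_map C X (in2 Y Y')) = flo X Y'" "Cod C (flat_map C X (in2 Y Y')) = flo X (cop Y Y')"
    by (rule flat_map_props; simp)+
  let ?c = "cot (flat_map C X (in1 Y Y')) (flat_map C X (in2 Y Y'))"
  have e: "epic C ?c" using coherent o by (intro regular_epi_epic) (simp add: algebraically_coherent_def)
  have "a \<cdot> ?c = b \<cdot> ?c" using a b eq f1 f2 by (simp add: cmp_cot)
  then show ?thesis by (rule epic_cancel[OF e]) (use a b f1 f2 in simp_all)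
qed

text \<open>By \<open>coop_iff_flat\<close> the claim is an equation between arrows out of
  \<open>X \<flat> (Y + Y')\<close>; restricted to the two summands it becomes the two
  hypotheses.\<close>

lemma coop_cot:
  assumes g: "g \<in> Arr C" "Dom C g = X" "Cod C g = Z" and f: "f \<in> Arr C" "Dom C f = Y" "Cod C f = Z"
    and f': "f' \<in> Arr C" "Dom C f' = Y'" "Cod C f' = Z" and c: "coop g f" "coop g f'"
  shows "coop g (cot f f')"
proof -
  have o [simp]: "X \<in> Obj C" "Y \<in> Obj C" "Y' \<in> Obj C" "Z \<in> Obj C" using g f f' by auto
  note [simp] = g f f'
  have c1: "cot g f \<cdot> fl X Y = cot (zro X Z) f \<cdot> fl X Y" by (subst coop_iff_flat[symmetric]) (simp_all add: c)
  have c2: "cot g f' \<cdot> fl X Y' = cot (zro X Z) f' \<cdot> fl X Y'" by (subst coop_iff_flat[symmetric]) (simp_all add: c)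
  note m1 = flat_map_props[of X "in1 Y Y'" Y "cop Y Y'"] and m2 = flat_map_props[of X "in2 Y Y'" Y' "cop Y Y'"]
  have "cot g (cot f f') \<cdot> fl X (cop Y Y') = cot (zro X Z) (cot f f') \<cdot> fl X (cop Y Y')"
  proof (rule flat_ext[OF o(1-3)])
    show "(cot g (cot f f') \<cdot> fl X (cop Y Y')) \<cdot> flat_map C X (in1 Y Y') = (cot (zro X Z) (cot f f') \<cdot> fl X (cop Y Y')) \<cdot> flat_map C X (in1 Y Y')"
      using m1 c1 by (simp add: cmp_cot cmp_cot')
    show "(cot g (cot f f') \<cdot> fl X (cop Y Y')) \<cdot> flat_map C X (in2 Y Y') = (cot (zro X Z) (cot f f') \<cdot> fl X (cop Y Y')) \<cdot> flat_map C X (in2 Y Y')"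
      using m2 c2 by (simp add: cmp_cot cmp_cot')
  qed simp_all
  then show ?thesis by (subst coop_iff_flat) simp_all
qed

end

context semi_abelian_category
begin

text \<open>For a central extension, the kernel pair is \<open>T \<times> D\<close>: parallel morphisms into \<open>T\<close> that agree in the
  quotient differ by a unique morphism into \<open>D\<close>.\<close>

lemma central_difference:
  assumes p: "p \<in> Arr C" "Dom C p = T" "Cod C p = A" and k: "is_kernel C p d" and d: "d \<in> Arr C" "Dom C d = D" "Cod C d = T"
    and c: "coop (ide T) d"
  obtains \<phi> where "\<phi> \<in> Arr C" "Dom C \<phi> = prd T D" "Cod C \<phi> = T"
    "\<And>x. \<lbrakk>x \<in> Arr C; Cod C x = T\<rbrakk> \<Longrightarrow> \<phi> \<cdot> tup x (zro (Dom C x) D) = x"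
    "\<And>y. \<lbrakk>y \<in> Arr C; Cod C y = D\<rbrakk> \<Longrightarrow> \<phi> \<cdot> tup (zro (Dom C y) T) y = d \<cdot> y"
    "p \<cdot> \<phi> = p \<cdot> pr1 T D"
    "\<And>W \<alpha> \<beta>. \<lbrakk>\<alpha> \<in> hom C W T; \<beta> \<in> hom C W T; p \<cdot> \<alpha> = p \<cdot> \<beta>\<rbrakk> \<Longrightarrow> \<exists>\<delta> \<in> hom C W D. \<phi> \<cdot> tup \<beta> \<delta> = \<alpha>"
    "\<And>W \<beta> \<delta> \<delta>'. \<lbrakk>\<beta> \<in> hom C W T; \<delta> \<in> hom C W D; \<delta>' \<in> hom C W D; \<phi> \<cdot> tup \<beta> \<delta> = \<phi> \<cdot> tup \<beta> \<delta>'\<rbrakk> \<Longrightarrow> \<delta> = \<delta>'"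
proof -
  have o [simp]: "T \<in> Obj C" "A \<in> Obj C" "D \<in> Obj C" using p d by auto
  note [simp] = p d
  have pd: "p \<cdot> d = zro D A" using kernelD[OF k] by simp
  obtain \<phi> where f: "\<phi> \<in> Arr C" "Dom C \<phi> = prd T D" "Cod C \<phi> = T"
    and f1': "\<And>x. \<lbrakk>x \<in> Arr C; Cod C x = T\<rbrakk> \<Longrightarrow> \<phi> \<cdot> tup x (zro (Dom C x) D) = ide T \<cdot> x"
    and f2: "\<And>y. \<lbrakk>y \<in> Arr C; Cod C y = D\<rbrakk> \<Longrightarrow> \<phi> \<cdot> tup (zro (Dom C y) T) y = d \<cdot> y"
    by (rule coopE[OF c, of T D T]) (simp_all)
  have f1: "\<phi> \<cdot> tup x (zro (Dom C x) D) = x" if "x \<in> Arr C" "Cod C x = T" for x using f1'[OF that] that by simp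
  have pf: "p \<cdot> \<phi> = p \<cdot> pr1 T D"
    by (rule prd_epi[of _ _ T D]) (use f f1[of "ide T"] f2[of "ide D"] pd in simp_all)
  obtain e1 e2 E where pb: "is_pullback C p p e1 e2" and e: "e1 \<in> Arr C" "e2 \<in> Arr C" "Dom C e1 = E" "Dom C e2 = E"
    "Cod C e1 = T" "Cod C e2 = T" "E \<in> Obj C" "p \<cdot> e1 = p \<cdot> e2"
    by (rule pullbackE[of p p]) simp_all
  obtain s where s: "s \<in> Arr C" "Dom C s = T" "Cod C s = E" "e1 \<cdot> s = ide T" "e2 \<cdot> s = ide T"
    by (rule pullback_factor[OF pb, of "ide T" "ide T"]) (use e in simp_all)
  obtain d' where d': "d' \<in> Arr C" "Dom C d' = D" "Cod C d' = E" "e1 \<cdot> d' = d" "e2 \<cdot> d' = zro D T"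
    by (rule pullback_factor[OF pb, of d "zro D T"]) (use e in \<open>simp_all add: pd\<close>)
  \<comment> \<open>On elements, \<open>F\<close> sends \<open>(x, z)\<close> to the pair of
    \<open>\<phi>(x, z)\<close> and \<open>x\<close>, with \<open>E\<close> the kernel pair of
    \<open>p\<close>. It is a morphism of points over \<open>T\<close> that is the identity on the
    kernels \<open>D\<close>, so it is an isomorphism; its surjectivity gives differences and its
    injectivity their uniqueness.\<close>
  obtain F where F: "F \<in> Arr C" "Dom C F = prd T D" "Cod C F = E" "e1 \<cdot> F = \<phi>" "e2 \<cdot> F = pr1 T D"
    by (rule pullback_factor[OF pb _ _ _ _ _ pf]) (use e f in simp_all)
  note r = e(8)[THEN reassoc] s(4,5)[THEN reassoc] d'(4,5)[THEN reassoc] F(4,5)[THEN reassoc]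
  have kd: "is_kernel C e2 d'"
  proof (rule is_kernelI)
    show "is_mono C d'"
    proof (rule is_monoI)
      fix u v assume a: "u \<in> Arr C" "v \<in> Arr C" "Cod C u = Dom C d'" "Cod C v = Dom C d'" "Dom C u = Dom C v" "d' \<cdot> u = d' \<cdot> v"
      have "e1 \<cdot> (d' \<cdot> u) = e1 \<cdot> (d' \<cdot> v)" by (simp only: a(6))
      then have "d \<cdot> u = d \<cdot> v" using a(1-5) d' e r by simp
      then show "u = v" by (rule is_mono_cancel[OF kernel_mono[OF k]]) (use a(1-5) d' in simp_all)
    qed (rule d')
    fix h assume h: "h \<in> Arr C" "Cod C h = Dom C e2" "e2 \<cdot> h = zro (Dom C h) (Cod C e2)"
    have "p \<cdot> (e1 \<cdot> h) = zro (Dom C h) A" using r(1)[of h] h e by simp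
    then obtain u where u: "u \<in> Arr C" "Dom C u = Dom C h" "Cod C u = D" "d \<cdot> u = e1 \<cdot> h"
      using kernel_factor[OF k, of "e1 \<cdot> h"] h(1,2) e by auto
    have "d' \<cdot> u = h" by (rule pullback_ext[OF pb]) (use u d' e h r(4,5)[of u] in simp_all)
    then show "\<exists>u. u \<in> Arr C \<and> Dom C u = Dom C h \<and> Cod C u = Dom C d' \<and> d' \<cdot> u = h"
      using u(1-3) d'(2) by (intro exI[of _ u]) simp
  qed (use d' e in simp_all)
  have iso: "is_iso C F"
  proof (rule split_short_five[OF pr1_point[of T D] is_pointI[of e2 s] _ _ _ _ _ pr1_kernel[of T D] kd is_iso_ide[of D]])
    show "F \<cdot> tup (ide T) (zro T D) = s"
      by (rule pullback_ext[OF pb]) (use F e s r f f1[of "ide T"] in simp_all)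
    have "F \<cdot> tup (zro D T) (ide D) = d'"
      by (rule pullback_ext[OF pb]) (use F e d' r f f2[of "ide D"] in simp_all)
    then show "F \<cdot> tup (zro D T) (ide D) = d' \<cdot> ide D" using d' by simp
  qed (use F e s d' in simp_all)
  then obtain j where j: "j \<in> Arr C" "Dom C j = E" "Cod C j = prd T D" "F \<cdot> j = ide E"
    by (rule is_isoE) (use F in simp)
  show thesis
  proof (rule that[OF f f1 f2 pf])
    fix W \<alpha> \<beta> assume a: "\<alpha> \<in> hom C W T" "\<beta> \<in> hom C W T" "p \<cdot> \<alpha> = p \<cdot> \<beta>"
    then have a': "\<alpha> \<in> Arr C" "Dom C \<alpha> = W" "Cod C \<alpha> = T" "\<beta> \<in> Arr C" "Dom C \<beta> = W" "Cod C \<beta> = T" by (simp_all add: hom_iff)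
    obtain h where h: "h \<in> Arr C" "Dom C h = W" "Cod C h = E" "e1 \<cdot> h = \<alpha>" "e2 \<cdot> h = \<beta>"
      by (rule pullback_factor[OF pb _ _ _ _ _ a(3)]) (use a' e in simp_all)
    have "F \<cdot> (j \<cdot> h) = h" using j(4)[THEN reassoc, of h] j(1-3) h(1-3) F(1-3) by simp
    then have "\<phi> \<cdot> (j \<cdot> h) = \<alpha>" "pr1 T D \<cdot> (j \<cdot> h) = \<beta>" using r(6,7)[of "j \<cdot> h"] h j(1-3) F(1-3) e by simp_all
    moreover have "tup \<beta> (pr2 T D \<cdot> (j \<cdot> h)) = j \<cdot> h"
      by (rule prd_ext[of _ _ T D]) (use calculation a' h(1-3) j(1-3) in simp_all)
    ultimately have "\<phi> \<cdot> tup \<beta> (pr2 T D \<cdot> (j \<cdot> h)) = \<alpha>" by simp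
    then show "\<exists>\<delta> \<in> hom C W D. \<phi> \<cdot> tup \<beta> \<delta> = \<alpha>"
      using h(1-3) j(1-3) by (intro bexI[of _ "pr2 T D \<cdot> (j \<cdot> h)"]) (simp_all add: hom_iff)
  next
    fix W \<beta> \<delta> \<delta>' assume a: "\<beta> \<in> hom C W T" "\<delta> \<in> hom C W D" "\<delta>' \<in> hom C W D" "\<phi> \<cdot> tup \<beta> \<delta> = \<phi> \<cdot> tup \<beta> \<delta>'"
    then have a': "\<beta> \<in> Arr C" "Dom C \<beta> = W" "Cod C \<beta> = T" "\<delta> \<in> Arr C" "Dom C \<delta> = W" "Cod C \<delta> = D"
       "\<delta>' \<in> Arr C" "Dom C \<delta>' = W" "Cod C \<delta>' = D" by (simp_all add: hom_iff)
    have "F \<cdot> tup \<beta> \<delta> = F \<cdot> tup \<beta> \<delta>'"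
      by (rule pullback_ext[OF pb]) (use a' F e r(6,7)[of "tup \<beta> \<delta>"] r(6,7)[of "tup \<beta> \<delta>'"] a(4) in simp_all)
    then have "tup \<beta> \<delta> = tup \<beta> \<delta>'" by (rule is_mono_cancel[OF is_iso_mono[OF iso]]) (use a' F in simp_all)
    then have "pr2 T D \<cdot> tup \<beta> \<delta> = pr2 T D \<cdot> tup \<beta> \<delta>'" by (simp only:)
    then show "\<delta> = \<delta>'" using a' by simp
  qed
qed

end

section \<open>Central extensions of abelian objects are two-nilpotent\<close>

context bicartesian_category
begin

lemma flat_ext_mono:
  assumes "X \<in> Obj C" "Y \<in> Obj C" "u \<in> Arr C" "v \<in> Arr C" "Dom C u = Dom C v" "Cod C u = flo X Y" "Cod C v = flo X Y"
    "fl X Y \<cdot> u = fl X Y \<cdot> v"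
  shows "u = v"
  by (rule is_mono_cancel[OF kernel_mono[OF flat_is_kernel[OF assms(1,2)]]]) (use assms in simp_all)

lemma flat_map_functor:
  assumes X: "X \<in> Obj C" and f: "f \<in> Arr C" "Dom C f = Y" "Cod C f = Y'" and g: "g \<in> Arr C" "Dom C g = Y'" "Cod C g = Y''"
  shows "flat_map C X g \<cdot> flat_map C X f = flat_map C X (g \<cdot> f)"
proof -
  have o: "Y \<in> Obj C" "Y' \<in> Obj C" "Y'' \<in> Obj C" using f g by auto
  note m = flat_map_props[OF X f] flat_map_props[OF X g] flat_map_props[OF X, of "g \<cdot> f" Y Y'']
  have gf: "g \<cdot> f \<in> Arr C" "Dom C (g \<cdot> f) = Y" "Cod C (g \<cdot> f) = Y''" using f g by simp_all
  show ?thesis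
  proof (rule flat_ext_mono[OF X o(3)])
    have "fl X Y'' \<cdot> (flat_map C X g \<cdot> flat_map C X f) = cot (in1 X Y'') (in2 X Y'' \<cdot> g) \<cdot> (fl X Y' \<cdot> flat_map C X f)"
      using m(8)[THEN reassoc, of "flat_map C X f"] m(1-7) X f g o by simp
    also have "\<dots> = cot (in1 X Y'') (in2 X Y'' \<cdot> (g \<cdot> f)) \<cdot> fl X Y"
      using X f g o by (subst flat_map_comp) simp_all
    finally show "fl X Y'' \<cdot> (flat_map C X g \<cdot> flat_map C X f) = fl X Y'' \<cdot> flat_map C X (g \<cdot> f)" using m(12) gf by simp
  qed (use m gf in simp_all)
qed

lemma flat_map_ide: "\<lbrakk>X \<in> Obj C; Y \<in> Obj C\<rbrakk> \<Longrightarrow> flat_map C X (ide Y) = ide (flo X Y)"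
proof -
  assume o [simp]: "X \<in> Obj C" "Y \<in> Obj C"
  have ii: "cot (in1 X Y) (in2 X Y) = ide (cop X Y)" by (rule cop_ext[of _ _ X Y]) simp_all
  show ?thesis by (rule flat_ext_mono[OF o]) (use flat_map_props[of X "ide Y" Y Y] in \<open>simp_all add: ii\<close>)
qed

lemma flat_map_zro: "\<lbrakk>X \<in> Obj C; Y \<in> Obj C; Y' \<in> Obj C\<rbrakk> \<Longrightarrow> flat_map C X (zro Y Y') = zro (flo X Y) (flo X Y')"
proof -
  assume o [simp]: "X \<in> Obj C" "Y \<in> Obj C" "Y' \<in> Obj C"
  show ?thesis
    by (rule flat_ext_mono[OF o(1,3)])
      (use flat_map_props[of X "zro Y Y'" Y Y'] flat_zero[of X "in1 X Y'" "cop X Y'" Y] in \<open>simp_all\<close>)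
qed

end

text \<open>Modulo the kernel \<open>D\<close> the conjugation action of \<open>T\<close> on \<open>T + T\<close> becomes trivial, so it differs from the
  trivial action by some \<open>\<delta>\<close> with values in \<open>D\<close>. By coherence \<open>\<delta>\<close> is the sum of its restrictions to the two
  summands, hence vanishes on the ternary cosmash product.\<close>

lemma (in coherent_category) central_extension_nilp2:
  assumes p: "p \<in> Arr C" "Dom C p = T" "Cod C p = A" and k: "is_kernel C p d"
    and c: "coop (ide T) d" and ab: "coop (ide A) (ide A)"
  shows "nilp2 T"
proof -
  define D where "D = Dom C d"
  have d: "d \<in> Arr C" "Dom C d = D" "Cod C d = T" using kernelD[OF k] p by (simp_all add: D_def)
  have o [simp]: "T \<in> Obj C" "A \<in> Obj C" "D \<in> Obj C" using p d by auto
  note [simp] = p d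
  have pd: "p \<cdot> d = zro D A" using kernelD[OF k] by simp
  obtain \<phi> where f: "\<phi> \<in> Arr C" "Dom C \<phi> = prd T D" "Cod C \<phi> = T"
    and f1: "\<And>x. \<lbrakk>x \<in> Arr C; Cod C x = T\<rbrakk> \<Longrightarrow> \<phi> \<cdot> tup x (zro (Dom C x) D) = x"
    and f2: "\<And>y. \<lbrakk>y \<in> Arr C; Cod C y = D\<rbrakk> \<Longrightarrow> \<phi> \<cdot> tup (zro (Dom C y) T) y = d \<cdot> y"
    and pf: "p \<cdot> \<phi> = p \<cdot> pr1 T D"
    and diff: "\<And>W \<alpha> \<beta>. \<lbrakk>\<alpha> \<in> hom C W T; \<beta> \<in> hom C W T; p \<cdot> \<alpha> = p \<cdot> \<beta>\<rbrakk> \<Longrightarrow> \<exists>\<delta> \<in> hom C W D. \<phi> \<cdot> tup \<beta> \<delta> = \<alpha>"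
    and uniq: "\<And>W \<beta> \<delta> \<delta>'. \<lbrakk>\<beta> \<in> hom C W T; \<delta> \<in> hom C W D; \<delta>' \<in> hom C W D; \<phi> \<cdot> tup \<beta> \<delta> = \<phi> \<cdot> tup \<beta> \<delta>'\<rbrakk> \<Longrightarrow> \<delta> = \<delta>'"
    by (rule central_difference[OF p k d c]) (rule that, assumption+)
  \<comment> \<open>Restricted to \<open>D \<times> D\<close>, the cooperator takes values in the
    kernel of \<open>p\<close>. This is an addition on \<open>D\<close>, of which the two unit laws
    are needed.\<close>
  have "p \<cdot> (\<phi> \<cdot> tup (d \<cdot> pr1 D D) (pr2 D D)) = zro (prd D D) A"
    using pf[THEN reassoc, of "tup (d \<cdot> pr1 D D) (pr2 D D)"] pd[THEN reassoc, of "pr1 D D"] f by simp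
  then obtain add where add: "add \<in> Arr C" "Dom C add = prd D D" "Cod C add = D" "d \<cdot> add = \<phi> \<cdot> tup (d \<cdot> pr1 D D) (pr2 D D)"
    using kernel_factor[OF k, of "\<phi> \<cdot> tup (d \<cdot> pr1 D D) (pr2 D D)"] f by auto
  have add1: "add \<cdot> tup x (zro W D) = x" if x: "x \<in> Arr C" "Cod C x = D" "Dom C x = W" for x W
  proof -
    have W: "W \<in> Obj C" using x by auto
    have "d \<cdot> (add \<cdot> tup x (zro W D)) = d \<cdot> x"
      using add(4)[THEN reassoc, of "tup x (zro W D)"] f1[of "d \<cdot> x"] x W add(1-3) f by simp
    then show ?thesis by (rule is_mono_cancel[OF kernel_mono[OF k]]) (use x W add in simp_all)
  qed
  have add2: "add \<cdot> tup (zro W D) x = x" if x: "x \<in> Arr C" "Cod C x = D" "Dom C x = W" for x W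
  proof -
    have W: "W \<in> Obj C" using x by auto
    have "d \<cdot> (add \<cdot> tup (zro W D) x) = d \<cdot> x"
      using add(4)[THEN reassoc, of "tup (zro W D) x"] f2[of x] x W add(1-3) f by simp
    then show ?thesis by (rule is_mono_cancel[OF kernel_mono[OF k]]) (use x W add in simp_all)
  qed
  let ?n = "cot (ide T) (ide T)"
  define S \<kappa> F \<kappa>1 F1 where defs: "S = cop T T" "\<kappa> = fl T S" "F = flo T S" "\<kappa>1 = fl T T" "F1 = flo T T"
  have S [simp]: "S \<in> Obj C" by (simp add: defs)
  have S': "cop T T = S" by (simp add: defs)
  note [simp] = S'
  have fl: "\<kappa> \<in> Arr C" "Dom C \<kappa> = F" "Cod C \<kappa> = cop T S" "F \<in> Obj C" "\<kappa>1 \<in> Arr C" "Dom C \<kappa>1 = F1" "Cod C \<kappa>1 = S" "F1 \<in> Obj C"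
    unfolding defs(2-5) using S flat_simps[of T T] by simp_all
  \<comment> \<open>Here \<open>\<alpha>\<close> is conjugation by \<open>T\<close> on
    \<open>T + T\<close> followed by the fold, and \<open>\<beta>\<close> the same with trivial
    action; \<open>\<alpha>1\<close> and \<open>\<beta>1\<close> are their versions with a single
    copy acted upon.\<close>
  define \<alpha> \<beta> \<alpha>1 \<beta>1 where ab_defs: "\<alpha> = cot (ide T) ?n \<cdot> \<kappa>" "\<beta> = cot (zro T T) ?n \<cdot> \<kappa>"
    "\<alpha>1 = cot (ide T) (ide T) \<cdot> \<kappa>1" "\<beta>1 = cot (zro T T) (ide T) \<cdot> \<kappa>1"
  have h: "\<alpha> \<in> hom C F T" "\<beta> \<in> hom C F T" "\<alpha>1 \<in> hom C F1 T" "\<beta>1 \<in> hom C F1 T"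
    unfolding ab_defs using fl by (simp_all add: hom_iff)
  then have h': "\<beta> \<in> Arr C" "Dom C \<beta> = F" "Cod C \<beta> = T" "\<beta>1 \<in> Arr C" "Dom C \<beta>1 = F1" "Cod C \<beta>1 = T" by (simp_all add: hom_iff)
  \<comment> \<open>Since \<open>A\<close> is abelian, any two arrows that factor through it with
    equal codomain \<open>A\<close> cooperate; by \<open>coop_iff_flat\<close>, conjugation becomes
    trivial after \<open>p\<close>.\<close>
  have "coop (ide A \<cdot> p) (ide A \<cdot> p)" "coop (ide A \<cdot> p) (ide A \<cdot> cot p p)"
    by (rule coop_precmp[OF ab, of A A A]; simp)+
  then have "coop p p" "coop p (cot p p)" by simp_all
  then have "cot p p \<cdot> \<kappa>1 = cot (zro T A) p \<cdot> \<kappa>1" "cot p (cot p p) \<cdot> \<kappa> = cot (zro T A) (cot p p) \<cdot> \<kappa>"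
    unfolding defs(2,4) by (simp_all add: coop_iff_flat[of p p T T A] coop_iff_flat[of p "cot p p" T S A])
  then have pab: "p \<cdot> \<alpha> = p \<cdot> \<beta>" "p \<cdot> \<alpha>1 = p \<cdot> \<beta>1" unfolding ab_defs using fl by (simp_all add: cmp_cot cmp_cot')
  obtain \<delta> where "\<delta> \<in> hom C F D" and dl4: "\<phi> \<cdot> tup \<beta> \<delta> = \<alpha>"
    using diff[OF h(1,2) pab(1)] by blast
  then have dl: "\<delta> \<in> Arr C" "Dom C \<delta> = F" "Cod C \<delta> = D" by (simp_all add: hom_iff)
  obtain \<delta>1 where "\<delta>1 \<in> hom C F1 D" and dl14: "\<phi> \<cdot> tup \<beta>1 \<delta>1 = \<alpha>1"
    using diff[OF h(3,4) pab(2)] by blast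
  then have dl1: "\<delta>1 \<in> Arr C" "Dom C \<delta>1 = F1" "Cod C \<delta>1 = D" by (simp_all add: hom_iff)
  \<comment> \<open>The inclusions of the two copies and the retractions that kill the other one.
    They satisfy the biproduct equations, although \<open>F\<close> is not a biproduct; it is
    coherence that makes \<open>m1\<close> and \<open>m2\<close> jointly epic.\<close>
  define m1 m2 r1 r2 where mr_defs: "m1 = flat_map C T (in1 T T)" "m2 = flat_map C T (in2 T T)"
    "r1 = flat_map C T (cot (ide T) (zro T T))" "r2 = flat_map C T (cot (zro T T) (ide T))"
  have m: "m1 \<in> Arr C" "Dom C m1 = F1" "Cod C m1 = F" "m2 \<in> Arr C" "Dom C m2 = F1" "Cod C m2 = F"
    "r1 \<in> Arr C" "Dom C r1 = F" "Cod C r1 = F1" "r2 \<in> Arr C" "Dom C r2 = F" "Cod C r2 = F1"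
    unfolding mr_defs defs(3,5) by (rule flat_map_props; simp)+
  have rm: "r1 \<cdot> m1 = ide F1" "r1 \<cdot> m2 = zro F1 F1" "r2 \<cdot> m1 = zro F1 F1" "r2 \<cdot> m2 = ide F1"
    unfolding mr_defs defs(5) by (simp_all add: flat_map_functor[of T _ T S _ T] flat_map_ide flat_map_zro)
  have am: "\<alpha> \<cdot> m1 = \<alpha>1" "\<beta> \<cdot> m1 = \<beta>1" "\<alpha> \<cdot> m2 = \<alpha>1" "\<beta> \<cdot> m2 = \<beta>1"
  proof -
    note c = flat_map_comp[of T "in1 T T" T S _ T ?n] flat_map_comp[of T "in2 T T" T S _ T ?n]
    show "\<alpha> \<cdot> m1 = \<alpha>1" "\<beta> \<cdot> m1 = \<beta>1" "\<alpha> \<cdot> m2 = \<alpha>1" "\<beta> \<cdot> m2 = \<beta>1"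
      using c[of "ide T"] c[of "zro T T"] fl m unfolding ab_defs mr_defs[symmetric] defs(2,4)[symmetric] by simp_all
  qed
  have dm: "\<delta> \<cdot> m1 = \<delta>1" "\<delta> \<cdot> m2 = \<delta>1"
  proof -
    have e1: "\<phi> \<cdot> tup \<beta>1 (\<delta> \<cdot> m1) = \<phi> \<cdot> tup \<beta>1 \<delta>1"
      using dl4[THEN reassoc, of m1] am dl14 h' dl m f by simp
    show "\<delta> \<cdot> m1 = \<delta>1" by (rule uniq[of \<beta>1 F1, OF _ _ _ e1]) (use h' dl dl1 m in \<open>simp_all add: hom_iff\<close>)
    have e2: "\<phi> \<cdot> tup \<beta>1 (\<delta> \<cdot> m2) = \<phi> \<cdot> tup \<beta>1 \<delta>1"
      using dl4[THEN reassoc, of m2] am dl14 h' dl m f by simp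
    show "\<delta> \<cdot> m2 = \<delta>1" by (rule uniq[of \<beta>1 F1, OF _ _ _ e2]) (use h' dl dl1 m in \<open>simp_all add: hom_iff\<close>)
  qed
  \<comment> \<open>The only candidate compatible with \<open>m1\<close> and \<open>m2\<close>: both
    restrictions of \<open>\<delta>\<close> are \<open>\<delta>1\<close>, and by the unit laws so
    are those of this sum.\<close>
  let ?d = "add \<cdot> tup (\<delta>1 \<cdot> r1) (\<delta>1 \<cdot> r2)"
  have deq: "\<delta> = ?d"
  proof (rule flat_ext[OF o(1) o(1) o(1)])
    show "\<delta> \<cdot> flat_map C T (in1 T T) = ?d \<cdot> flat_map C T (in1 T T)"
      unfolding mr_defs(1,2)[symmetric] using dm dl1 m add(1-3) fl add1[of \<delta>1] by (simp add: rm)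
    show "\<delta> \<cdot> flat_map C T (in2 T T) = ?d \<cdot> flat_map C T (in2 T T)"
      unfolding mr_defs(1,2)[symmetric] using dm dl1 m add(1-3) fl add2[of \<delta>1] by (simp add: rm)
  qed (use dl dl1 add m in \<open>simp_all add: defs(3)\<close>)
  define \<iota> W where "\<iota> = cosmash3 C T T T" and "W = Dom C \<iota>"
  have io: "\<iota> \<in> Arr C" "Dom C \<iota> = W" "Cod C \<iota> = cop S T" "W \<in> Obj C" unfolding W_def \<iota>_def by simp_all
  have kill: "(g \<cdot> cot (ide S) (zro T S)) \<cdot> \<iota> = zro W (Cod C g)"
    "(g \<cdot> cot (cot (in1 T T) (zro T S)) (in2 T T)) \<cdot> \<iota> = zro W (Cod C g)"
    "(g \<cdot> cot (cot (zro T S) (in1 T T)) (in2 T T)) \<cdot> \<iota> = zro W (Cod C g)" if "g \<in> Arr C" "Dom C g = S" for g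
    using cosmash3_kill[OF o(1) o(1) o(1) that(1)] that unfolding W_def \<iota>_def by simp_all
  \<comment> \<open>The third summand is moved to the front, to become the one that acts. What is
    left after the other two are killed vanishes, so the ternary cosmash product factors through
    \<open>T \<flat> (T + T)\<close>.\<close>
  let ?s = "cot (cot (in2 T S \<cdot> in1 T T) (in2 T S \<cdot> in2 T T)) (in1 T S)"
  obtain w where w: "w \<in> Arr C" "Dom C w = W" "Cod C w = F" "\<kappa> \<cdot> w = ?s \<cdot> \<iota>"
    unfolding defs(2,3)
    by (rule flat_lift[of T S "?s \<cdot> \<iota>" W]) (use kill(3)[of "cot (zro T T) (ide T)"] io in \<open>simp_all add: cmp_cot cmp_cot'\<close>)
  \<comment> \<open>Each retraction removes one of the two summands acted upon, and the ternary
    cosmash product is killed by such a removal. Removing the acting summand gives \<open>bw\<close>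
    in the same way, so that conjugation equals \<open>\<phi>(0, 0)\<close> there.\<close>
  have rw: "r1 \<cdot> w = zro W F1" "r2 \<cdot> w = zro W F1"
  proof -
    have "\<kappa>1 \<cdot> (r1 \<cdot> w) = cot (in1 T T) (in2 T T \<cdot> cot (ide T) (zro T T)) \<cdot> (\<kappa> \<cdot> w)"
      "\<kappa>1 \<cdot> (r2 \<cdot> w) = cot (in1 T T) (in2 T T \<cdot> cot (zro T T) (ide T)) \<cdot> (\<kappa> \<cdot> w)"
      using flat_map_props(4)[of T "cot (ide T) (zro T T)" S T, THEN reassoc, of w]
        flat_map_props(4)[of T "cot (zro T T) (ide T)" S T, THEN reassoc, of w] fl w(1-3) m
      unfolding mr_defs[symmetric] defs(2,4)[symmetric] by simp_all
    then have "\<kappa>1 \<cdot> (r1 \<cdot> w) = zro W S" "\<kappa>1 \<cdot> (r2 \<cdot> w) = zro W S"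
      unfolding w(4) using kill(2)[of "cot (in2 T T) (in1 T T)"] kill(3)[of "cot (in2 T T) (in1 T T)"] io
      by (simp_all add: cmp_cot cmp_cot')
    then have e: "fl T T \<cdot> (r1 \<cdot> w) = fl T T \<cdot> zro W F1" "fl T T \<cdot> (r2 \<cdot> w) = fl T T \<cdot> zro W F1"
      using fl io unfolding defs(4)[symmetric] by simp_all
    show "r1 \<cdot> w = zro W F1"
      by (rule flat_ext_mono[OF o(1) o(1) _ _ _ _ _ e(1)]) (use m w(1-3) fl io defs(5) in simp_all)
    show "r2 \<cdot> w = zro W F1"
      by (rule flat_ext_mono[OF o(1) o(1) _ _ _ _ _ e(2)]) (use m w(1-3) fl io defs(5) in simp_all)
  qed
  have dw: "\<delta> \<cdot> w = zro W D" unfolding deq using rw w(1-3) m dl1 add(1-3) io add1[of "zro W D"] fl by simp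
  have bw: "\<beta> \<cdot> w = zro W T" unfolding ab_defs using fl w kill(1)[of ?n] io by (simp add: cmp_cot cmp_cot')
  have "\<alpha> \<cdot> w = \<phi> \<cdot> tup (\<beta> \<cdot> w) (\<delta> \<cdot> w)" using dl4[THEN reassoc, of w] h' dl w(1-3) f by simp
  then have "\<alpha> \<cdot> w = zro W T" unfolding dw bw using f1[of "zro W T"] io by simp
  then have "cot (ide T) ?n \<cdot> (\<kappa> \<cdot> w) = zro W T" unfolding ab_defs using fl w(1-3) by simp
  then have "cot (cot (ide T) (ide T)) (ide T) \<cdot> \<iota> = zro W T" unfolding w(4) using io by (simp add: cmp_cot cmp_cot')
  then show ?thesis by (simp add: nilp2_def \<iota>_def W_def)
qed

section \<open>Images, commutators, joins and meets\<close>

context semi_abelian_category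
begin

lemma image_props:
  assumes f: "f \<in> Arr C"
  obtains e where "is_mono C (image C f)" "image C f \<in> Arr C" "Cod C (image C f) = Cod C f"
    "is_regular_epi C e" "e \<in> Arr C" "Dom C e = Dom C f" "Cod C e = Dom C (image C f)" "image C f \<cdot> e = f"
proof -
  obtain m e where me: "is_mono C m" "is_regular_epi C e" "m \<cdot> e = f" "Dom C m = Cod C e" "Dom C e = Dom C f" "Cod C m = Cod C f"
    using image_factorization[OF f] .
  then have "is_mono C m \<and> (\<exists>e \<in> hom C (Dom C f) (Dom C m). is_regular_epi C e \<and> f = m \<cdot> e)"
    using regular_epi_arr[OF me(2)] by (intro conjI bexI[of _ e]) (simp_all add: hom_iff)
  then have "is_mono C (image C f) \<and> (\<exists>e \<in> hom C (Dom C f) (Dom C (image C f)). is_regular_epi C e \<and> f = image C f \<cdot> e)"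
    unfolding image_def by (rule someI)
  then obtain e where i: "is_mono C (image C f)" "e \<in> hom C (Dom C f) (Dom C (image C f))" "is_regular_epi C e" "f = image C f \<cdot> e"
    by blast
  have e: "e \<in> Arr C" "Dom C e = Dom C f" "Cod C e = Dom C (image C f)" using i(2) by (simp_all add: hom_iff)
  have c: "Cod C (image C f \<cdot> e) = Cod C (image C f)" by (rule cod_cmp) (use e is_mono_arr[OF i(1)] in simp_all)
  show thesis by (rule that[OF i(1) is_mono_arr[OF i(1)] _ i(3) e i(4)[symmetric]]) (use c i(4) in metis)
qed

text \<open>The first part of the factorisation can be cancelled because it is epic. This is how a
  chosen image is handled without being known.\<close>

lemma kills_image:
  assumes f: "f \<in> Arr C" "Cod C f = X" and h: "h \<in> Arr C" "Dom C h = X" "Cod C h = Y"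
  shows "h \<cdot> image C f = zro (Dom C (image C f)) Y \<longleftrightarrow> h \<cdot> f = zro (Dom C f) Y"
proof -
  obtain e where i: "is_mono C (image C f)" "image C f \<in> Arr C" "Cod C (image C f) = Cod C f"
    "is_regular_epi C e" "e \<in> Arr C" "Dom C e = Dom C f" "Cod C e = Dom C (image C f)" "image C f \<cdot> e = f"
    by (rule image_props[OF f(1)])
  have Y: "Y \<in> Obj C" using h by auto
  have eq: "(h \<cdot> image C f) \<cdot> e = h \<cdot> f" using i(2,3,5-8) f h by simp
  show ?thesis
  proof
    assume "h \<cdot> image C f = zro (Dom C (image C f)) Y"
    then show "h \<cdot> f = zro (Dom C f) Y" using eq i(2,5-7) Y by simp
  next
    assume "h \<cdot> f = zro (Dom C f) Y"
    then have eq2: "(h \<cdot> image C f) \<cdot> e = zro (Dom C (image C f)) Y \<cdot> e" using eq i(2,5-7) Y by simp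
    show "h \<cdot> image C f = zro (Dom C (image C f)) Y"
      by (rule epic_cancel[OF regular_epi_epic[OF i(4)] eq2]) (use i(2,3,5-7) f h Y in simp_all)
  qed
qed

text \<open>With the identity in the role of \<open>h\<close>, the image is a zero arrow exactly
  when \<open>f\<close> is; a monomorphism that is a zero arrow has zero domain.\<close>

lemma image_is_zero:
  assumes f: "f \<in> Arr C" "Dom C f = X" "Cod C f = Y"
  shows "is_zero C (Dom C (image C f)) \<longleftrightarrow> f = zro X Y"
proof -
  obtain e where i: "is_mono C (image C f)" "image C f \<in> Arr C" "Cod C (image C f) = Cod C f"
    by (rule image_props[OF f(1)])
  have [simp]: "Y \<in> Obj C" "X \<in> Obj C" using f by auto
  have "ide Y \<cdot> f = f" "ide Y \<cdot> image C f = image C f" using f i by simp_all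
  then have eq: "image C f = zro (Dom C (image C f)) Y \<longleftrightarrow> f = zro X Y"
    using kills_image[OF f(1,3), of "ide Y" Y] f by simp
  show ?thesis
  proof
    assume "is_zero C (Dom C (image C f))"
    from zero_from[OF this i(2) refl] show "f = zro X Y" using eq i(3) f(3) by simp
  next
    define I where "I = Dom C (image C f)"
    assume "f = zro X Y"
    then have z: "image C f = zro I Y" using eq by (simp add: I_def)
    have [simp]: "I \<in> Obj C" using i(2) by (simp add: I_def)
    have "image C f \<cdot> ide I = image C f \<cdot> zro I I" unfolding z by simp
    then have "ide I = zro I I" by (rule is_mono_cancel[OF i(1)]) (simp_all add: I_def[symmetric])
    then show "is_zero C (Dom C (image C f))" unfolding I_def[symmetric] by (intro is_zeroI) simp_all
  qed
qed

text \<open>The last clause combines \<open>kills_image\<close> with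
  \<open>coop_iff_cosmash\<close>: it characterises the commutator by the arrows in whose target
  \<open>m\<close> and \<open>n\<close> commute.\<close>

lemma higgins_props:
  assumes m: "m \<in> Arr C" "Dom C m = X" "Cod C m = Z" and n: "n \<in> Arr C" "Dom C n = Y" "Cod C n = Z"
  shows "higgins C m n \<in> Arr C" "Cod C (higgins C m n) = Z" "is_mono C (higgins C m n)"
    "\<And>h. \<lbrakk>h \<in> Arr C; Dom C h = Z\<rbrakk> \<Longrightarrow> h \<cdot> higgins C m n = zro (Dom C (higgins C m n)) (Cod C h) \<longleftrightarrow> coop (h \<cdot> m) (h \<cdot> n)"
proof -
  have [simp]: "X \<in> Obj C" "Y \<in> Obj C" "Z \<in> Obj C" using m n by auto
  note [simp] = m n
  let ?f = "cot m n \<cdot> cosmash C X Y"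
  have f: "?f \<in> Arr C" "Dom C ?f = Dom C (cosmash C X Y)" "Cod C ?f = Z" by simp_all
  have hig: "higgins C m n = image C ?f" by (simp add: higgins_def)
  obtain e where i: "is_mono C (image C ?f)" "image C ?f \<in> Arr C" "Cod C (image C ?f) = Cod C ?f"
    by (rule image_props[OF f(1)])
  then show "higgins C m n \<in> Arr C" "Cod C (higgins C m n) = Z" "is_mono C (higgins C m n)" using hig f by simp_all
  fix h assume h: "h \<in> Arr C" "Dom C h = Z"
  show "h \<cdot> higgins C m n = zro (Dom C (higgins C m n)) (Cod C h) \<longleftrightarrow> coop (h \<cdot> m) (h \<cdot> n)"
    using kills_image[OF f(1,3) h] h coop_iff_cosmash[of "h \<cdot> m" "h \<cdot> n" X Y "Cod C h"]
    by (simp add: hig cmp_cot cmp_cot')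
qed

lemma abelian_object_iff: "abelian_object C M \<longleftrightarrow> M \<in> Obj C \<and> coop (ide M) (ide M)"
proof -
  have "is_zero C (Dom C (higgins C (ide M) (ide M))) \<longleftrightarrow> coop (ide M) (ide M)" if [simp]: "M \<in> Obj C"
    using image_is_zero[of "cot (ide M) (ide M) \<cdot> cosmash C M M"] coop_iff_cosmash[of "ide M" "ide M" M M M]
    by (simp add: higgins_def)
  then show ?thesis by (auto simp: abelian_object_def)
qed

lemma nilp2_iff:
  assumes [simp]: "T \<in> Obj C"
  shows "is_zero C (Dom C (higgins3 C (ide T) (ide T) (ide T))) \<longleftrightarrow> nilp2 T"
  using image_is_zero[of "cot (cot (ide T) (ide T)) (ide T) \<cdot> cosmash3 C T T T"]
  by (simp add: higgins3_def cotuple3_def nilp2_def)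

lemma kills_le:
  assumes "m \<in> Arr C" "n \<in> Arr C" "Cod C n = X" "sub_le C m n" "h \<in> Arr C" "Dom C h = X" "h \<cdot> n = zro (Dom C n) (Cod C h)"
  shows "h \<cdot> m = zro (Dom C m) (Cod C h)"
proof -
  obtain u where u: "u \<in> Arr C" "Dom C u = Dom C m" "Cod C u = Dom C n" "m = n \<cdot> u"
    using assms(4) by (auto simp: sub_le_def hom_iff)
  have "h \<cdot> (n \<cdot> u) = zro (Dom C m) (Cod C h)" using assms(7)[THEN reassoc, of u] u(1-3) assms by simp
  then show ?thesis using u(4) by simp
qed

lemma sub_leI: "\<lbrakk>u \<in> Arr C; Dom C u = Dom C m; Cod C u = Dom C n; n \<cdot> u = m\<rbrakk> \<Longrightarrow> sub_le C m n"
  by (auto simp: sub_le_def hom_iff)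

lemma kernel_sub_le:
  assumes "is_kernel C h k" "m \<in> Arr C" "Cod C m = Dom C h" "h \<cdot> m = zro (Dom C m) (Cod C h)"
  shows "sub_le C m k"
  by (rule kernel_factor[OF assms]) (rule sub_leI)

text \<open>The choice is witnessed by the kernel of the cokernel of \<open>m\<close>: if
  \<open>l\<close> is the kernel of \<open>f\<close> and contains \<open>m\<close>, then
  \<open>f\<close> factors through the cokernel. An arrow that kills \<open>m\<close> kills the
  closure, because its own kernel is a normal subobject containing \<open>m\<close>.\<close>

lemma normal_closure_props:
  assumes m: "m \<in> Arr C" "Cod C m = X"
  shows "normal_closure C m \<in> Arr C" "is_mono C (normal_closure C m)" "Cod C (normal_closure C m) = X"
    "\<And>h. \<lbrakk>h \<in> Arr C; Dom C h = X\<rbrakk> \<Longrightarrow> h \<cdot> normal_closure C m = zro (Dom C (normal_closure C m)) (Cod C h) \<longleftrightarrow> h \<cdot> m = zro (Dom C m) (Cod C h)"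
proof -
  let ?P = "\<lambda>n. is_normal_subobject C (Cod C m) n \<and> sub_le C m n \<and>
    (\<forall>l. is_normal_subobject C (Cod C m) l \<and> sub_le C m l \<longrightarrow> sub_le C n l)"
  have norm: "n \<in> Arr C" "is_mono C n" "Cod C n = X" if "is_normal_subobject C X n" for n
    using that kernelD kernel_mono by (auto simp: is_normal_subobject_def)
  obtain c where co: "is_cokernel C m c" using cokernel_exists[OF m(1)] .
  note c = cokernelD[OF co]
  obtain k K where k: "is_kernel C c k" "k \<in> Arr C" "Dom C k = K" "Cod C k = Dom C c" "K \<in> Obj C" "c \<cdot> k = zro K (Cod C c)"
    by (rule kerE[OF c(2)])
  have kX: "Cod C k = X" using k(4) c(3) m(2) by simp
  have "?P k"
  proof (intro conjI allI impI)
    show "is_normal_subobject C (Cod C m) k" using k(1) c(3) by (auto simp: is_normal_subobject_def)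
    show "sub_le C m k" by (rule kernel_sub_le[OF k(1) m(1)]) (use c m in simp_all)
    fix l assume l: "is_normal_subobject C (Cod C m) l \<and> sub_le C m l"
    then obtain f where f: "Dom C f = X" "is_kernel C f l" by (auto simp: is_normal_subobject_def m)
    note fl = kernelD[OF f(2)]
    have "f \<cdot> m = zro (Dom C m) (Cod C f)" by (rule kills_le[OF m(1) fl(2) _ _ fl(1) f(1) fl(4)]) (use l fl f in simp_all)
    then obtain u where u: "u \<in> Arr C" "Dom C u = Cod C c" "Cod C u = Cod C f" "u \<cdot> c = f"
      using cokernel_factor[OF co fl(1)] f m by auto
    have "(u \<cdot> c) \<cdot> k = zro (Dom C k) (Cod C f)" using u(1-3) c(2) k(2-6) by simp
    then show "sub_le C k l" by (intro kernel_sub_le[OF f(2) k(2)]) (use kX f u(4) in simp_all)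
  qed
  then have P: "?P (normal_closure C m)" unfolding normal_closure_def by (rule someI)
  then show n: "normal_closure C m \<in> Arr C" "is_mono C (normal_closure C m)" "Cod C (normal_closure C m) = X"
    using norm by (simp_all add: m)
  fix h assume h: "h \<in> Arr C" "Dom C h = X"
  show "h \<cdot> normal_closure C m = zro (Dom C (normal_closure C m)) (Cod C h) \<longleftrightarrow> h \<cdot> m = zro (Dom C m) (Cod C h)"
  proof
    assume "h \<cdot> normal_closure C m = zro (Dom C (normal_closure C m)) (Cod C h)"
    then show "h \<cdot> m = zro (Dom C m) (Cod C h)"
      by (intro kills_le[OF m(1) n(1,3) _ h]) (use P in simp_all)
  next
    assume "h \<cdot> m = zro (Dom C m) (Cod C h)"
    obtain l L where l: "is_kernel C h l" "l \<in> Arr C" "Dom C l = L" "Cod C l = Dom C h" "L \<in> Obj C" "h \<cdot> l = zro L (Cod C h)"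
      by (rule kerE[OF h(1)])
    have "is_normal_subobject C (Cod C m) l" using l(1) h m by (auto simp: is_normal_subobject_def)
    moreover have "sub_le C m l" by (rule kernel_sub_le[OF l(1) m(1)]) (use h m \<open>h \<cdot> m = _\<close> in simp_all)
    ultimately have le: "sub_le C (normal_closure C m) l" using P by blast
    show "h \<cdot> normal_closure C m = zro (Dom C (normal_closure C m)) (Cod C h)"
      by (rule kills_le[OF n(1) l(2) _ le h]) (use l h in simp_all)
  qed
qed

lemma huq_props:
  assumes m: "m \<in> Arr C" "Dom C m = X" "Cod C m = Z" and n: "n \<in> Arr C" "Dom C n = Y" "Cod C n = Z"
  shows "huq C m n \<in> Arr C" "is_mono C (huq C m n)" "Cod C (huq C m n) = Z"
    "\<And>h. \<lbrakk>h \<in> Arr C; Dom C h = Z\<rbrakk> \<Longrightarrow> h \<cdot> huq C m n = zro (Dom C (huq C m n)) (Cod C h) \<longleftrightarrow> coop (h \<cdot> m) (h \<cdot> n)"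
  unfolding huq_def using higgins_props[OF m n] normal_closure_props[of "higgins C m n" Z] by simp_all

text \<open>The choice is witnessed by the image of \<open>cot m n\<close>, which is least by the
  diagonal property. An arrow that kills both \<open>m\<close> and \<open>n\<close> has a kernel
  containing both, hence their join.\<close>

lemma join_props:
  assumes m: "is_mono C m" "m \<in> Arr C" "Cod C m = X" and n: "is_mono C n" "n \<in> Arr C" "Cod C n = X"
  shows "join C m n \<in> Arr C" "Cod C (join C m n) = X"
    "\<And>h. \<lbrakk>h \<in> Arr C; Dom C h = X\<rbrakk> \<Longrightarrow> h \<cdot> join C m n = zro (Dom C (join C m n)) (Cod C h) \<longleftrightarrow>
       h \<cdot> m = zro (Dom C m) (Cod C h) \<and> h \<cdot> n = zro (Dom C n) (Cod C h)"
proof -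
  let ?P = "\<lambda>j. is_subobject C (Cod C m) j \<and> sub_le C m j \<and> sub_le C n j \<and>
        (\<forall>l. is_subobject C (Cod C m) l \<and> sub_le C m l \<and> sub_le C n l \<longrightarrow> sub_le C j l)"
  define A B where "A = Dom C m" and "B = Dom C n"
  have ab: "Dom C m = A" "Dom C n = B" "A \<in> Obj C" "B \<in> Obj C" using m n by (simp_all add: A_def B_def)
  obtain e where i: "is_mono C (image C (cot m n))" "image C (cot m n) \<in> Arr C" "Cod C (image C (cot m n)) = Cod C (cot m n)"
    "is_regular_epi C e" "e \<in> Arr C" "Dom C e = Dom C (cot m n)" "Cod C e = Dom C (image C (cot m n))" "image C (cot m n) \<cdot> e = cot m n"
    by (rule image_props[of "cot m n"]) (use m n in simp_all)
  define I j where "I = Cod C e" and "j = image C (cot m n)"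
  have j: "j \<in> Arr C" "Dom C j = I" "Cod C j = X" "is_mono C j" "j \<cdot> e = cot m n" and e: "e \<in> Arr C" "Dom C e = cop A B" "Cod C e = I"
    using i m(2,3) n(2,3) ab unfolding I_def j_def by simp_all
  have "?P j"
  proof (intro conjI allI impI)
    show "is_subobject C (Cod C m) j" using j m by (simp add: is_subobject_def)
    show "sub_le C m j" by (rule sub_leI[of "e \<cdot> in1 A B"])
      (use j(5)[THEN reassoc, of "in1 A B"] j(1-3) e ab m(2,3) n(2,3) in simp_all)
    show "sub_le C n j" by (rule sub_leI[of "e \<cdot> in2 A B"])
      (use j(5)[THEN reassoc, of "in2 A B"] j(1-3) e ab m(2,3) n(2,3) in simp_all)
    fix l assume l: "is_subobject C (Cod C m) l \<and> sub_le C m l \<and> sub_le C n l"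
    then have l1: "is_mono C l" "l \<in> Arr C" "Cod C l = X" using is_mono_arr m by (auto simp: is_subobject_def)
    obtain a where a: "a \<in> Arr C" "Dom C a = A" "Cod C a = Dom C l" "m = l \<cdot> a" using l ab by (auto simp: sub_le_def hom_iff)
    obtain b where b: "b \<in> Arr C" "Dom C b = B" "Cod C b = Dom C l" "n = l \<cdot> b" using l ab by (auto simp: sub_le_def hom_iff)
    have eq: "l \<cdot> cot a b = j \<cdot> e" unfolding j(5) using a(1-3) b(1-3) l1 by (simp add: cmp_cot a(4)[symmetric] b(4)[symmetric])
    obtain d where "d \<in> Arr C" "Dom C d = I" "Cod C d = Dom C l" "l \<cdot> d = j"
      using regular_epi_diagonal[OF i(4) l1(1) _ _ _ j(1) _ eq] a(1-3) b(1-3) e j(2) by auto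
    then show "sub_le C j l" by (intro sub_leI[of d]) (simp_all add: j)
  qed
  then have P: "?P (join C m n)" unfolding join_def by (rule someI)
  then show J: "join C m n \<in> Arr C" "Cod C (join C m n) = X" using is_mono_arr m by (auto simp: is_subobject_def)
  fix h assume h: "h \<in> Arr C" "Dom C h = X"
  show "h \<cdot> join C m n = zro (Dom C (join C m n)) (Cod C h) \<longleftrightarrow>
       h \<cdot> m = zro (Dom C m) (Cod C h) \<and> h \<cdot> n = zro (Dom C n) (Cod C h)"
  proof
    assume z: "h \<cdot> join C m n = zro (Dom C (join C m n)) (Cod C h)"
    show "h \<cdot> m = zro (Dom C m) (Cod C h) \<and> h \<cdot> n = zro (Dom C n) (Cod C h)"
      using kills_le[OF m(2) J _ h z] kills_le[OF n(2) J _ h z] P by blast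
  next
    assume z: "h \<cdot> m = zro (Dom C m) (Cod C h) \<and> h \<cdot> n = zro (Dom C n) (Cod C h)"
    obtain l L where l: "is_kernel C h l" "l \<in> Arr C" "Dom C l = L" "Cod C l = Dom C h" "L \<in> Obj C" "h \<cdot> l = zro L (Cod C h)"
      by (rule kerE[OF h(1)])
    have "is_subobject C (Cod C m) l" using l h m kernel_mono by (auto simp: is_subobject_def)
    moreover have "sub_le C m l" by (rule kernel_sub_le[OF l(1) m(2)]) (use h m z in simp_all)
    moreover have "sub_le C n l" by (rule kernel_sub_le[OF l(1) n(2)]) (use h n z in simp_all)
    ultimately have le: "sub_le C (join C m n) l" using P by blast
    show "h \<cdot> join C m n = zro (Dom C (join C m n)) (Cod C h)"
      by (rule kills_le[OF J(1) l(2) _ le h]) (use l h in simp_all)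
  qed
qed

text \<open>The kernel \<open>s\<close> of \<open>tup a b\<close> is a greatest lower bound, so the
  chosen meet exists and contains \<open>s\<close>; through this comparison it inherits the
  universal property of that kernel. In this way the tensor product is identified as a
  kernel.\<close>

lemma meet_kernels:
  assumes a: "a \<in> Arr C" "Dom C a = X" "Cod C a = A" and b: "b \<in> Arr C" "Dom C b = X" "Cod C b = B"
    and k: "is_kernel C a k" and l: "is_kernel C b l"
  obtains t where "t = meet C k l" "t \<in> Arr C" "is_mono C t" "Cod C t = X" "a \<cdot> t = zro (Dom C t) A" "b \<cdot> t = zro (Dom C t) B"
    "\<And>h. \<lbrakk>h \<in> Arr C; Cod C h = X; a \<cdot> h = zro (Dom C h) A; b \<cdot> h = zro (Dom C h) B\<rbrakk>
       \<Longrightarrow> \<exists>u \<in> hom C (Dom C h) (Dom C t). t \<cdot> u = h"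
proof -
  let ?P = "\<lambda>j. is_subobject C (Cod C k) j \<and> sub_le C j k \<and> sub_le C j l \<and>
        (\<forall>i. is_subobject C (Cod C k) i \<and> sub_le C i k \<and> sub_le C i l \<longrightarrow> sub_le C i j)"
  have o: "A \<in> Obj C" "B \<in> Obj C" "X \<in> Obj C" using a b by auto
  note kk = kernelD(2-4)[OF k] and ll = kernelD(2-4)[OF l]
  have kX: "Cod C k = X" "Cod C l = X" using kk ll a b by simp_all
  let ?t = "tup a b"
  obtain s S where s: "is_kernel C ?t s" "s \<in> Arr C" "Dom C s = S" "Cod C s = X" "S \<in> Obj C" "?t \<cdot> s = zro S (prd A B)"
    by (rule kerE[of ?t]) (use a b in simp_all)
  have "pr1 A B \<cdot> (?t \<cdot> s) = zro S A" "pr2 A B \<cdot> (?t \<cdot> s) = zro S B" unfolding s(6) using s(5) o by simp_all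
  then have st: "a \<cdot> s = zro S A" "b \<cdot> s = zro S B" using a b s(2-5) o by simp_all
  have fac: "sub_le C h s" if h: "h \<in> Arr C" "Cod C h = X" "a \<cdot> h = zro (Dom C h) A" "b \<cdot> h = zro (Dom C h) B" for h
    by (rule kernel_sub_le[OF s(1)]) (use h a b o in \<open>simp_all add: tup_zro\<close>)
  have "?P s"
  proof (intro conjI allI impI)
    show "is_subobject C (Cod C k) s" using kernel_mono[OF s(1)] s kX by (simp add: is_subobject_def)
    show "sub_le C s k" by (rule kernel_sub_le[OF k]) (use s st a in simp_all)
    show "sub_le C s l" by (rule kernel_sub_le[OF l]) (use s st b in simp_all)
    fix i assume i: "is_subobject C (Cod C k) i \<and> sub_le C i k \<and> sub_le C i l"
    then have i1: "i \<in> Arr C" "Cod C i = X" using is_mono_arr kX by (auto simp: is_subobject_def)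
    show "sub_le C i s"
      by (rule fac[OF i1]) (use kills_le[OF i1(1) kk(1) kX(1) _ a(1,2)] kills_le[OF i1(1) ll(1) kX(2) _ b(1,2)] i kk ll a b in simp_all)
  qed
  then have P: "?P (meet C k l)" unfolding meet_def by (rule someI)
  define t where "t = meet C k l"
  have t: "t \<in> Arr C" "is_mono C t" "Cod C t = X" using P is_mono_arr kX by (auto simp: is_subobject_def t_def)
  have "is_subobject C (Cod C k) s" "sub_le C s k" "sub_le C s l" using \<open>?P s\<close> by simp_all
  then have "sub_le C s t" using P by (simp add: t_def)
  then obtain v where v: "v \<in> Arr C" "Dom C v = S" "Cod C v = Dom C t" "s = t \<cdot> v" using s by (auto simp: sub_le_def hom_iff)
  show thesis
  proof (rule that[OF t_def t])
    show "a \<cdot> t = zro (Dom C t) A" using kills_le[OF t(1) kk(1) kX(1) _ a(1,2)] P kk a by (simp add: t_def)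
    show "b \<cdot> t = zro (Dom C t) B" using kills_le[OF t(1) ll(1) kX(2) _ b(1,2)] P ll b by (simp add: t_def)
    fix h assume h: "h \<in> Arr C" "Cod C h = X" "a \<cdot> h = zro (Dom C h) A" "b \<cdot> h = zro (Dom C h) B"
    obtain u where u: "u \<in> Arr C" "Dom C u = Dom C h" "Cod C u = S" "h = s \<cdot> u" using fac[OF h] s by (auto simp: sub_le_def hom_iff)
    have "t \<cdot> (v \<cdot> u) = (t \<cdot> v) \<cdot> u" using t v(1-3) u(1-3) by simp
    then have "t \<cdot> (v \<cdot> u) = h" by (simp only: v(4)[symmetric] u(4)[symmetric])
    then show "\<exists>u \<in> hom C (Dom C h) (Dom C t). t \<cdot> u = h" using u(1-3) v(1-3) by (intro bexI[of _ "v \<cdot> u"]) (simp_all add: hom_iff)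
  qed
qed

end

section \<open>The tensor product over the zero object\<close>

text \<open>It allows results proved for one of \<open>M\<close> and \<open>N\<close> to be reused
  for the other.\<close>

lemma (in category) coproduct_swap: "is_coproduct C A B i j \<Longrightarrow> is_coproduct C B A j i"
proof -
  assume co: "is_coproduct C A B i j"
  have d: "i \<in> hom C A (Cod C i)" "j \<in> hom C B (Cod C i)" using coproductD[OF co] .
  have c: "Cod C j = Cod C i" using d by (simp add: hom_iff)
  show ?thesis unfolding is_coproduct_def c
  proof (intro conjI allI ballI)
    show "\<exists>!h. h \<in> hom C (Cod C i) X \<and> h \<cdot> j = f \<and> h \<cdot> i = g" if "f \<in> hom C B X" "g \<in> hom C A X" for X f g
      using coproduct_ex1[OF co that(2,1)] by (simp add: conj_commute)
  qed (use d in simp_all)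
qed

lemma (in category) coproduct_factor:
  assumes "is_coproduct C A B i j" "f \<in> hom C A X" "g \<in> hom C B X"
  obtains h where "h \<in> hom C (Cod C i) X" "h \<cdot> i = f" "h \<cdot> j = g"
  using coproduct_ex1[OF assms] by blast

context coherent_category
begin

text \<open>\<open>coop_regular_epi\<close> removes \<open>e\<close> on one side only; symmetry
  allows it to be used twice.\<close>

lemma coop_self_regular_epi:
  assumes f: "f \<in> Arr C" "Dom C f = X" "Cod C f = Z" and e: "is_regular_epi C e" "Dom C e = X'" "Cod C e = X"
    and c: "coop (f \<cdot> e) (f \<cdot> e)"
  shows "coop f f"
proof -
  have [simp]: "e \<in> Arr C" using regular_epi_arr[OF e(1)] .
  have 1: "coop f (f \<cdot> e)" by (rule coop_regular_epi[OF f(1) _ f(2) _ f(3) _ e c]) (use f e in simp_all)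
  have 2: "coop (f \<cdot> e) f" by (rule coop_sym[OF 1 f(1) _ f(2) _ f(3)]) (use f e in simp_all)
  show ?thesis by (rule coop_regular_epi[OF f(1,1,2,2,3,3) e 2])
qed

text \<open>The kernel of \<open>M + N \<rightarrow> N\<close> is generated by \<open>M\<close> and the commutator of \<open>M\<close> and \<open>N\<close>, the latter
  being central in a two-nilpotent object.\<close>

lemma nilp2_kills_huq:
  assumes co: "is_coproduct C M N i j" and Q: "Cod C i = Q" and ab: "coop (ide M) (ide M)"
    and a: "a \<in> hom C Q M" "a \<cdot> i = ide M" "a \<cdot> j = zro N M"
    and b: "b \<in> hom C Q N" "b \<cdot> i = zro M N" "b \<cdot> j = ide N"
    and v: "is_kernel C b v" and h: "h \<in> hom C Q T" and T: "nilp2 T"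
  shows "coop (h \<cdot> v) (h \<cdot> v)"
proof -
  have ij: "i \<in> Arr C" "Dom C i = M" "Cod C i = Q" "j \<in> Arr C" "Dom C j = N" "Cod C j = Q"
    using coproductD[OF co] Q by (simp_all add: hom_iff)
  have at: "a \<in> Arr C" "Dom C a = Q" "Cod C a = M" and bt: "b \<in> Arr C" "Dom C b = Q" "Cod C b = N"
    and ht: "h \<in> Arr C" "Dom C h = Q" "Cod C h = T" using a b h by (simp_all add: hom_iff)
  have o [simp]: "M \<in> Obj C" "N \<in> Obj C" "Q \<in> Obj C" "T \<in> Obj C" using ij at bt ht by auto
  define V where "V = Dom C v"
  have vt: "v \<in> Arr C" "Dom C v = V" "Cod C v = Q" "V \<in> Obj C" and bv: "b \<cdot> v = zro V N" using kernelD[OF v] bt by (simp_all add: V_def)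
  obtain i' where i': "i' \<in> Arr C" "Dom C i' = M" "Cod C i' = V" "v \<cdot> i' = i"
    using kernel_factor[OF v ij(1)] ij bt b vt by auto
  \<comment> \<open>Inside the kernel of \<open>b\<close>, the arrow induced by \<open>a\<close> is
    split by \<open>M\<close>, so its kernel \<open>w\<close> is the part of \<open>Q\<close> killed
    by both \<open>a\<close> and \<open>b\<close>. Through \<open>\<theta>\<close>, the comparison
    with the chosen coproduct, \<open>w\<close> lands in the cosmash product.\<close>
  have pt: "is_point C (a \<cdot> v) i'" by (rule is_pointI) (use at vt i' a in simp_all)
  obtain w W where w: "is_kernel C (a \<cdot> v) w" "w \<in> Arr C" "Dom C w = W" "Cod C w = V" "W \<in> Obj C" "a \<cdot> (v \<cdot> w) = zro W M"
    by (rule kerE[of "a \<cdot> v"]) (use at vt in simp_all)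
  obtain \<theta> where "\<theta> \<in> hom C Q (cop M N)" and t2: "\<theta> \<cdot> i = in1 M N" "\<theta> \<cdot> j = in2 M N"
    by (rule coproduct_factor[OF co, of "in1 M N" "cop M N" "in2 M N"]) (simp_all add: Q hom_iff)
  then have t: "\<theta> \<in> Arr C" "Dom C \<theta> = Q" "Cod C \<theta> = cop M N" by (simp_all add: hom_iff)
  have inv: "cot i j \<cdot> \<theta> = ide Q"
    by (rule coproduct_ext[OF co]) (use t t2 ij in \<open>simp_all add: hom_iff\<close>)
  have ta: "cot (ide M) (zro N M) \<cdot> \<theta> = a"
    by (rule coproduct_ext[OF co]) (use t t2 ij a b at in \<open>simp_all add: hom_iff\<close>)
  have tb: "cot (zro M N) (ide N) \<cdot> \<theta> = b"
    by (rule coproduct_ext[OF co]) (use t t2 ij a b bt in \<open>simp_all add: hom_iff\<close>)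
  obtain x where x: "x \<in> Arr C" "Dom C x = W" "Cod C x = Dom C (cosmash C M N)" "cosmash C M N \<cdot> x = \<theta> \<cdot> (v \<cdot> w)"
    by (rule cosmash_lift[of M N "\<theta> \<cdot> (v \<cdot> w)" W])
      (use ta[THEN reassoc, of "v \<cdot> w"] tb[THEN reassoc, of "v \<cdot> w"] bv[THEN reassoc, of w] t vt w at bt in simp_all)
  have "h \<cdot> cot i j = cot (h \<cdot> i) (h \<cdot> j)" using ht ij by (simp add: cmp_cot)
  then have "cot (h \<cdot> i) (h \<cdot> j) \<cdot> (\<theta> \<cdot> (v \<cdot> w)) = h \<cdot> (cot i j \<cdot> (\<theta> \<cdot> (v \<cdot> w)))"
    using ht ij t vt w(2-5) by (simp add: cmp_cot cmp_cot')
  then have hvw: "(cot (h \<cdot> i) (h \<cdot> j) \<cdot> cosmash C M N) \<cdot> x = h \<cdot> (v \<cdot> w)"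
    using inv[THEN reassoc, of "v \<cdot> w"] ht ij t vt w(2-5) x by simp
  \<comment> \<open>Up to \<open>x\<close>, the composite \<open>h \<cdot> (v \<cdot> w)\<close> is
    a commutator in the two-nilpotent \<open>T\<close>.\<close>
  have central: "coop (h \<cdot> (v \<cdot> w)) z" if z: "z \<in> Arr C" "Cod C z = T" for z
  proof -
    have c: "coop (cot (h \<cdot> i) (h \<cdot> j) \<cdot> cosmash C M N) z"
      by (rule nilp2_commutator_central[OF T, of _ M _ N _ "Dom C z"]) (use ht ij z in simp_all)
    have "coop ((cot (h \<cdot> i) (h \<cdot> j) \<cdot> cosmash C M N) \<cdot> x) (z \<cdot> ide (Dom C z))"
      by (rule coop_precmp[OF c, of "Dom C (cosmash C M N)" "Dom C z" T]) (use ht ij z x(1-3) in simp_all)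
    then show ?thesis unfolding hvw using z by simp
  qed
  let ?a = "h \<cdot> i" and ?b = "h \<cdot> (v \<cdot> w)"
  have ty: "?a \<in> Arr C" "Dom C ?a = M" "Cod C ?a = T" "?b \<in> Arr C" "Dom C ?b = W" "Cod C ?b = T"
    using ht ij vt w(2-5) by simp_all
  have "coop (?a \<cdot> ide M) (?a \<cdot> ide M)"
    by (rule coop_postcmp[OF ab, of M M M]) (use ht ij in simp_all)
  then have aa: "coop ?a ?a" using ht ij by simp
  have bb: "coop ?b ?b" and ba: "coop ?b ?a" by (rule central; use ty in simp)+
  have abc: "coop ?a ?b" by (rule coop_sym[OF ba ty(4,1,5,2,6,3)])
  define g where "g = cot ?a ?b"
  have g: "g \<in> Arr C" "Dom C g = cop M W" "Cod C g = T" unfolding g_def using ty by simp_all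
  \<comment> \<open>Both \<open>?a\<close> and \<open>?b\<close> cooperate with themselves and with
    each other; coherence applied in each argument in turn makes their cotuple cooperate with
    itself.\<close>
  have ag: "coop ?a g" and bg: "coop ?b g" unfolding g_def
    by (rule coop_cot[OF ty(1-3) ty(1-3) ty(4-6) aa abc], rule coop_cot[OF ty(4-6) ty(1-3) ty(4-6) ba bb])
  have "coop g (cot ?a ?b)"
    by (rule coop_cot[OF g ty coop_sym[OF ag ty(1) g(1) ty(2) g(2) ty(3) g(3)] coop_sym[OF bg ty(4) g(1) ty(5) g(2) ty(6) g(3)]])
  then have gg: "coop g g" by (simp only: g_def)
  \<comment> \<open>The section \<open>i'\<close> and the kernel \<open>w\<close> generate the
    domain of the point \<open>(a \<cdot> v, i')\<close>.\<close>
  have e: "is_regular_epi C (cot i' w)"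
  proof (rule regular_epiI)
    fix m y assume m: "is_mono C m" "Cod C m = Cod C (cot i' w)" and y: "y \<in> Arr C" "Dom C m = Cod C y" "Dom C y = Dom C (cot i' w)" "m \<cdot> y = cot i' w"
    define Y where "Y = Cod C y"
    have mt: "m \<in> Arr C" "Dom C m = Y" "Cod C m = V" and yt: "y \<in> Arr C" "Cod C y = Y" "Dom C y = cop M W"
      using is_mono_arr[OF m(1)] m(2) y(1-3) i' w(2-5) by (simp_all add: Y_def)
    have "m \<cdot> (y \<cdot> in1 M W) = i'" "m \<cdot> (y \<cdot> in2 M W) = w"
      using y(4)[THEN reassoc, of "in1 M W"] y(4)[THEN reassoc, of "in2 M W"] mt yt i'(1-3) w(2-5) by simp_all
    then show "is_iso C m"
      by (intro mono_kernel_section_iso[OF pt w(1) m(1), of "y \<cdot> in2 M W" "y \<cdot> in1 M W"]) (use mt yt vt at i'(1-3) w(2-5) in simp_all)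
  qed (use i' w(2-5) in simp)
  have "(h \<cdot> v) \<cdot> cot i' w = g" unfolding g_def using ht vt i' w(2-5) by (simp add: cmp_cot cmp_cot')
  then show ?thesis
    by (intro coop_self_regular_epi[of "h \<cdot> v" V T "cot i' w" "cop M W"]) (use ht vt i' w(2-5) e gg in simp_all)
qed

text \<open>Pulling \<open>q\<close> back along \<open>v'\<close> covers the kernel of
  \<open>b'\<close> by a regular epimorphism \<open>y\<close>, and the other projection lies in the
  kernel of \<open>b\<close>. So \<open>v' \<cdot> y\<close> factors through
  \<open>q \<cdot> v\<close>, and self-cooperation descends along \<open>y\<close>.\<close>

lemma coop_kernel_of_quotient:
  assumes q: "is_regular_epi C q" "Dom C q = Q" "Cod C q = R" and b: "b \<in> Arr C" "Dom C b = Q" "Cod C b = N"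
    and b': "b' \<in> Arr C" "Dom C b' = R" "Cod C b' = N" "b' \<cdot> q = b" and v: "is_kernel C b v" and v': "is_kernel C b' v'"
    and c: "coop (q \<cdot> v) (q \<cdot> v)"
  shows "coop v' v'"
proof -
  have qa: "q \<in> Arr C" by (rule regular_epi_arr[OF q(1)])
  have o [simp]: "N \<in> Obj C" "R \<in> Obj C" "Q \<in> Obj C" using b b' by auto
  define V V' where "V = Dom C v" and "V' = Dom C v'"
  have vt: "v \<in> Arr C" "Dom C v = V" "Cod C v = Q" "V \<in> Obj C" using kernelD[OF v] b by (simp_all add: V_def)
  have vt': "v' \<in> Arr C" "Dom C v' = V'" "Cod C v' = R" "V' \<in> Obj C" "b' \<cdot> v' = zro V' N" using kernelD[OF v'] b' by (simp_all add: V'_def)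
  obtain x y P where pb: "is_pullback C q v' x y" and xy: "x \<in> Arr C" "y \<in> Arr C" "Dom C x = P" "Dom C y = P"
    "Cod C x = Q" "Cod C y = V'" "P \<in> Obj C" "q \<cdot> x = v' \<cdot> y"
    by (rule pullbackE[of q v']) (use qa q vt' in simp_all)
  have ye: "is_regular_epi C y" by (rule regular_epi_pullback[OF pb q(1)])
  have "(b' \<cdot> q) \<cdot> x = zro P N" using vt'(5)[THEN reassoc, of y] qa q(2,3) xy b'(1-3) vt'(1-4) by simp
  then obtain z where z: "z \<in> Arr C" "Dom C z = P" "Cod C z = V" "v \<cdot> z = x"
    using kernel_factor[OF v xy(1)] xy b vt b'(4) by auto
  have eq: "(q \<cdot> v) \<cdot> z = v' \<cdot> y" using z xy(8) qa q(2,3) vt by simp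
  have "coop ((q \<cdot> v) \<cdot> z) ((q \<cdot> v) \<cdot> z)"
    by (rule coop_precmp[OF c, of V V R]) (use qa q(2,3) vt z in simp_all)
  then show ?thesis unfolding eq by (intro coop_self_regular_epi[OF vt'(1-3) ye xy(4,6)])
qed

text \<open>The kernel \<open>d\<close> of \<open>tup a' b'\<close> lies in the kernels of both
  \<open>a'\<close> and \<open>b'\<close>. The first of these contains \<open>q \<cdot> j\<close>,
  the second \<open>q \<cdot> i\<close>, and each cooperates with itself. So \<open>d\<close>
  cooperates with both generators of \<open>R\<close>, by coherence with \<open>q\<close>, and then
  with the identity of \<open>R\<close> because \<open>q\<close> is a regular epimorphism.\<close>

lemma quotient_nilp2:
  assumes co: "is_coproduct C M N i j" and Q: "Cod C i = Q" and abM: "coop (ide M) (ide M)" and abN: "coop (ide N) (ide N)"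
    and q: "is_regular_epi C q" "Dom C q = Q" "Cod C q = R"
    and a: "a \<in> hom C Q M" "a \<cdot> i = ide M" "a \<cdot> j = zro N M"
    and b: "b \<in> hom C Q N" "b \<cdot> i = zro M N" "b \<cdot> j = ide N"
    and a': "a' \<in> hom C R M" "a' \<cdot> q = a" and b': "b' \<in> hom C R N" "b' \<cdot> q = b"
    and u: "is_kernel C a u" "coop (q \<cdot> u) (q \<cdot> u)" and v: "is_kernel C b v" "coop (q \<cdot> v) (q \<cdot> v)"
  shows "nilp2 R"
proof -
  have ij: "i \<in> Arr C" "Dom C i = M" "Cod C i = Q" "j \<in> Arr C" "Dom C j = N" "Cod C j = Q"
    using coproductD[OF co] Q by (simp_all add: hom_iff)
  have qa: "q \<in> Arr C" by (rule regular_epi_arr[OF q(1)])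
  have t: "a \<in> Arr C" "Dom C a = Q" "Cod C a = M" "b \<in> Arr C" "Dom C b = Q" "Cod C b = N"
     "a' \<in> Arr C" "Dom C a' = R" "Cod C a' = M" "b' \<in> Arr C" "Dom C b' = R" "Cod C b' = N" using a b a' b' by (simp_all add: hom_iff)
  have o [simp]: "M \<in> Obj C" "N \<in> Obj C" "Q \<in> Obj C" "R \<in> Obj C" using t by auto
  let ?p = "tup a' b'"
  obtain d D where d: "is_kernel C ?p d" "d \<in> Arr C" "Dom C d = D" "Cod C d = R" "D \<in> Obj C" "?p \<cdot> d = zro D (prd M N)"
    by (rule kerE[of ?p]) (use t in simp_all)
  have "pr1 M N \<cdot> (?p \<cdot> d) = zro D M" "pr2 M N \<cdot> (?p \<cdot> d) = zro D N" unfolding d(6) using d(5) by simp_all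
  then have ad: "a' \<cdot> d = zro D M" "b' \<cdot> d = zro D N" using t d(2-5) by simp_all
  \<comment> \<open>A common pattern for \<open>a\<close> and \<open>b\<close>: \<open>d\<close> and
    \<open>q \<cdot> k\<close> both factor through the kernel \<open>w'\<close> of
    \<open>x'\<close>, which cooperates with itself.\<close>
  have sub: "coop d (q \<cdot> k)" if x: "x \<in> Arr C" "Dom C x = Q" "Cod C x = X" "x' \<in> Arr C" "Dom C x' = R" "Cod C x' = X" "x' \<cdot> q = x"
      "is_kernel C x w" "coop (q \<cdot> w) (q \<cdot> w)" and k: "k \<in> Arr C" "Cod C k = Q" "x \<cdot> k = zro (Dom C k) X" "x' \<cdot> d = zro D X" for k x x' w X
  proof -
    obtain w' W where w': "is_kernel C x' w'" "w' \<in> Arr C" "Dom C w' = W" "Cod C w' = Dom C x'" "W \<in> Obj C"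
      by (rule kerE[OF x(4)])
    have c: "coop w' w'" by (rule coop_kernel_of_quotient[OF q x(1-8) w'(1) x(9)])
    obtain y where y: "y \<in> Arr C" "Dom C y = D" "Cod C y = W" "w' \<cdot> y = d"
      using kernel_factor[OF w'(1) d(2)] d(3,4) x(5,6) k(4) w'(3) by auto
    have "x' \<cdot> (q \<cdot> k) = zro (Dom C k) X" using x(7)[THEN reassoc, of k] qa q(2,3) x(4,5) k by simp
    then obtain z where z: "z \<in> Arr C" "Dom C z = Dom C k" "Cod C z = W" "w' \<cdot> z = q \<cdot> k"
      using kernel_factor[OF w'(1), of "q \<cdot> k"] qa q(2,3) x(5,6) k(1,2) w'(3) by auto
    have "coop (w' \<cdot> y) (w' \<cdot> z)" by (rule coop_precmp[OF c, of W W R]) (use w'(2-5) x(5) y z in simp_all)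
    then show ?thesis by (simp only: y(4) z(4))
  qed
  have di: "coop d (q \<cdot> i)" by (rule sub[OF t(4-6) t(10-12) b'(2) v]) (use ij b ad in simp_all)
  have dj: "coop d (q \<cdot> j)" by (rule sub[OF t(1-3) t(7-9) a'(2) u]) (use ij a ad in simp_all)
  have c1: "coop d (cot (q \<cdot> i) (q \<cdot> j))"
    by (rule coop_cot[OF d(2-4), of _ M _ N]) (use qa q(2,3) ij di dj in simp_all)
  obtain \<theta> where "\<theta> \<in> hom C Q (cop M N)" and t2: "\<theta> \<cdot> i = in1 M N" "\<theta> \<cdot> j = in2 M N"
    by (rule coproduct_factor[OF co, of "in1 M N" "cop M N" "in2 M N"]) (simp_all add: Q hom_iff)
  then have th: "\<theta> \<in> Arr C" "Dom C \<theta> = Q" "Cod C \<theta> = cop M N" by (simp_all add: hom_iff)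
  have "cot (q \<cdot> i) (q \<cdot> j) \<cdot> \<theta> = q"
    by (rule coproduct_ext[OF co]) (use th t2 ij qa q(2,3) in \<open>simp_all add: hom_iff\<close>)
  then have "coop (d \<cdot> ide D) q"
    using coop_precmp[OF c1 d(2) _ d(3) _ d(4), of "cop M N" "ide D" \<theta>] th ij qa q(2,3) d(5) by simp
  then have "coop d q" using d by simp
  then have qd: "coop (ide R \<cdot> q) d" using coop_sym[of d q D Q R] d(2-4) qa q(2,3) by simp
  have "coop (ide R) d" by (rule coop_regular_epi[OF _ d(2) _ d(3) _ d(4) q qd]) simp_all
  then show ?thesis
    by (intro central_extension_nilp2[of ?p R "prd M N" d, OF _ _ _ d(1) _ self_coop_product[OF o(1) abM o(2) abN]]) (use t in simp_all)
qed

text \<open>The outcome is phrased inside \<open>C\<close>: \<open>R\<close> has the universal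
  property of the coproduct against two-nilpotent objects, and \<open>t\<close> is a kernel of the
  pair \<open>a\<close>, \<open>b\<close>. The core is thereby kept out of the analysis of the
  quotient.\<close>

lemma tensor_over_zero:
  assumes M: "M \<in> Obj C" "coop (ide M) (ide M)" and N: "N \<in> Obj C" "coop (ide N) (ide N)"
  obtains R i j a b t where "nilp2 R" "i \<in> hom C M R" "j \<in> hom C N R" "a \<in> hom C R M" "b \<in> hom C R N"
    "a \<cdot> i = ide M" "a \<cdot> j = zro N M" "b \<cdot> i = zro M N" "b \<cdot> j = ide N"
    "\<And>T f g. \<lbrakk>nilp2 T; f \<in> hom C M T; g \<in> hom C N T\<rbrakk> \<Longrightarrow> \<exists>!h. h \<in> hom C R T \<and> h \<cdot> i = f \<and> h \<cdot> j = g"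
    "Dom C t = tensor C (groupoid_over_zero C M) (groupoid_over_zero C N)" "is_mono C t" "Cod C t = R"
    "a \<cdot> t = zro (Dom C t) M" "b \<cdot> t = zro (Dom C t) N"
    "\<And>h. \<lbrakk>h \<in> Arr C; Cod C h = R; a \<cdot> h = zro (Dom C h) M; b \<cdot> h = zro (Dom C h) N\<rbrakk> \<Longrightarrow> \<exists>u \<in> hom C (Dom C h) (Dom C t). t \<cdot> u = h"
proof -
  note [simp] = M(1) N(1)
  let ?Z = "zero_ob C"
  let ?zM = "zro ?Z M" and ?zN = "zro ?Z N"
  define i where "i = fst (pushout_cocone C ?zM ?zN)"
  define j where "j = snd (pushout_cocone C ?zM ?zN)"
  \<comment> \<open>Arrows out of the zero object agree, so the pushout condition is void: the
    chosen pushout is a coproduct, though possibly not the one chosen by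
    \<open>coprod_cocone\<close>.\<close>
  have zz: "u \<cdot> ?zM = v \<cdot> ?zN" if "u \<in> hom C M X" "v \<in> hom C N X" for u v X
    using that by (simp add: hom_iff)
  have pu: "is_pushout C ?zM ?zN (in1 M N) (in2 M N)"
    unfolding is_pushout_def
  proof (intro conjI allI ballI impI)
    show "\<exists>!h. h \<in> hom C (Cod C (in1 M N)) X \<and> h \<cdot> in1 M N = u \<and> h \<cdot> in2 M N = v"
      if "u \<in> hom C (Cod C ?zM) X" "v \<in> hom C (Cod C ?zN) X" for X u v
      by (rule coproduct_ex1[OF inj_coproduct[of M N]]) (use that in simp_all)
  qed (simp_all add: hom_iff)
  have "case pushout_cocone C ?zM ?zN of (i, j) \<Rightarrow> is_pushout C ?zM ?zN i j"
    unfolding pushout_cocone_def by (rule someI[of _ "(in1 M N, in2 M N)"]) (simp add: pu)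
  then have po: "is_pushout C ?zM ?zN i j" by (simp add: i_def j_def case_prod_beta)
  have co: "is_coproduct C M N i j" unfolding is_coproduct_def
  proof (intro conjI allI ballI)
    show "i \<in> hom C M (Cod C i)" "j \<in> hom C N (Cod C i)" using po by (simp_all add: is_pushout_def)
    have "\<forall>X. \<forall>u \<in> hom C (Cod C ?zM) X. \<forall>v \<in> hom C (Cod C ?zN) X.
        u \<cdot> ?zM = v \<cdot> ?zN \<longrightarrow> (\<exists>!h. h \<in> hom C (Cod C i) X \<and> h \<cdot> i = u \<and> h \<cdot> j = v)"
      using po unfolding is_pushout_def by (elim conjE)
    then show "\<exists>!h. h \<in> hom C (Cod C i) X \<and> h \<cdot> i = u \<and> h \<cdot> j = v" if "u \<in> hom C M X" "v \<in> hom C N X" for X u v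
      using that zz[OF that] by simp
  qed
  define Q where "Q = Cod C i"
  have ij: "i \<in> Arr C" "Dom C i = M" "Cod C i = Q" "j \<in> Arr C" "Dom C j = N" "Cod C j = Q"
    using coproductD[OF co] by (simp_all add: hom_iff Q_def)
  have [simp]: "Q \<in> Obj C" using ij by auto
  define a where "a = (THE h. h \<in> hom C Q M \<and> h \<cdot> i = ide M \<and> h \<cdot> j = zro N M)"
  define b where "b = (THE h. h \<in> hom C Q N \<and> h \<cdot> i = zro M N \<and> h \<cdot> j = ide N)"
  have a: "a \<in> hom C Q M" "a \<cdot> i = ide M" "a \<cdot> j = zro N M"
    using theI'[OF coproduct_ex1[OF co, of "ide M" M "zro N M"]] unfolding a_def Q_def by (simp_all add: hom_iff)
  have b: "b \<in> hom C Q N" "b \<cdot> i = zro M N" "b \<cdot> j = ide N"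
    using theI'[OF coproduct_ex1[OF co, of "zro M N" N "ide N"]] unfolding b_def Q_def by (simp_all add: hom_iff)
  have at: "a \<in> Arr C" "Dom C a = Q" "Cod C a = M" and bt: "b \<in> Arr C" "Dom C b = Q" "Cod C b = N"
    using a b by (simp_all add: hom_iff)
  \<comment> \<open>Over the zero object domain and codomain of a groupoid are the same zero arrow.
    Hence \<open>d_U = c_U = a\<close> and \<open>d_L = c_L = b\<close>, and what is divided out are
    the Huq commutators of the kernels \<open>u\<close> and \<open>v\<close> with
    themselves.\<close>
  define u v where "u = ker a" and "v = ker b"
  have u: "is_kernel C a u" and v: "is_kernel C b v" unfolding u_def v_def using at bt by (simp_all add: ker_is_kernel)
  define U V where "U = Dom C u" and "V = Dom C v"
  have ut: "u \<in> Arr C" "Dom C u = U" "Cod C u = Q" "a \<cdot> u = zro U M" "U \<in> Obj C"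
    and vt: "v \<in> Arr C" "Dom C v = V" "Cod C v = Q" "b \<cdot> v = zro V N" "V \<in> Obj C"
    using kernelD[OF u] kernelD[OF v] at bt by (simp_all add: U_def V_def)
  define q where "q = cokernel C (join C (huq C v v) (huq C u u))"
  note hv = huq_props[OF vt(1-3) vt(1-3)] and hu = huq_props[OF ut(1-3) ut(1-3)]
  note jn = join_props[OF hv(2,1,3) hu(2,1,3)]
  have q: "is_cokernel C (join C (huq C v v) (huq C u u)) q" unfolding q_def by (rule cokernel_cokernel[OF jn(1)])
  define R where "R = Cod C q"
  have qe: "is_regular_epi C q" by (rule cokernel_regular_epi[OF q])
  have qt: "q \<in> Arr C" "Dom C q = Q" "Cod C q = R" using cokernelD[OF q] jn by (simp_all add: R_def)
  have [simp]: "R \<in> Obj C" using qt by auto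
  have "q \<cdot> join C (huq C v v) (huq C u u) = zro (Dom C (join C (huq C v v) (huq C u u))) (Cod C q)" using cokernelD[OF q] by simp
  then have qc: "coop (q \<cdot> v) (q \<cdot> v)" "coop (q \<cdot> u) (q \<cdot> u)"
    using jn(3)[OF qt(1,2)] hv(4)[OF qt(1,2)] hu(4)[OF qt(1,2)] by simp_all
  \<comment> \<open>The universal property of the quotient in terms of cooperation: \<open>h\<close>
    descends as soon as its restrictions to both kernels cooperate with themselves.\<close>
  have desc: "\<exists>h' \<in> hom C R X. h' \<cdot> q = h" if h: "h \<in> hom C Q X" "coop (h \<cdot> v) (h \<cdot> v)" "coop (h \<cdot> u) (h \<cdot> u)" for h X
  proof -
    have ht: "h \<in> Arr C" "Dom C h = Q" "Cod C h = X" using h by (simp_all add: hom_iff)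
    have "h \<cdot> join C (huq C v v) (huq C u u) = zro (Dom C (join C (huq C v v) (huq C u u))) (Cod C h)"
      using jn(3)[OF ht(1,2)] hv(4)[OF ht(1,2)] hu(4)[OF ht(1,2)] h(2,3) by simp
    then obtain h' where "h' \<in> Arr C" "Dom C h' = Cod C q" "Cod C h' = Cod C h" "h' \<cdot> q = h"
      by (rule cokernel_factor[OF q ht(1), rotated]) (use ht jn in simp_all)
    then show ?thesis using ht by (auto simp: hom_iff R_def)
  qed
  have zc: "coop (zro X A) (zro X A)" if "X \<in> Obj C" "A \<in> Obj C" for X A
    by (rule coopI[of _ _ X X A "zro (prd X X) A"]) (use that in simp_all)
  have abz: "coop (ide A \<cdot> x) (ide A \<cdot> x)" if "coop (ide A) (ide A)" "x \<in> Arr C" "Cod C x = A" "A \<in> Obj C" for A x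
    by (rule coop_precmp[OF that(1), of A A A]) (use that in simp_all)
  \<comment> \<open>For \<open>a\<close>, the restriction to its own kernel \<open>u\<close> is
    zero, and the restriction to \<open>v\<close> takes values in the abelian object
    \<open>M\<close>. For \<open>b\<close> the two roles are exchanged.\<close>
  have "\<exists>h' \<in> hom C R M. h' \<cdot> q = a"
    by (rule desc[OF a(1)]) (use abz[OF M(2), of "a \<cdot> v"] zc[of U M] ut vt at in simp_all)
  then obtain a' where a': "a' \<in> hom C R M" "a' \<cdot> q = a" by blast
  have "\<exists>h' \<in> hom C R N. h' \<cdot> q = b"
    by (rule desc[OF b(1)]) (use abz[OF N(2), of "b \<cdot> u"] zc[of V N] ut vt bt in simp_all)
  then obtain b' where b': "b' \<in> hom C R N" "b' \<cdot> q = b" by blast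
  have at': "a' \<in> Arr C" "Dom C a' = R" "Cod C a' = M" and bt': "b' \<in> Arr C" "Dom C b' = R" "Cod C b' = N"
    using a' b' by (simp_all add: hom_iff)
  have qep: "epic C q" by (rule regular_epi_epic[OF qe])
  have "descend_along C q a = a'" unfolding descend_along_def
  proof (rule the_equality)
    show "a' \<in> hom C (Cod C q) (Cod C a) \<and> a' \<cdot> q = a" using a' qt at by simp
    show "x = a'" if "x \<in> hom C (Cod C q) (Cod C a) \<and> x \<cdot> q = a" for x
      by (rule epic_cancel[OF qep]) (use that a' qt at at' in \<open>simp_all add: hom_iff\<close>)
  qed
  moreover have "descend_along C q b = b'" unfolding descend_along_def
  proof (rule the_equality)
    show "b' \<in> hom C (Cod C q) (Cod C b) \<and> b' \<cdot> q = b" using b' qt bt by simp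
    show "x = b'" if "x \<in> hom C (Cod C q) (Cod C b) \<and> x \<cdot> q = b" for x
      by (rule epic_cancel[OF qep]) (use that b' qt bt bt' in \<open>simp_all add: hom_iff\<close>)
  qed
  moreover have "tensor C (groupoid_over_zero C M) (groupoid_over_zero C N) =
    Dom C (meet C (ker (descend_along C q a)) (ker (descend_along C q b)))"
    unfolding q_def u_def v_def a_def b_def Q_def
    by (simp add: tensor_def groupoid_over_zero_def Let_def i_def[symmetric] j_def[symmetric])
  ultimately have tens: "tensor C (groupoid_over_zero C M) (groupoid_over_zero C N) = Dom C (meet C (ker a') (ker b'))"
    by simp
  obtain t where t: "t = meet C (ker a') (ker b')" "t \<in> Arr C" "is_mono C t" "Cod C t = R" "a' \<cdot> t = zro (Dom C t) M" "b' \<cdot> t = zro (Dom C t) N"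
    and tfac: "\<And>h. \<lbrakk>h \<in> Arr C; Cod C h = R; a' \<cdot> h = zro (Dom C h) M; b' \<cdot> h = zro (Dom C h) N\<rbrakk>
       \<Longrightarrow> \<exists>u \<in> hom C (Dom C h) (Dom C t). t \<cdot> u = h"
    by (rule meet_kernels[OF at' bt' ker_is_kernel[OF at'(1)] ker_is_kernel[OF bt'(1)]]) (rule that, assumption+)
  have R: "nilp2 R"
    by (rule quotient_nilp2[OF co ij(3) M(2) N(2) qe qt(2,3) a b a' b' u qc(2) v qc(1)])
  have cop: "\<exists>!h. h \<in> hom C R T \<and> h \<cdot> (q \<cdot> i) = f \<and> h \<cdot> (q \<cdot> j) = g"
    if T: "nilp2 T" and fg: "f \<in> hom C M T" "g \<in> hom C N T" for T f g
  proof -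
    obtain h where h: "h \<in> hom C Q T" "h \<cdot> i = f" "h \<cdot> j = g"
      using coproduct_factor[OF co fg] unfolding Q_def by blast
    have hv: "coop (h \<cdot> v) (h \<cdot> v)" by (rule nilp2_kills_huq[OF co ij(3) M(2) a b v h(1) T])
    \<comment> \<open>The same statement with \<open>M\<close> and \<open>N\<close> exchanged,
      whence the swapped coproduct and the permuted equations for \<open>a\<close> and
      \<open>b\<close>.\<close>
    have hu: "coop (h \<cdot> u) (h \<cdot> u)" by (rule nilp2_kills_huq[OF coproduct_swap[OF co] ij(6) N(2) b(1,3,2) a(1,3,2) u h(1) T])
    obtain h' where h': "h' \<in> hom C R T" "h' \<cdot> q = h" using desc[OF h(1) hv hu] by blast
    have r: "x \<cdot> (q \<cdot> y) = (x \<cdot> q) \<cdot> y" if "x \<in> hom C R T" "y \<in> Arr C" "Cod C y = Q" for x y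
      using that qt by (simp add: hom_iff)
    show ?thesis
    proof (rule ex1I)
      show "h' \<in> hom C R T \<and> h' \<cdot> (q \<cdot> i) = f \<and> h' \<cdot> (q \<cdot> j) = g"
        using h h' by (simp add: r[OF h'(1)] ij)
      fix x assume x: "x \<in> hom C R T \<and> x \<cdot> (q \<cdot> i) = f \<and> x \<cdot> (q \<cdot> j) = g"
      then have "(x \<cdot> q) \<cdot> i = h \<cdot> i" "(x \<cdot> q) \<cdot> j = h \<cdot> j" using h by (simp_all add: r[symmetric] ij del: assoc)
      then have "x \<cdot> q = h" by (rule coproduct_ext[OF co, rotated 2]) (use x h ij qt in \<open>simp_all add: hom_iff\<close>)
      then have e: "x \<cdot> q = h' \<cdot> q" using h' by simp
      show "x = h'" by (rule epic_cancel[OF qep e]) (use x h' qt in \<open>simp_all add: hom_iff\<close>)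
    qed
  qed
  show thesis
  proof (rule that[OF R _ _ a'(1) b'(1) _ _ _ _ cop _ t(3,4,5,6) tfac])
    show "a' \<cdot> (q \<cdot> i) = ide M" "a' \<cdot> (q \<cdot> j) = zro N M"
      using a'(2)[THEN reassoc, of i] a'(2)[THEN reassoc, of j] a at' qt ij by simp_all
    show "b' \<cdot> (q \<cdot> i) = zro M N" "b' \<cdot> (q \<cdot> j) = ide N"
      using b'(2)[THEN reassoc, of i] b'(2)[THEN reassoc, of j] b bt' qt ij by simp_all
    show "Dom C t = tensor C (groupoid_over_zero C M) (groupoid_over_zero C N)" by (simp only: tens t(1))
  qed (use qt ij in \<open>simp_all add: hom_iff\<close>)
qed

end

section \<open>The two-nilpotent core\<close>

lemma full_subcat_simps [simp]:
  "Dom (full_subcat C S) = Dom C" "Cod (full_subcat C S) = Cod C" "Ide (full_subcat C S) = Ide C" "Cmp (full_subcat C S) = Cmp C"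
  by (simp_all add: full_subcat_def)

context semi_abelian_category
begin

lemma nil2_simps:
  "Dom (nil2 C) = Dom C" "Cod (nil2 C) = Cod C" "Ide (nil2 C) = Ide C" "Cmp (nil2 C) = Cmp C"
  by (simp_all add: nil2_def)

lemma nil2_Obj: "Obj (nil2 C) = {T. nilp2 T}"
  using nilp2_iff nilp2_obj by (auto simp: nil2_def full_subcat_def)

lemma nil2_Arr: "Arr (nil2 C) = {f \<in> Arr C. nilp2 (Dom C f) \<and> nilp2 (Cod C f)}"
  using nilp2_iff by (auto simp: nil2_def full_subcat_def)

lemma nil2_hom: "f \<in> hom (nil2 C) A B \<longleftrightarrow> f \<in> hom C A B \<and> nilp2 A \<and> nilp2 B"
  by (auto simp: hom_def nil2_Arr nil2_simps)

lemma nil2_category: "category (nil2 C)"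
proof
  show "g \<cdot>\<^bsub>nil2 C\<^esub> f \<in> hom (nil2 C) A D" if "f \<in> hom (nil2 C) A B" "g \<in> hom (nil2 C) B D" for f g A B D
    using that cmp_in_hom by (auto simp: nil2_hom nil2_simps)
  show "(h \<cdot>\<^bsub>nil2 C\<^esub> g) \<cdot>\<^bsub>nil2 C\<^esub> f = h \<cdot>\<^bsub>nil2 C\<^esub> (g \<cdot>\<^bsub>nil2 C\<^esub> f)"
    if "f \<in> hom (nil2 C) A B" "g \<in> hom (nil2 C) B D" "h \<in> hom (nil2 C) D E" for f g h A B D E
    using that by (auto simp: nil2_hom nil2_simps hom_iff)
qed (auto simp: nil2_hom nil2_simps nil2_Obj nil2_Arr hom_iff)

lemma nil2_zero: "is_zero (nil2 C) (zero_ob C)"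
  using zero_ob nilp2_zero[OF zero_ob] nilp2_obj
  unfolding is_zero_def is_initial_def is_terminal_def by (simp add: nil2_Obj nil2_hom)

text \<open>The zero object of \<open>C\<close> is two-nilpotent, so it is a zero object of the
  core, and zero arrows factor through it in both categories.\<close>

lemma nil2_zro:
  assumes "nilp2 A" "nilp2 B" shows "zero_arr (nil2 C) A B = zro A B"
proof -
  have [simp]: "A \<in> Obj C" "B \<in> Obj C" using assms by simp_all
  have "zero_arr (nil2 C) A B = zro (zero_ob C) B \<cdot>\<^bsub>nil2 C\<^esub> zro A (zero_ob C)"
    by (rule category.zero_arr_eq[OF nil2_category nil2_zero]) (use assms nilp2_zero[OF zero_ob] zro_hom in \<open>simp_all add: nil2_hom\<close>)
  then show ?thesis by (simp add: nil2_simps)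
qed

text \<open>The domain of a kernel is a subobject of a two-nilpotent object, so the kernel formed in
  \<open>C\<close> already lies in the full subcategory.\<close>

lemma nil2_kernel:
  assumes f: "f \<in> Arr (nil2 C)" and k: "is_kernel C f k"
  shows "is_kernel (nil2 C) f k"
proof -
  note d = kernelD[OF k]
  have n: "nilp2 (Dom C f)" "nilp2 (Cod C f)" using f by (simp_all add: nil2_Arr)
  have nk: "nilp2 (Dom C k)" by (rule nilp2_mono[OF n(1) kernel_mono[OF k] d(3) refl])
  show ?thesis unfolding is_kernel_def nil2_simps
  proof (intro conjI allI ballI impI)
    show "f \<cdot> k = zero_arr (nil2 C) (Dom C k) (Cod C f)" using d nk n by (simp add: nil2_zro)
    fix X h assume h: "h \<in> hom (nil2 C) X (Dom C f)" and z: "f \<cdot> h = zero_arr (nil2 C) X (Cod C f)"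
    then have "h \<in> hom C X (Dom C f)" "f \<cdot> h = zro X (Cod C f)" using n by (simp_all add: nil2_hom nil2_zro)
    then have "\<exists>!u. u \<in> hom C X (Dom C k) \<and> k \<cdot> u = h" using k unfolding is_kernel_def by simp
    then show "\<exists>!u. u \<in> hom (nil2 C) X (Dom C k) \<and> k \<cdot> u = h" using h nk by (simp add: nil2_hom)
  qed (use d f nk n in \<open>simp_all add: nil2_hom hom_iff\<close>)
qed

lemma nil2_product:
  assumes "nilp2 A" "nilp2 B" shows "is_product (nil2 C) A B (pr1 A B) (pr2 A B)"
proof -
  have o [simp]: "A \<in> Obj C" "B \<in> Obj C" using assms by simp_all
  show ?thesis unfolding is_product_def nil2_simps
  proof (intro conjI allI ballI)
    show "\<exists>!h. h \<in> hom (nil2 C) X (Dom C (pr1 A B)) \<and> pr1 A B \<cdot> h = f \<and> pr2 A B \<cdot> h = g"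
      if "f \<in> hom (nil2 C) X A" "g \<in> hom (nil2 C) X B" for X f g
      using product_ex1[OF proj_product[OF o], of f X g] that nilp2_product[OF assms] by (simp add: nil2_hom)
  qed (use assms nilp2_product[OF assms] in \<open>simp_all add: nil2_hom hom_iff\<close>)
qed

text \<open>The cosmash product of the core is built from choices made in \<open>nil2 C\<close>,
  which need not be the product chosen in \<open>C\<close> nor the coproduct \<open>R\<close>. The
  isomorphism \<open>\<theta>\<close> between the two coproducts carries \<open>a\<close>,
  \<open>b\<close> to the components of \<open>\<sigma>\<close>, so \<open>t\<close> and
  \<open>\<kappa>\<close> are kernels of the same arrow up to isomorphism.\<close>

lemma cosmash_nil2:
  assumes n: "nilp2 M" "nilp2 N" and R: "nilp2 R"
    and ij: "i \<in> hom C M R" "j \<in> hom C N R" and ab: "a \<in> hom C R M" "b \<in> hom C R N"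
    and e: "a \<cdot> i = ide M" "a \<cdot> j = zro N M" "b \<cdot> i = zro M N" "b \<cdot> j = ide N"
    and cop: "\<And>T f g. \<lbrakk>nilp2 T; f \<in> hom C M T; g \<in> hom C N T\<rbrakk> \<Longrightarrow> \<exists>!h. h \<in> hom C R T \<and> h \<cdot> i = f \<and> h \<cdot> j = g"
    and t: "is_mono C t" "Cod C t = R" "a \<cdot> t = zro (Dom C t) M" "b \<cdot> t = zro (Dom C t) N"
    and tfac: "\<And>h. \<lbrakk>h \<in> Arr C; Cod C h = R; a \<cdot> h = zro (Dom C h) M; b \<cdot> h = zro (Dom C h) N\<rbrakk> \<Longrightarrow> \<exists>u \<in> hom C (Dom C h) (Dom C t). t \<cdot> u = h"
  shows "isomorphic C (Dom C t) (cosmash_ob (nil2 C) M N)"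
proof -
  let ?D = "nil2 C"
  note D = nil2_category
  note [simp] = nil2_simps
  have oM [simp]: "M \<in> Obj C" "N \<in> Obj C" "R \<in> Obj C" using n R by simp_all
  have ijt: "i \<in> Arr C" "Dom C i = M" "Cod C i = R" "j \<in> Arr C" "Dom C j = N" "Cod C j = R"
    and abt: "a \<in> Arr C" "Dom C a = R" "Cod C a = M" "b \<in> Arr C" "Dom C b = R" "Cod C b = N"
    using ij ab by (simp_all add: hom_iff)
  have ijD: "i \<in> hom ?D M R" "j \<in> hom ?D N R" using ij n R by (simp_all add: nil2_hom)
  define T where "T = Dom C t"
  have tt: "t \<in> Arr C" "Dom C t = T" "Cod C t = R" "T \<in> Obj C" "a \<cdot> t = zro T M" "b \<cdot> t = zro T N"
    using is_mono_arr[OF t(1)] t(2-4) by (simp_all add: T_def)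
  have nT: "nilp2 T" by (rule nilp2_mono[OF R t(1,2)]) (simp add: T_def)
  have coR: "is_coproduct ?D M N i j" unfolding is_coproduct_def
  proof (intro conjI allI ballI)
    show "\<exists>!h. h \<in> hom ?D (Cod ?D i) X \<and> h \<cdot>\<^bsub>?D\<^esub> i = f \<and> h \<cdot>\<^bsub>?D\<^esub> j = g"
      if "f \<in> hom ?D M X" "g \<in> hom ?D N X" for X f g
      using cop[of X f g] that R ijt by (simp add: nil2_hom)
  qed (use n R ij in \<open>simp_all add: nil2_hom hom_iff\<close>)
  define I1 I2 P where "I1 = inj1 ?D M N" and "I2 = inj2 ?D M N" and "P = coprod_ob ?D M N"
  have coP: "is_coproduct ?D M N I1 I2" unfolding I1_def I2_def by (rule category.inj_is_coproduct[OF D coR])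
  have P: "Cod C I1 = P" by (simp add: I1_def P_def coprod_ob_def)
  have I: "I1 \<in> hom ?D M P" "I2 \<in> hom ?D N P" using category.coproductD[OF D coP] P by simp_all
  define p1 p2 X where "p1 = proj1 ?D M N" and "p2 = proj2 ?D M N" and "X = prod_ob ?D M N"
  have prX: "is_product ?D M N p1 p2" unfolding p1_def p2_def by (rule category.proj_is_product[OF D nil2_product[OF n]])
  have X: "Dom C p1 = X" by (simp add: p1_def X_def prod_ob_def)
  have p: "p1 \<in> hom ?D X M" "p2 \<in> hom ?D X N" using category.productD[OF D prX] X by simp_all
  have nPX: "nilp2 P" "nilp2 X" using I p by (simp_all add: nil2_hom)
  have [simp]: "P \<in> Obj C" "X \<in> Obj C" using nPX by simp_all
  have It: "I1 \<in> Arr C" "Dom C I1 = M" "Cod C I1 = P" "I2 \<in> Arr C" "Dom C I2 = N" "Cod C I2 = P"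
    and pt: "p1 \<in> Arr C" "Dom C p1 = X" "Cod C p1 = M" "p2 \<in> Arr C" "Dom C p2 = X" "Cod C p2 = N"
    using I p by (simp_all add: nil2_hom hom_iff)
  define x where "x = tuple ?D (ide M) (zro M N)"
  define y where "y = tuple ?D (zro N M) (ide N)"
  have "x \<in> hom ?D M X \<and> p1 \<cdot>\<^bsub>?D\<^esub> x = ide M \<and> p2 \<cdot>\<^bsub>?D\<^esub> x = zro M N"
    unfolding x_def p1_def p2_def X_def
    by (rule category.tuple_props[OF D prX[unfolded p1_def p2_def]]) (use n in \<open>simp_all add: nil2_hom hom_iff\<close>)
  then have x: "x \<in> Arr C" "Dom C x = M" "Cod C x = X" "p1 \<cdot> x = ide M" "p2 \<cdot> x = zro M N" by (simp_all add: nil2_hom hom_iff)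
  have "y \<in> hom ?D N X \<and> p1 \<cdot>\<^bsub>?D\<^esub> y = zro N M \<and> p2 \<cdot>\<^bsub>?D\<^esub> y = ide N"
    unfolding y_def p1_def p2_def X_def
    by (rule category.tuple_props[OF D prX[unfolded p1_def p2_def]]) (use n in \<open>simp_all add: nil2_hom hom_iff\<close>)
  then have y: "y \<in> Arr C" "Dom C y = N" "Cod C y = X" "p1 \<cdot> y = zro N M" "p2 \<cdot> y = ide N" by (simp_all add: nil2_hom hom_iff)
  define \<sigma> where "\<sigma> = cotuple ?D x y"
  have "\<sigma> \<in> hom ?D P X \<and> \<sigma> \<cdot>\<^bsub>?D\<^esub> I1 = x \<and> \<sigma> \<cdot>\<^bsub>?D\<^esub> I2 = y"
    unfolding \<sigma>_def I1_def I2_def P_def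
    by (rule category.cotuple_props[OF D coP[unfolded I1_def I2_def]]) (use n nPX x y in \<open>simp_all add: nil2_hom hom_iff\<close>)
  then have s: "\<sigma> \<in> Arr C" "Dom C \<sigma> = P" "Cod C \<sigma> = X" "\<sigma> \<cdot> I1 = x" "\<sigma> \<cdot> I2 = y" by (simp_all add: nil2_hom hom_iff)
  define \<kappa> K where "\<kappa> = kernel ?D \<sigma>" and "K = Dom C \<kappa>"
  have K: "K = cosmash_ob ?D M N" using n by (simp add: K_def \<kappa>_def \<sigma>_def x_def y_def cosmash_ob_def cosmash_def nil2_zro)
  have kk: "is_kernel ?D \<sigma> \<kappa>" unfolding \<kappa>_def
    by (rule category.kernel_is_kernel[OF D nil2_kernel[OF _ ker_is_kernel[OF s(1)]]]) (use s nPX in \<open>simp add: nil2_Arr\<close>)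
  then have "\<kappa> \<in> hom ?D K P" "\<sigma> \<cdot> \<kappa> = zero_arr ?D K X" unfolding is_kernel_def using s by (simp_all add: K_def)
  then have k: "\<kappa> \<in> Arr C" "Dom C \<kappa> = K" "Cod C \<kappa> = P" "nilp2 K" "\<sigma> \<cdot> \<kappa> = zro K X"
    using nPX by (auto simp: nil2_hom hom_iff nil2_zro)
  have [simp]: "K \<in> Obj C" using k(4) by simp
  \<comment> \<open>A kernel in the core is tested on two-nilpotent \<open>W\<close> only; this
    suffices, since it is applied to the domains of \<open>t\<close> and of \<open>\<kappa>\<close>,
    both two-nilpotent.\<close>
  have kfac: "\<exists>!u. u \<in> hom C W K \<and> \<kappa> \<cdot> u = h" if "h \<in> hom C W P" "\<sigma> \<cdot> h = zro W X" "nilp2 W" for W h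
  proof -
    have "\<forall>X'. \<forall>h \<in> hom ?D X' (Dom ?D \<sigma>). \<sigma> \<cdot>\<^bsub>?D\<^esub> h = zero_arr ?D X' (Cod ?D \<sigma>) \<longrightarrow>
        (\<exists>!u. u \<in> hom ?D X' (Dom ?D \<kappa>) \<and> \<kappa> \<cdot>\<^bsub>?D\<^esub> u = h)"
      using kk unfolding is_kernel_def by (elim conjE)
    then show ?thesis using that s(2,3) nPX k(2,4) by (simp add: nil2_hom nil2_zro)
  qed
  obtain \<theta> where "\<theta> \<in> hom ?D (Cod ?D i) P" "\<theta> \<cdot>\<^bsub>?D\<^esub> i = I1" "\<theta> \<cdot>\<^bsub>?D\<^esub> j = I2"
    by (rule category.coproduct_factor[OF D coR I])
  then have th: "\<theta> \<in> Arr C" "Dom C \<theta> = R" "Cod C \<theta> = P" "\<theta> \<cdot> i = I1" "\<theta> \<cdot> j = I2" using ijt by (simp_all add: nil2_hom hom_iff)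
  obtain \<theta>' where "\<theta>' \<in> hom ?D (Cod ?D I1) R" "\<theta>' \<cdot>\<^bsub>?D\<^esub> I1 = i" "\<theta>' \<cdot>\<^bsub>?D\<^esub> I2 = j"
    by (rule category.coproduct_factor[OF D coP ijD])
  then have th': "\<theta>' \<in> Arr C" "Dom C \<theta>' = P" "Cod C \<theta>' = R" "\<theta>' \<cdot> I1 = i" "\<theta>' \<cdot> I2 = j" using P by (simp_all add: nil2_hom hom_iff)
  have extR: "f = g" if "f \<in> hom C R Y" "g \<in> hom C R Y" "nilp2 Y" "f \<cdot> i = g \<cdot> i" "f \<cdot> j = g \<cdot> j" for f g Y
    by (rule category.coproduct_ext[OF D coR]) (use that R ijt in \<open>simp_all add: nil2_hom\<close>)
  have extP: "f = g" if "f \<in> hom C P Y" "g \<in> hom C P Y" "nilp2 Y" "f \<cdot> I1 = g \<cdot> I1" "f \<cdot> I2 = g \<cdot> I2" for f g Y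
    by (rule category.coproduct_ext[OF D coP]) (use that nPX P in \<open>simp_all add: nil2_hom\<close>)
  have extX: "f = g" if "f \<in> hom C Y X" "g \<in> hom C Y X" "nilp2 Y" "p1 \<cdot> f = p1 \<cdot> g" "p2 \<cdot> f = p2 \<cdot> g" for f g Y
    by (rule category.product_ext[OF D prX]) (use that nPX X in \<open>simp_all add: nil2_hom\<close>)
  have tt': "\<theta>' \<cdot> \<theta> = ide R" by (rule extR[of _ R]) (use th th' ijt R in \<open>simp_all add: hom_iff\<close>)
  have t't: "\<theta> \<cdot> \<theta>' = ide P" by (rule extP[of _ P]) (use th th' It nPX in \<open>simp_all add: hom_iff\<close>)
  \<comment> \<open>Both sides are determined on \<open>i\<close> and \<open>j\<close>, where they
    give the rows of the identity matrix. The same holds for the next three equations.\<close>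
  have sa: "p1 \<cdot> (\<sigma> \<cdot> \<theta>) = a" by (rule extR[of _ M]) (use th s x y pt ijt abt e n in \<open>simp_all add: hom_iff\<close>)
  have sb: "p2 \<cdot> (\<sigma> \<cdot> \<theta>) = b" by (rule extR[of _ N]) (use th s x y pt ijt abt e n in \<open>simp_all add: hom_iff\<close>)
  have sa': "a \<cdot> \<theta>' = p1 \<cdot> \<sigma>" by (rule extP[of _ M]) (use th' s x y pt It abt e n in \<open>simp_all add: hom_iff\<close>)
  have sb': "b \<cdot> \<theta>' = p2 \<cdot> \<sigma>" by (rule extP[of _ N]) (use th' s x y pt It abt e n in \<open>simp_all add: hom_iff\<close>)
  have "\<sigma> \<cdot> (\<theta> \<cdot> t) = zro T X"
    by (rule extX[of _ T]) (use sa[THEN reassoc, of t] sb[THEN reassoc, of t] th s tt pt nT in \<open>simp_all add: hom_iff\<close>)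
  then have "\<exists>!u. u \<in> hom C T K \<and> \<kappa> \<cdot> u = \<theta> \<cdot> t" by (intro kfac) (use th tt nT in \<open>simp_all add: hom_iff\<close>)
  then obtain f where f: "f \<in> Arr C" "Dom C f = T" "Cod C f = K" "\<kappa> \<cdot> f = \<theta> \<cdot> t" by (auto simp: hom_iff)
  have "a \<cdot> (\<theta>' \<cdot> \<kappa>) = zro K M" using sa'[THEN reassoc, of \<kappa>] k s pt th' abt by simp
  moreover have "b \<cdot> (\<theta>' \<cdot> \<kappa>) = zro K N" using sb'[THEN reassoc, of \<kappa>] k s pt th' abt by simp
  ultimately have "\<exists>u \<in> hom C (Dom C (\<theta>' \<cdot> \<kappa>)) (Dom C t). t \<cdot> u = \<theta>' \<cdot> \<kappa>"
    by (intro tfac) (use th' k in simp_all)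
  then obtain g where g: "g \<in> Arr C" "Dom C g = K" "Cod C g = T" "t \<cdot> g = \<theta>' \<cdot> \<kappa>" using th' k tt(2) by (auto simp: hom_iff)
  have "t \<cdot> (g \<cdot> f) = t \<cdot> ide T"
    using g(4)[THEN reassoc, of f] tt'[THEN reassoc, of t] f g(1-3) th th' k tt by simp
  then have gf: "g \<cdot> f = ide T" by (rule is_mono_cancel[OF t(1)]) (use f g tt in simp_all)
  have e1: "\<kappa> \<cdot> (f \<cdot> g) = \<kappa>"
    using f(4)[THEN reassoc, of g] t't[THEN reassoc, of \<kappa>] f(1-3) g th th' k tt by simp
  have "\<exists>!u. u \<in> hom C K K \<and> \<kappa> \<cdot> u = \<kappa>" by (rule kfac) (use k in \<open>simp_all add: hom_iff\<close>)
  moreover have "f \<cdot> g \<in> hom C K K" "ide K \<in> hom C K K" using f g by (simp_all add: hom_iff)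
  moreover have "\<kappa> \<cdot> ide K = \<kappa>" using k by simp
  ultimately have fg: "f \<cdot> g = ide K" using e1 by blast
  have "is_iso C f" by (rule is_isoI[of f g]) (use f g gf fg in simp_all)
  then show ?thesis using f unfolding isomorphic_def K[symmetric] T_def[symmetric] by (intro bexI[of _ f]) (simp_all add: hom_iff)
qed

end

theorem theorem7p4:
  fixes C :: "('o, 'a) cat" and M N :: 'o
  assumes "semi_abelian C"
    and "algebraically_coherent C"
    and "abelian_object C M"
    and "abelian_object C N"
  shows "isomorphic C
           (tensor C (groupoid_over_zero C M) (groupoid_over_zero C N))
           (cosmash_ob (nil2 C) M N)"
proof -
  interpret coherent_category C
    by (intro coherent_category.intro semi_abelian_category.intro coherent_category_axioms.intro assms)
  have M: "M \<in> Obj C" "coop (ide M) (ide M)" and N: "N \<in> Obj C" "coop (ide N) (ide N)"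
    using assms(3,4) by (simp_all add: abelian_object_iff)
  show ?thesis
  proof (rule tensor_over_zero[OF M N], goal_cases)
    case prems: (1 R i j a b t)
    \<comment> \<open>Abelian objects are two-nilpotent, so \<open>M\<close> and \<open>N\<close>
      are objects of the core.\<close>
    have "isomorphic C (Dom C t) (cosmash_ob (nil2 C) M N)"
      by (rule cosmash_nil2[OF self_coop_nilp2[OF M] self_coop_nilp2[OF N] prems(1-10) prems(12-16)])
    then show ?case by (simp only: prems(11))
  qed
qed

end
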